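(* Let $\mathcal R$ be a take-it-or-leave-it size rule. Then $t_{\mathrm b}^{\mathcal R}=t_{\mathrm c}^{\mathcal R}$. More precisely, for any $t>t_{\mathrm b}^{\mathcal R}$ and $\varepsilon>0$ there exist $\delta,n_0>0$ (depending only on $\mathcal R,t,\varepsilon$) such that $\Pr(L_1(G_{tn}^{\mathcal R})\ge\delta n)\ge1-\varepsilon$ for $n\ge n_0$. Moreover, for any $\varepsilon>0$ there is an $\alpha>0$ such that whp $L_1(G^{\mathcal R}_{(t_{\mathrm b}^{\mathcal R}+\varepsilon)n})\ge\alpha n$.
   Context: An Achlioptas process with a size rule $\mathcal R$ (fixed, not depending on $n$) is, for each $n$, a random sequence $(G_i^{\mathcal R})_{i\ge0}$ of graphs on $[n]$: $G_0^{\mathcal R}$ is the empty graph (no edges); in step $i+1$ two potential edges $e_1,e_2$ are chosen independently and uniformly at random from all $\binom n2$ possible edges (independently of previous steps; equivalently for present purposes, $e_1=v_1v_2$ and $e_2=v_3v_4$ with $v_1,\ldots,v_4$ independent uniform vertices), and exactly one of them, selected by $\mathcal R$ based only on the list of sizes (numbers of vertices) of the four components of $G_i^{\mathcal R}$ containing the endvertices of $e_1$ and $e_2$, is added to form $G_{i+1}^{\mathcal R}$. Thus these are $4$-vertex size rules. An Achlioptas rule is take-it-or-leave-it if the decision which of $e_1,e_2$ to select depends only on the current graph and on $e_1$ (the rule first sees $e_1$ and decides whether to take it; if not, it selects the uniformly random edge $e_2$). A take-it-or-leave-it size rule is a size rule with this property, so the decision depends only on the sizes of the components containing the endvertices of $e_1$.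 It is not assumed to be bounded-size. $L_1(G)$ is the number of vertices in a largest component of $G$; $S(G)=\sum_{k}kN_k(G)/n$ for an $n$-vertex graph $G$, where $N_k(G)$ is the number of vertices in components of size $k$. $t_{\mathrm c}^{\mathcal R}$ is the supremum of the set of $t\ge0$ for which $L_1(G_{tn}^{\mathcal R})/n\overset{\mathrm p}{\to}0$ as $n\to\infty$; $t_{\mathrm b}^{\mathcal R}$ is the supremum of the set of $t\ge0$ for which $S(G_{tn}^{\mathcal R})$ is bounded in probability (as $n\to\infty$); for size rules the latter equals the infimum of the set of $t\ge 0$ for which $S(G_{tn}^{\mathcal R})\overset{\mathrm p}{\to}\infty$. "Whp" means with probability tending to $1$ as $n\to\infty$. Rounding to integers is ignored. *)

theory Defs
  imports "HOL-Probability.Probability"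
begin

type_synonym graph = "nat set set"

text \<open>The vertex set is always \<^term>\<open>{1..n}\<close>; a graph is its set of edges.\<close>

definition component :: "nat \<Rightarrow> graph \<Rightarrow> nat \<Rightarrow> nat set" where
  "component n E v = {w \<in> {1..n}. (v, w) \<in> {(x, y). {x, y} \<in> E}\<^sup>*}"

definition comp_size :: "nat \<Rightarrow> graph \<Rightarrow> nat \<Rightarrow> nat" where
  "comp_size n E v = card (component n E v)"

definition L1 :: "nat \<Rightarrow> graph \<Rightarrow> nat" where
  "L1 n E = Max (comp_size n E ` {1..n})"

definition N :: "nat \<Rightarrow> graph \<Rightarrow> nat \<Rightarrow> nat" where
  "N n E k = card {v \<in> {1..n}. comp_size n E v = k}"

definition susceptibility :: "nat \<Rightarrow> graph \<Rightarrow> real" where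
  "susceptibility n E = (\<Sum>k=1..n. real k * real (N n E k)) / real n"

text \<open>
  A (4-vertex) size rule maps the list of the sizes of the components of the endvertices
  of \<open>e\<^sub>1 = v\<^sub>1v\<^sub>2\<close> and \<open>e\<^sub>2 = v\<^sub>3v\<^sub>4\<close> to a decision; \<^term>\<open>True\<close> means that \<open>e\<^sub>1\<close> is selected.
\<close>

type_synonym size_rule = "nat \<Rightarrow> nat \<Rightarrow> nat \<Rightarrow> nat \<Rightarrow> bool"

definition take_it_or_leave_it :: "size_rule \<Rightarrow> bool" where
  "take_it_or_leave_it R \<longleftrightarrow>
     (\<exists>T :: nat \<Rightarrow> nat \<Rightarrow> bool. \<forall>c1 c2 c3 c4. R c1 c2 c3 c4 \<longleftrightarrow> T c1 c2)"

type_synonym choice = "(nat \<times> nat) \<times> (nat \<times> nat)"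

text \<open>
  A potential edge is represented by an ordered pair of distinct vertices, so that the list of
  component sizes is well defined. A uniformly random such pair induces a uniformly random
  unordered edge.
\<close>

definition potential_edges :: "nat \<Rightarrow> (nat \<times> nat) set" where
  "potential_edges n = {(u, v). u \<in> {1..n} \<and> v \<in> {1..n} \<and> u \<noteq> v}"

definition choice_pmf :: "nat \<Rightarrow> choice pmf" where
  "choice_pmf n = pair_pmf (pmf_of_set (potential_edges n)) (pmf_of_set (potential_edges n))"

text \<open>The probability space of the independent choices made in all steps.\<close>

definition choices :: "nat \<Rightarrow> (nat \<Rightarrow> choice) measure" where
  "choices n = (\<Pi>\<^sub>M i\<in>UNIV. measure_pmf (choice_pmf n))"

fun selected_edge :: "size_rule \<Rightarrow> nat \<Rightarrow> graph \<Rightarrow> choice \<Rightarrow> nat set" where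
  "selected_edge R n E ((v1, v2), (v3, v4)) =
     (if R (comp_size n E v1) (comp_size n E v2) (comp_size n E v3) (comp_size n E v4)
      then {v1, v2} else {v3, v4})"

primrec achlioptas :: "size_rule \<Rightarrow> nat \<Rightarrow> nat \<Rightarrow> (nat \<Rightarrow> choice) \<Rightarrow> graph" where
  "achlioptas R n 0 \<omega> = {}"
| "achlioptas R n (Suc i) \<omega> =
     insert (selected_edge R n (achlioptas R n i \<omega>) (\<omega> i)) (achlioptas R n i \<omega>)"

lemma achlioptas_measurable:
  "achlioptas R n i \<in> measurable (choices n) (count_space UNIV)"
proof -
  have *: "(\<lambda>\<omega>. map \<omega> [0..<i]) \<in> measurable (choices n) (count_space UNIV)" for i :: nat
  proof (induction i)
    case (Suc i)
    have "(\<lambda>\<omega>. \<omega> i) \<in> measurable (choices n) (measure_pmf (choice_pmf n))"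
      unfolding choices_def by (rule measurable_component_singleton) simp
    then have c: "(\<lambda>\<omega>. \<omega> i) \<in> measurable (choices n) (count_space UNIV)"
      by simp
    have "(\<lambda>\<omega>. map \<omega> [0..<i] @ [\<omega> i]) \<in> measurable (choices n) (count_space UNIV)"
    proof (rule measurable_compose_countable[where f = "\<lambda>c \<omega>. map \<omega> [0..<i] @ [c]", OF _ c])
      fix c :: choice
      show "(\<lambda>\<omega>. map \<omega> [0..<i] @ [c]) \<in> measurable (choices n) (count_space UNIV)"
        by (rule measurable_compose[OF Suc.IH, where g = "\<lambda>xs. xs @ [c]"]) simp
    qed
    then show ?case by simp
  qed simp
  have eq: "achlioptas R n i = (\<lambda>\<omega>. foldl (\<lambda>E c. insert (selected_edge R n E c) E) {} (map \<omega> [0..<i]))"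
  proof
    show "achlioptas R n i \<omega> = foldl (\<lambda>E c. insert (selected_edge R n E c) E) {} (map \<omega> [0..<i])" for \<omega>
      by (induction i) simp_all
  qed
  show ?thesis
    unfolding eq by (rule measurable_compose[OF *]) simp
qed

text \<open>The graph \<open>G\<^bsub>tn\<^esub>\<close>, with \<open>tn\<close> rounded down.\<close>

definition graph_at :: "size_rule \<Rightarrow> nat \<Rightarrow> real \<Rightarrow> (nat \<Rightarrow> choice) \<Rightarrow> graph" where
  "graph_at R n t = achlioptas R n (nat \<lfloor>t * real n\<rfloor>)"

text \<open>
  Convergence in probability to 0 and boundedness in probability, for random variables \<open>X n\<close>
  living on probability spaces \<open>M n\<close> that vary with \<open>n\<close>.
\<close>

definition tends_to_0_in_prob :: "(nat \<Rightarrow> 'a measure) \<Rightarrow> (nat \<Rightarrow> 'a \<Rightarrow> real) \<Rightarrow> bool" where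
  "tends_to_0_in_prob M X \<longleftrightarrow>
     (\<forall>\<epsilon>>0. (\<lambda>n. \<P>(\<omega> in M n. \<bar>X n \<omega>\<bar> > \<epsilon>)) \<longlonglongrightarrow> 0)"

definition bounded_in_prob :: "(nat \<Rightarrow> 'a measure) \<Rightarrow> (nat \<Rightarrow> 'a \<Rightarrow> real) \<Rightarrow> bool" where
  "bounded_in_prob M X \<longleftrightarrow>
     (\<forall>\<epsilon>>0. \<exists>K. \<forall>\<^sub>F n in sequentially. \<P>(\<omega> in M n. \<bar>X n \<omega>\<bar> > K) \<le> \<epsilon>)"

definition t_c :: "size_rule \<Rightarrow> real" where
  "t_c R = Sup {t. t \<ge> 0 \<and>
     tends_to_0_in_prob choices (\<lambda>n \<omega>. real (L1 n (graph_at R n t \<omega>)) / real n)}"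

definition t_b :: "size_rule \<Rightarrow> real" where
  "t_b R = Sup {t. t \<ge> 0 \<and>
     bounded_in_prob choices (\<lambda>n \<omega>. susceptibility n (graph_at R n t \<omega>))}"

end

theory Submission
  imports Defs
begin

text \<open>For a graph on \<open>n\<close> vertices let \<open>S\<close> be the susceptibility, the mean component size of a random vertex, let
\<open>A\<^sub>k\<close> be the mean of the component size truncated at \<open>k\<close> (\<open>trunc_susc\<close>), and let \<open>X\<close> be the mean
squared component size. The heart of the matter is that at time \<open>t_b\<close> not only \<open>S\<close> but already \<open>A\<^sub>k\<close>, for a
suitable constant \<open>k\<close>, is as large as desired with high probability (\<open>trunc_susc_blowup\<close>). A large \<open>S\<close> alone would
be useless, as it may be due to a few components of size about \<open>sqrt n\<close>.

This blow-up holds for every four-vertex size rule. While \<open>S \<le> K\<close>, the mean of \<open>X\<close> grows at most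
exponentially, so \<open>S - A\<^sub>k \<le> X/k\<close> is small for large \<open>k\<close> (\<open>susc2_bound\<close>). Moreover, two independent
processes on \<open>n\<close> and \<open>m\<close> vertices have almost the same component size law as long as both susceptibilities
are at most \<open>K\<close> (\<open>compare_processes\<close>): the drift of the size law is Lipschitz in the \<open>\<ell>\<^sub>1\<close> norm in the
one-sided sense needed for a Gronwall argument (\<open>drift_difference\<close>). If now \<open>A\<^sub>k(t_b)\<close> failed to exceed \<open>L\<close> with high
probability for every \<open>k\<close>, it would be below \<open>L\<close> with a probability bounded away from 0 for infinitely
many \<open>m\<close>; comparison with these \<open>m\<close> shows \<open>A\<^sub>k(t) \<le> L + 1\<close> and hence \<open>S(t) \<le> L + 2\<close> with high
probability for all \<open>t < t_b\<close> and all large \<open>n\<close> (\<open>susc_upper_whp\<close>). But a susceptibility bounded by \<open>M\<close>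
with high probability stays bounded for a further time of order \<open>1/M\<close> (\<open>susc_forward\<close>), which contradicts the choice
of \<open>t_b\<close>.

Take-it-or-leave-it rules are special because they contain uniform sprinkling: at any positive time, with high
probability every potential edge is added next with at least \<open>\<eta>\<close> times its uniform probability
(\<open>elliptic_rarely_fails\<close>). Either all first edges are accepted, or some pair of sizes that is present with positive
density is rejected, and the second edge is uniform. Sprinkling for a time \<open>\<epsilon>\<close> turns a large \<open>A\<^sub>k\<close> into a giant
component in two phases, both of the form that a bounded statistic with \<open>s' \<ge> const s\<^sup>2\<close> would have to
blow up (\<open>reciprocal_growth\<close>). In the first one, \<open>s = A\<^sub>k\<close> with \<open>k = 2h\<close>, and the phase can only end with many
vertices in components of size at least \<open>h\<close>; in the second one, \<open>s\<close> is essentially the number of merges of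
such components, and the phase can only end with a component of linear size.

Finally \<open>L\<^sub>1\<^sup>2 \<le> n S\<close> shows that there is no giant component before \<open>t_b\<close>. Concentration is always obtained from
squared excesses over a moving line, whose expectation is followed step by step (\<open>drift_concentration\<close>); stopping
times are replaced by events that can only be left.\<close>

section \<open>Expectations over finitely supported distributions\<close>

abbreviation expect :: "'a pmf \<Rightarrow> ('a \<Rightarrow> real) \<Rightarrow> real" where
  "expect p f \<equiv> measure_pmf.expectation p f"

abbreviation pr :: "'a pmf \<Rightarrow> ('a \<Rightarrow> bool) \<Rightarrow> real" where
  "pr p P \<equiv> expect p (\<lambda>x. of_bool (P x))"

lemma expect_mono:
  assumes "finite (set_pmf p)" "\<And>x. x \<in> set_pmf p \<Longrightarrow> f x \<le> g x"
  shows "expect p f \<le> expect p g"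
  using assms by (intro integral_mono_AE) (auto simp: integrable_measure_pmf_finite AE_measure_pmf_iff)

lemma expect_cong:
  assumes "\<And>x. x \<in> set_pmf p \<Longrightarrow> f x = g x"
  shows "expect p f = expect p g"
  using assms by (intro integral_cong_AE) (auto simp: AE_measure_pmf_iff)

lemma expect_nonneg: "(\<And>x. x \<in> set_pmf p \<Longrightarrow> 0 \<le> f x) \<Longrightarrow> 0 \<le> expect p f"
  by (intro integral_nonneg_AE) (auto simp: AE_measure_pmf_iff)

lemma expect_add:
  "finite (set_pmf p) \<Longrightarrow> expect p (\<lambda>x. f x + g x) = expect p f + expect p g"
  by (intro Bochner_Integration.integral_add integrable_measure_pmf_finite)

lemma expect_diff:
  "finite (set_pmf p) \<Longrightarrow> expect p (\<lambda>x. f x - g x) = expect p f - expect p g"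
  by (intro Bochner_Integration.integral_diff integrable_measure_pmf_finite)

lemma expect_bind:
  assumes "finite (set_pmf p)" "\<And>x. x \<in> set_pmf p \<Longrightarrow> finite (set_pmf (k x))"
  shows "expect (bind_pmf p k) f = expect p (\<lambda>x. expect (k x) f)"
  using assms by (subst pmf_expectation_bind[where A = "set_pmf p"])
    (auto simp: integral_measure_pmf[where A = "set_pmf p"])

lemma expect_pair:
  assumes "finite (set_pmf p)" "finite (set_pmf q)"
  shows "expect (pair_pmf p q) f = expect p (\<lambda>x. expect q (\<lambda>y. f (x, y)))"
  using assms by (simp add: pair_pmf_def expect_bind)

lemma pr_le_1: "finite (set_pmf p) \<Longrightarrow> pr p P \<le> 1"
  using expect_mono[of p "\<lambda>x. of_bool (P x)" "\<lambda>x. 1"] by simp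

lemma pr_nonneg: "0 \<le> pr p P"
  by (rule expect_nonneg) simp

lemma pr_mono:
  assumes "finite (set_pmf p)" "\<And>x. x \<in> set_pmf p \<Longrightarrow> P x \<Longrightarrow> Q x"
  shows "pr p P \<le> pr p Q"
  using assms by (intro expect_mono) auto

lemma pr_Un:
  assumes "finite (set_pmf p)" "\<And>x. x \<in> set_pmf p \<Longrightarrow> P x \<Longrightarrow> Q x \<or> Q' x"
  shows "pr p P \<le> pr p Q + pr p Q'"
proof -
  have "pr p P \<le> expect p (\<lambda>x. of_bool (Q x) + of_bool (Q' x))"
    using assms by (intro expect_mono) (auto simp: of_bool_def)
  then show ?thesis using assms by (simp add: expect_add)
qed

lemma pr_not: "finite (set_pmf p) \<Longrightarrow> pr p (\<lambda>x. \<not> P x) = 1 - pr p P"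
  using expect_diff[of p "\<lambda>x. 1" "\<lambda>x. of_bool (P x)"] by (simp add: of_bool_not_iff)

lemma pr_markov:
  assumes "finite (set_pmf p)" "\<And>x. x \<in> set_pmf p \<Longrightarrow> 0 \<le> f x" "0 < c"
    "\<And>x. x \<in> set_pmf p \<Longrightarrow> P x \<Longrightarrow> c \<le> f x"
  shows "pr p P \<le> expect p f / c"
proof -
  have "pr p P \<le> expect p (\<lambda>x. f x / c)"
    using assms by (intro expect_mono) auto
  then show ?thesis by simp
qed

lemma pr_tendsto_0I:
  assumes "\<And>\<epsilon>. 0 < \<epsilon> \<Longrightarrow> \<forall>\<^sub>F n in sequentially. pr (p n) (P n) < \<epsilon>"
  shows "(\<lambda>n. pr (p n) (P n)) \<longlonglongrightarrow> 0"
proof (rule order_tendstoI)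
  fix x :: real assume "x < 0"
  then have "x < pr (p n) (P n)" for n by (rule less_le_trans) (rule pr_nonneg)
  then show "\<forall>\<^sub>F n in sequentially. x < pr (p n) (P n)" by (rule always_eventually[OF allI])
qed (rule assms)

section \<open>Components and averages over vertices\<close>

definition joined :: "graph \<Rightarrow> nat \<Rightarrow> nat \<Rightarrow> bool" where
  "joined E u v \<longleftrightarrow> (u, v) \<in> {(x, y). {x, y} \<in> E}\<^sup>*"

lemma component_joined: "component n E v = {w \<in> {1..n}. joined E v w}"
  by (simp add: component_def joined_def)

lemma joined_refl: "joined E u u"
  by (simp add: joined_def)

lemma joined_sym: "joined E u v \<Longrightarrow> joined E v u"
proof -
  have "sym {(x, y). {x, y} \<in> E}" by (auto simp: sym_def insert_commute)
  then show "joined E u v \<Longrightarrow> joined E v u" unfolding joined_def by (meson sym_rtrancl symD)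
qed

lemma joined_trans: "joined E u v \<Longrightarrow> joined E v w \<Longrightarrow> joined E u w"
  unfolding joined_def by (rule rtrancl_trans)

lemma joined_insert:
  "joined (insert {u, v} E) w z \<longleftrightarrow>
     joined E w z \<or> joined E w u \<and> joined E v z \<or> joined E w v \<and> joined E u z"
proof -
  have "{(x, y). {x, y} \<in> insert {u, v} E} = insert (u, v) (insert (v, u) {(x, y). {x, y} \<in> E})"
    by (auto simp: doubleton_eq_iff)
  then have "joined (insert {u, v} E) w z \<longleftrightarrow>
      (joined E w z \<or> joined E w v \<and> joined E u z) \<or>
      (joined E w u \<or> joined E w v) \<and> (joined E v z \<or> joined E u z)"
    by (simp add: joined_def rtrancl_insert)
  moreover have "joined E w x \<Longrightarrow> joined E x z \<Longrightarrow> joined E w z" for x by (rule joined_trans)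
  ultimately show ?thesis by blast
qed

lemma finite_component [simp]: "finite (component n E v)"
  by (simp add: component_def)

lemma component_eq_iff:
  assumes "u \<in> {1..n}" "v \<in> {1..n}"
  shows "component n E u = component n E v \<longleftrightarrow> v \<in> component n E u"
proof
  assume "component n E u = component n E v"
  then show "v \<in> component n E u" using assms joined_refl by (auto simp: component_joined)
next
  assume "v \<in> component n E u"
  then have "joined E u v" "joined E v u" by (auto simp: component_joined dest: joined_sym)
  then show "component n E u = component n E v"
    unfolding component_joined by (metis joined_trans)
qed

lemma component_disjoint:
  "v \<in> {1..n} \<Longrightarrow> v \<notin> component n E u \<Longrightarrow> component n E u \<inter> component n E v = {}"
  unfolding component_joined using joined_sym joined_trans by blast

lemma self_in_component: "v \<in> {1..n} \<Longrightarrow> v \<in> component n E v"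
  by (simp add: component_joined joined_refl)

lemma component_subset: "component n E v \<subseteq> {1..n}"
  by (auto simp: component_joined)

lemma component_insert:
  assumes "u \<in> {1..n}" "v \<in> {1..n}" "w \<in> {1..n}"
  shows "component n (insert {u, v} E) w =
    (if w \<in> component n E u \<union> component n E v then component n E u \<union> component n E v
     else component n E w)"
proof -
  have s: "joined E x y = joined E y x" for x y using joined_sym by blast
  have t: "joined E x y \<Longrightarrow> joined E y z \<Longrightarrow> joined E x z" for x y z by (rule joined_trans)
  show ?thesis
  proof (cases "joined E u w \<or> joined E v w")
    case True
    then have "joined (insert {u, v} E) w z \<longleftrightarrow> joined E u z \<or> joined E v z" for z
      unfolding joined_insert using s t by blast
    then show ?thesis using True assms by (auto simp: component_joined)
  next
    case False
    then have "joined (insert {u, v} E) w z \<longleftrightarrow> joined E w z" for z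
      unfolding joined_insert using s by blast
    then show ?thesis using False assms by (auto simp: component_joined)
  qed
qed

lemma comp_size_pos: "v \<in> {1..n} \<Longrightarrow> 1 \<le> comp_size n E v"
  using self_in_component[of v n E]
  by (auto simp: comp_size_def Suc_le_eq card_gt_0_iff)

lemma comp_size_le: "comp_size n E v \<le> n"
  using card_mono[OF _ component_subset, of n E v] by (simp add: comp_size_def)

lemma comp_size_component:
  "v \<in> {1..n} \<Longrightarrow> w \<in> component n E v \<Longrightarrow> comp_size n E w = comp_size n E v"
  using component_eq_iff[of v n w E] component_subset[of n E v] by (auto simp: comp_size_def)

lemma comp_size_empty: "v \<in> {1..n} \<Longrightarrow> comp_size n {} v = 1"
proof -
  assume "v \<in> {1..n}"
  then have "component n {} v = {v}" by (auto simp: component_def)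
  then show ?thesis by (simp add: comp_size_def)
qed

definition size_avg :: "nat \<Rightarrow> graph \<Rightarrow> (nat \<Rightarrow> real) \<Rightarrow> real" where
  "size_avg n E f = (\<Sum>v=1..n. f (comp_size n E v)) / n"

text \<open>When two components of sizes \<open>a\<close> and \<open>b\<close> merge, \<open>\<Sum>\<^sub>v f (|C(v)|)\<close> changes by exactly this amount,
so every statistic of the form \<^term>\<open>size_avg n E f\<close> has an explicit one-step drift.\<close>

definition merge_gain :: "(nat \<Rightarrow> real) \<Rightarrow> nat \<Rightarrow> nat \<Rightarrow> real" where
  "merge_gain f a b = (a + b) * f (a + b) - a * f a - b * f b"

definition gain :: "nat \<Rightarrow> graph \<Rightarrow> (nat \<Rightarrow> real) \<Rightarrow> nat \<times> nat \<Rightarrow> real" where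
  "gain n E f = (\<lambda>(u, v). if v \<in> component n E u then 0
     else merge_gain f (comp_size n E u) (comp_size n E v))"

lemma size_avg_insert:
  assumes "u \<in> {1..n}" "v \<in> {1..n}"
  shows "size_avg n (insert {u, v} E) f = size_avg n E f + gain n E f (u, v) / n"
proof -
  let ?C = "component n E u" and ?D = "component n E v" and ?c = "comp_size n E"
  let ?E = "insert {u, v} E"
  show ?thesis
  proof (cases "v \<in> ?C")
    case True
    then have "?C = ?D" using assms component_eq_iff by blast
    have "component n ?E w = component n E w" if "w \<in> {1..n}" for w
      using that assms True component_eq_iff[of u n w E] component_insert[OF assms that, of E]
      by (metis Un_absorb \<open>?C = ?D\<close>)
    then show ?thesis
      using True by (simp add: size_avg_def gain_def comp_size_def)
  next
    case False
    then have disj: "?C \<inter> ?D = {}" using assms component_disjoint by blast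
    have new: "comp_size n ?E w = (if w \<in> ?C \<union> ?D then ?c u + ?c v else ?c w)"
      if "w \<in> {1..n}" for w
      using component_insert[OF assms that, of E] disj
      by (simp add: comp_size_def card_Un_disjoint)
    have split: "(\<Sum>w=1..n. g w) = (\<Sum>w\<in>?C. g w) + (\<Sum>w\<in>?D. g w) + (\<Sum>w\<in>{1..n} - (?C \<union> ?D). g w)"
      for g :: "nat \<Rightarrow> real"
    proof -
      have "(\<Sum>w=1..n. g w) = (\<Sum>w\<in>{1..n} - (?C \<union> ?D). g w) + (\<Sum>w\<in>?C \<union> ?D. g w)"
        by (rule sum.subset_diff) (use component_subset in auto)
      also have "(\<Sum>w\<in>?C \<union> ?D. g w) = (\<Sum>w\<in>?C. g w) + (\<Sum>w\<in>?D. g w)"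
        by (rule sum.union_disjoint) (use disj in auto)
      finally show ?thesis by simp
    qed
    have "(\<Sum>w\<in>?C. f (?c w)) = ?c u * f (?c u)" "(\<Sum>w\<in>?D. f (?c w)) = ?c v * f (?c v)"
      using comp_size_component assms by (simp_all add: comp_size_def)
    moreover have "(\<Sum>w\<in>?C. f (comp_size n ?E w)) = ?c u * f (?c u + ?c v)"
      "(\<Sum>w\<in>?D. f (comp_size n ?E w)) = ?c v * f (?c u + ?c v)"
      using new component_subset by (simp_all add: comp_size_def subset_iff)
    moreover have "(\<Sum>w\<in>{1..n} - (?C \<union> ?D). f (comp_size n ?E w)) =
        (\<Sum>w\<in>{1..n} - (?C \<union> ?D). f (?c w))"
      using new by (intro sum.cong) auto
    ultimately have "(\<Sum>w=1..n. f (comp_size n ?E w)) = (\<Sum>w=1..n. f (?c w)) + merge_gain f (?c u) (?c v)"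
      unfolding split by (simp add: merge_gain_def algebra_simps)
    then show ?thesis using False by (simp add: size_avg_def gain_def add_divide_distrib)
  qed
qed

lemma size_avg_mono:
  "(\<And>k. 1 \<le> k \<Longrightarrow> k \<le> n \<Longrightarrow> f k \<le> g k) \<Longrightarrow> size_avg n E f \<le> size_avg n E g"
  unfolding size_avg_def
  using comp_size_le comp_size_pos by (intro divide_right_mono sum_mono) auto

lemma size_avg_cong:
  "(\<And>k. 1 \<le> k \<Longrightarrow> k \<le> n \<Longrightarrow> f k = g k) \<Longrightarrow> size_avg n E f = size_avg n E g"
  by (intro antisym size_avg_mono) auto

lemma size_avg_add: "size_avg n E (\<lambda>k. f k + g k) = size_avg n E f + size_avg n E g"
  by (simp add: size_avg_def sum.distrib add_divide_distrib)

lemma size_avg_diff: "size_avg n E (\<lambda>k. f k - g k) = size_avg n E f - size_avg n E g"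
  by (simp add: size_avg_def sum_subtractf diff_divide_distrib)

lemma size_avg_cmult: "size_avg n E (\<lambda>k. c * f k) = c * size_avg n E f"
  by (simp add: size_avg_def sum_distrib_left)

lemma size_avg_sum: "size_avg n E (\<lambda>k. \<Sum>i\<in>I. f i k) = (\<Sum>i\<in>I. size_avg n E (f i))"
  unfolding size_avg_def by (subst sum.swap) (simp add: sum_divide_distrib)

lemma size_avg_const: "n > 0 \<Longrightarrow> size_avg n E (\<lambda>_. c) = c"
  by (simp add: size_avg_def)

lemma size_avg_nonneg: "(\<And>k. 1 \<le> k \<Longrightarrow> k \<le> n \<Longrightarrow> 0 \<le> f k) \<Longrightarrow> 0 \<le> size_avg n E f"
  using size_avg_mono[of n "\<lambda>_. 0" f E] by (simp add: size_avg_def)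

lemma size_avg_empty: "n > 0 \<Longrightarrow> size_avg n {} f = f 1"
  using comp_size_empty[of _ n] by (simp add: size_avg_def)

lemma sum_size_avg: "(\<Sum>v=1..n. f (comp_size n E v)) = n * size_avg n E f"
  by (simp add: size_avg_def)

lemma sum_pairs_size_avg:
  "(\<Sum>u=1..n. \<Sum>v=1..n. f (comp_size n E u) * g (comp_size n E v)) =
     n\<^sup>2 * (size_avg n E f * size_avg n E g)"
  using sum_size_avg[of f n E] sum_size_avg[of g n E]
  by (simp add: sum_product[symmetric] power2_eq_square)

abbreviation frac_of_size :: "nat \<Rightarrow> graph \<Rightarrow> nat \<Rightarrow> real" where
  "frac_of_size n E j \<equiv> size_avg n E (\<lambda>k. of_bool (k = j))"

text \<open>Averages over vertices are expectations under the size distribution \<open>(frac_of_size n E a)\<^sub>a\<close>. The bound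
\<open>M\<close> may exceed \<open>n\<close> so that graphs on different vertex sets can be compared over one index set.\<close>

lemma size_avg_as_sum:
  assumes "n \<le> M"
  shows "size_avg n E f = (\<Sum>a=1..M. frac_of_size n E a * f a)"
proof -
  have "(\<Sum>a=1..M. frac_of_size n E a * f a) = size_avg n E (\<lambda>k. \<Sum>a=1..M. of_bool (k = a) * f a)"
    by (subst size_avg_sum) (simp add: size_avg_def sum_distrib_right)
  also have "\<dots> = size_avg n E f"
  proof (rule size_avg_cong)
    fix k assume k: "1 \<le> k" "k \<le> n"
    have "(\<Sum>a=1..M. of_bool (k = a) * f a) = (\<Sum>a=1..M. if k = a then f a else 0)"
      by (intro sum.cong) auto
    also have "\<dots> = f k" using k assms by simp
    finally show "(\<Sum>a=1..M. of_bool (k = a) * f a) = f k" .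
  qed
  finally show ?thesis ..
qed

lemma susceptibility_eq: "susceptibility n E = size_avg n E real"
proof -
  have "frac_of_size n E k = N n E k / n" for k
    by (simp add: N_def size_avg_def Int_def conj_commute)
  then have "susceptibility n E = (\<Sum>k=1..n. frac_of_size n E k * real k)"
    by (simp add: susceptibility_def sum_divide_distrib mult.commute)
  also have "\<dots> = size_avg n E real" by (rule size_avg_as_sum[symmetric]) simp
  finally show ?thesis .
qed

lemma L1_ge: "v \<in> {1..n} \<Longrightarrow> comp_size n E v \<le> L1 n E"
  by (simp add: L1_def)

lemma L1_attained:
  assumes "n > 0"
  obtains v where "v \<in> {1..n}" "comp_size n E v = L1 n E"
proof -
  have "L1 n E \<in> comp_size n E ` {1..n}" unfolding L1_def using assms by (intro Max_in) auto
  then show ?thesis using that by force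
qed

text \<open>The largest component alone contributes \<open>L\<^sub>1\<^sup>2\<close> to \<open>\<Sum>\<^sub>v |C(v)|\<close>.\<close>

lemma L1_square_le: "n > 0 \<Longrightarrow> (real (L1 n E))\<^sup>2 \<le> n * susceptibility n E"
proof -
  assume "n > 0"
  then obtain v where v: "v \<in> {1..n}" "comp_size n E v = L1 n E" by (rule L1_attained)
  have "(real (L1 n E))\<^sup>2 = (\<Sum>w\<in>component n E v. real (comp_size n E w))"
    using comp_size_component[OF v(1)] v by (simp add: power2_eq_square) (simp add: comp_size_def)
  also have "\<dots> \<le> (\<Sum>w=1..n. real (comp_size n E w))"
    by (intro sum_mono2) (use component_subset in auto)
  also have "\<dots> = n * susceptibility n E" by (simp add: susceptibility_eq size_avg_def)
  finally show ?thesis .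
qed

section \<open>The Markov chain of graphs\<close>

definition unif :: "nat \<Rightarrow> (nat \<times> nat \<Rightarrow> real) \<Rightarrow> real" where
  "unif n h = expect (pmf_of_set (potential_edges n)) h"

definition sel_pair :: "size_rule \<Rightarrow> nat \<Rightarrow> graph \<Rightarrow> choice \<Rightarrow> nat \<times> nat" where
  "sel_pair R n E = (\<lambda>((v1, v2), (v3, v4)).
     if R (comp_size n E v1) (comp_size n E v2) (comp_size n E v3) (comp_size n E v4)
     then (v1, v2) else (v3, v4))"

definition sel_pmf :: "size_rule \<Rightarrow> nat \<Rightarrow> graph \<Rightarrow> (nat \<times> nat) pmf" where
  "sel_pmf R n E = map_pmf (sel_pair R n E) (choice_pmf n)"

definition add_edge :: "graph \<Rightarrow> nat \<times> nat \<Rightarrow> graph" where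
  "add_edge E e = insert {fst e, snd e} E"

definition graph_step :: "size_rule \<Rightarrow> nat \<Rightarrow> graph \<Rightarrow> graph pmf" where
  "graph_step R n E = map_pmf (add_edge E) (sel_pmf R n E)"

text \<open>The start graph is a parameter because the infinite product measure of the choices splits off its
first factor: the induction in \<open>nn_integral_run\<close> restarts the process after one step.\<close>

primrec dist_from :: "size_rule \<Rightarrow> nat \<Rightarrow> graph \<Rightarrow> nat \<Rightarrow> graph pmf" where
  "dist_from R n E 0 = return_pmf E"
| "dist_from R n E (Suc i) = bind_pmf (dist_from R n E i) (graph_step R n)"

abbreviation gdist :: "size_rule \<Rightarrow> nat \<Rightarrow> nat \<Rightarrow> graph pmf" where
  "gdist R n i \<equiv> dist_from R n {} i"

lemma selected_edge_eq: "insert (selected_edge R n E c) E = add_edge E (sel_pair R n E c)"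
proof -
  obtain v1 v2 v3 v4 where "c = ((v1, v2), (v3, v4))" by (metis prod.exhaust)
  then show ?thesis by (simp add: add_edge_def sel_pair_def)
qed

lemma dist_from_Suc_front:
  "dist_from R n E (Suc i) = bind_pmf (graph_step R n E) (\<lambda>E'. dist_from R n E' i)"
proof (induction i)
  case (Suc i)
  have "dist_from R n E (Suc (Suc i)) = bind_pmf (dist_from R n E (Suc i)) (graph_step R n)"
    by simp
  also have "\<dots> = bind_pmf (graph_step R n E) (\<lambda>E'. dist_from R n E' (Suc i))"
    unfolding Suc by (simp add: bind_assoc_pmf)
  finally show ?case .
qed (simp add: bind_return_pmf bind_return_pmf')

primrec run :: "size_rule \<Rightarrow> nat \<Rightarrow> graph \<Rightarrow> nat \<Rightarrow> (nat \<Rightarrow> choice) \<Rightarrow> graph" where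
  "run R n E 0 \<omega> = E"
| "run R n E (Suc i) \<omega> = add_edge (run R n E i \<omega>) (sel_pair R n (run R n E i \<omega>) (\<omega> i))"

lemma achlioptas_eq_run: "achlioptas R n i \<omega> = run R n {} i \<omega>"
  by (induction i) (simp_all add: selected_edge_eq)

lemma run_Suc_front:
  "run R n E (Suc i) (case_nat c \<omega>) = run R n (add_edge E (sel_pair R n E c)) i \<omega>"
  by (induction i) simp_all

lemma run_measurable: "run R n E i \<in> measurable (choices n) (count_space UNIV)"
proof (induction i)
  case (Suc i)
  have "(\<lambda>\<omega>. \<omega> i) \<in> measurable (choices n) (measure_pmf (choice_pmf n))"
    unfolding choices_def by (rule measurable_component_singleton) simp
  then have c: "(\<lambda>\<omega>. \<omega> i) \<in> measurable (choices n) (count_space UNIV)"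
    by simp
  have "(\<lambda>\<omega>. add_edge (run R n E i \<omega>) (sel_pair R n (run R n E i \<omega>) (\<omega> i)))
      \<in> measurable (choices n) (count_space UNIV)"
  proof (rule measurable_compose_countable[where
        f = "\<lambda>c \<omega>. add_edge (run R n E i \<omega>) (sel_pair R n (run R n E i \<omega>) c)", OF _ c])
    fix c :: choice
    show "(\<lambda>\<omega>. add_edge (run R n E i \<omega>) (sel_pair R n (run R n E i \<omega>) c))
        \<in> measurable (choices n) (count_space UNIV)"
      by (rule measurable_compose[OF Suc.IH, where g = "\<lambda>G. add_edge G (sel_pair R n G c)"]) simp
  qed
  then show ?case by simp
qed simp

lemma prob_space_choices: "prob_space (choices n)"
  unfolding choices_def by (intro prob_space_PiM) (simp add: measure_pmf.prob_space_axioms)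

text \<open>The independent choices form a stationary sequence, so integrating out the first choice leaves a process
of the same kind, started from the graph after one step.\<close>

lemma nn_integral_run:
  fixes f :: "graph \<Rightarrow> ennreal"
  shows "(\<integral>\<^sup>+\<omega>. f (run R n E i \<omega>) \<partial>choices n) = (\<integral>\<^sup>+G. f G \<partial>measure_pmf (dist_from R n E i))"
proof (induction i arbitrary: E)
  case 0
  then show ?case using prob_space.emeasure_space_1[OF prob_space_choices] by simp
next
  case (Suc i)
  interpret sequence_space "measure_pmf (choice_pmf n)"
    by unfold_locales
  interpret C: prob_space "choices n" by (rule prob_space_choices)
  let ?M = "measure_pmf (choice_pmf n)"
  have m: "(\<lambda>\<omega>. f (run R n E (Suc i) \<omega>)) \<in> borel_measurable (choices n)"
    by (rule measurable_compose[OF run_measurable]) simp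
  have iter: "distr (?M \<Otimes>\<^sub>M choices n) (choices n) (\<lambda>(s, \<omega>). case_nat s \<omega>) = choices n"
    unfolding choices_def by (rule PiM_iter)
  have cn: "(\<lambda>(s, \<omega>). case_nat s \<omega>) \<in> measurable (?M \<Otimes>\<^sub>M choices n) (choices n)"
    unfolding choices_def by measurable
  have m2: "(\<lambda>x. f (run R n E (Suc i) ((\<lambda>(s, \<omega>). case_nat s \<omega>) x)))
      \<in> borel_measurable (?M \<Otimes>\<^sub>M choices n)"
    by (rule measurable_compose[OF cn m])
  have "(\<integral>\<^sup>+\<omega>. f (run R n E (Suc i) \<omega>) \<partial>choices n) =
      (\<integral>\<^sup>+x. f (run R n E (Suc i) ((\<lambda>(s, \<omega>). case_nat s \<omega>) x)) \<partial>(?M \<Otimes>\<^sub>M choices n))"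
    by (subst (1) iter[symmetric], rule nn_integral_distr[OF cn]) (use m in simp)
  also have "\<dots> = (\<integral>\<^sup>+s. \<integral>\<^sup>+\<omega>. f (run R n E (Suc i) (case_nat s \<omega>)) \<partial>choices n \<partial>?M)"
    using C.nn_integral_fst[OF m2] by simp
  also have "\<dots> = (\<integral>\<^sup>+s. \<integral>\<^sup>+G. f G \<partial>dist_from R n (add_edge E (sel_pair R n E s)) i \<partial>?M)"
    unfolding run_Suc_front Suc.IH ..
  also have "\<dots> = (\<integral>\<^sup>+G. f G \<partial>measure_pmf (dist_from R n E (Suc i)))"
    unfolding dist_from_Suc_front by (simp add: graph_step_def sel_pmf_def)
  finally show ?case .
qed

text \<open>From here on only the finitely supported laws \<open>gdist R n i\<close> matter, where every expectation is a finite
sum and no measurability or integrability has to be checked.\<close>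

lemma prob_graph:
  "\<P>(\<omega> in choices n. P (achlioptas R n i \<omega>)) = pr (gdist R n i) P"
proof -
  interpret C: prob_space "choices n" by (rule prob_space_choices)
  have "{\<omega> \<in> space (choices n). P (run R n {} i \<omega>)} \<in> sets (choices n)"
    using run_measurable[of R n "{}" i] by (auto intro: measurable_sets_Collect)
  then have "emeasure (choices n) {\<omega> \<in> space (choices n). P (run R n {} i \<omega>)} =
      (\<integral>\<^sup>+\<omega>. indicator {G. P G} (run R n {} i \<omega>) \<partial>choices n)"
    by (simp only: nn_integral_indicator[symmetric])
      (auto intro!: nn_integral_cong simp: indicator_def)
  also have "\<dots> = emeasure (measure_pmf (gdist R n i)) {G. P G}"
    unfolding nn_integral_run by simp
  finally have "\<P>(\<omega> in choices n. P (achlioptas R n i \<omega>)) = measure_pmf.prob (gdist R n i) {G. P G}"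
    by (simp add: achlioptas_eq_run measure_def)
  also have "\<dots> = expect (gdist R n i) (indicator {G. P G})" by simp
  also have "\<dots> = pr (gdist R n i) P"
    by (intro expect_cong) (auto simp: indicator_def)
  finally show ?thesis .
qed

section \<open>The law of the selected pair\<close>

lemma finite_potential_edges [simp]: "finite (potential_edges n)"
  by (rule finite_subset[of _ "{1..n} \<times> {1..n}"]) (auto simp: potential_edges_def)

lemma card_potential_edges: "card (potential_edges n) = n * (n - 1)"
proof -
  have "potential_edges n = {1..n} \<times> {1..n} - (\<lambda>v. (v, v)) ` {1..n}"
    by (auto simp: potential_edges_def)
  also have "card \<dots> = n * n - n"
    by (subst card_Diff_subset) (auto simp: card_image inj_on_def)
  finally show ?thesis by (simp add: diff_mult_distrib2)
qed

lemma potential_edges_nonempty: "2 \<le> n \<Longrightarrow> potential_edges n \<noteq> {}"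
proof -
  assume "2 \<le> n"
  then have "(1, 2) \<in> potential_edges n" by (simp add: potential_edges_def)
  then show ?thesis by blast
qed

lemma finite_choice_pmf: "2 \<le> n \<Longrightarrow> finite (set_pmf (choice_pmf n))"
  by (simp add: choice_pmf_def potential_edges_nonempty)

lemma finite_sel_pmf [simp]: "2 \<le> n \<Longrightarrow> finite (set_pmf (sel_pmf R n E))"
  by (simp add: sel_pmf_def finite_choice_pmf)

lemma set_sel_pmf: "2 \<le> n \<Longrightarrow> set_pmf (sel_pmf R n E) \<subseteq> potential_edges n"
  by (force simp: sel_pmf_def choice_pmf_def potential_edges_nonempty sel_pair_def)

lemma finite_step [simp]: "2 \<le> n \<Longrightarrow> finite (set_pmf (graph_step R n E))"
  by (simp add: graph_step_def)

lemma finite_dist_from [simp]: "2 \<le> n \<Longrightarrow> finite (set_pmf (dist_from R n E i))"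
  by (induction i) simp_all

lemma expect_step: "expect (graph_step R n E) F = expect (sel_pmf R n E) (\<lambda>e. F (add_edge E e))"
  by (simp add: graph_step_def)

lemma step_cases:
  assumes "2 \<le> n" "E' \<in> set_pmf (graph_step R n E)"
  obtains u v where "u \<in> {1..n}" "v \<in> {1..n}" "u \<noteq> v" "E' = add_edge E (u, v)"
proof -
  obtain e where "e \<in> potential_edges n" "E' = add_edge E e"
    using assms set_sel_pmf[OF assms(1), of R E] by (auto simp: graph_step_def)
  then show ?thesis using that[of "fst e" "snd e"] by (auto simp: potential_edges_def)
qed

lemma size_avg_add_edge:
  "e \<in> potential_edges n \<Longrightarrow> size_avg n (add_edge E e) f = size_avg n E f + gain n E f e / n"
  by (cases e) (simp add: add_edge_def size_avg_insert potential_edges_def)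

lemma expect_step_size_avg:
  assumes "2 \<le> n"
  shows "expect (graph_step R n E) (\<lambda>E'. size_avg n E' f) =
    size_avg n E f + expect (sel_pmf R n E) (gain n E f) / n"
proof -
  have "expect (graph_step R n E) (\<lambda>E'. size_avg n E' f) =
      expect (sel_pmf R n E) (\<lambda>e. size_avg n E f + gain n E f e / n)"
    unfolding expect_step using set_sel_pmf[OF assms] by (intro expect_cong size_avg_add_edge) auto
  also have "\<dots> = size_avg n E f + expect (sel_pmf R n E) (gain n E f) / n"
    using assms by (subst expect_add) auto
  finally show ?thesis .
qed

lemma gain_nonneg:
  assumes "mono f"
  shows "0 \<le> gain n E f e"
proof -
  have "0 \<le> merge_gain f a b" for a b
  proof -
    have "merge_gain f a b = a * (f (a + b) - f a) + b * (f (a + b) - f b)"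
      by (simp add: merge_gain_def algebra_simps)
    then show ?thesis using assms by (simp add: monoD)
  qed
  then show ?thesis by (auto simp: gain_def split: prod.split)
qed

lemma size_avg_step_mono:
  assumes "2 \<le> n" "mono f" "E' \<in> set_pmf (graph_step R n E)"
  shows "size_avg n E f \<le> size_avg n E' f"
proof -
  obtain u v where "u \<in> {1..n}" "v \<in> {1..n}" "u \<noteq> v" "E' = add_edge E (u, v)"
    using step_cases[OF assms(1,3)] by blast
  then show ?thesis
    using gain_nonneg[OF assms(2), of n E "(u, v)"]
    by (simp add: size_avg_add_edge potential_edges_def)
qed

lemma unif_eq: "2 \<le> n \<Longrightarrow> unif n h = (\<Sum>e\<in>potential_edges n. h e) / (real n * (real n - 1))"
  by (simp add: unif_def integral_pmf_of_set potential_edges_nonempty card_potential_edges of_nat_diff)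

lemma sum_potential_edges_le:
  assumes "\<And>u v. 0 \<le> h (u, v)"
  shows "(\<Sum>e\<in>potential_edges n. h e) \<le> (\<Sum>u=1..n. \<Sum>v=1..n. (h (u, v) :: real))"
proof -
  have "(\<Sum>e\<in>potential_edges n. h e) \<le> (\<Sum>e\<in>{1..n} \<times> {1..n}. h e)"
    using assms by (intro sum_mono2) (auto simp: potential_edges_def)
  then show ?thesis by (simp add: sum.cartesian_product)
qed

lemma unif_nonneg: "(\<And>e. 0 \<le> h e) \<Longrightarrow> 0 \<le> unif n h"
  unfolding unif_def by (rule expect_nonneg)

lemma unif_mono: "2 \<le> n \<Longrightarrow> (\<And>e. e \<in> potential_edges n \<Longrightarrow> f e \<le> g e) \<Longrightarrow> unif n f \<le> unif n g"
  unfolding unif_def by (rule expect_mono) (auto simp: potential_edges_nonempty)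

text \<open>Distinct pairs versus all pairs: \<open>n (n - 1) \<ge> n\<^sup>2 / 2\<close>.\<close>

lemma unif_le:
  assumes "2 \<le> n" "\<And>u v. 0 \<le> h (u, v)"
  shows "unif n h \<le> 2 / n\<^sup>2 * (\<Sum>u=1..n. \<Sum>v=1..n. h (u, v))"
proof -
  let ?s = "\<Sum>u=1..n. \<Sum>v=1..n. h (u, v)"
  have s: "0 \<le> ?s" using assms by (intro sum_nonneg) auto
  have "unif n h \<le> ?s / (real n * (real n - 1))"
    unfolding unif_eq[OF assms(1)] using assms sum_potential_edges_le[of h n]
    by (intro divide_right_mono) auto
  also have "\<dots> \<le> ?s / (real n * (real n / 2))"
    using assms s by (intro divide_left_mono mult_left_mono) auto
  finally show ?thesis by (simp add: power2_eq_square mult.commute)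
qed

lemma expect_sel_choice:
  assumes "2 \<le> n"
  shows "expect (sel_pmf R n E) h =
    unif n (\<lambda>(v1, v2). unif n (\<lambda>(v3, v4). h (sel_pair R n E ((v1, v2), (v3, v4)))))"
  using assms
  by (simp add: sel_pmf_def choice_pmf_def expect_pair potential_edges_nonempty unif_def
      case_prod_unfold)

lemma unif_const: "unif n (\<lambda>_. c) = c"
  by (simp add: unif_def)

lemma unif_add: "2 \<le> n \<Longrightarrow> unif n (\<lambda>e. f e + g e) = unif n f + unif n g"
  unfolding unif_def by (rule expect_add) (simp add: potential_edges_nonempty)

lemma unif_cmult: "unif n (\<lambda>e. c * f e) = c * unif n f"
  by (simp add: unif_def)

text \<open>Whatever the rule does, the selected pair is one of the two offered uniform pairs.\<close>

lemma expect_sel_le: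
  assumes "2 \<le> n" "\<And>e. 0 \<le> h e"
  shows "expect (sel_pmf R n E) h \<le> 2 * unif n h"
proof -
  have "expect (sel_pmf R n E) h \<le> unif n (\<lambda>e1. unif n (\<lambda>e2. h e1 + h e2))"
    unfolding expect_sel_choice[OF assms(1)]
    using assms
    by (intro unif_mono) (auto simp: sel_pair_def case_prod_unfold intro!: unif_mono)
  also have "\<dots> = 2 * unif n h"
    using assms(1) by (simp add: unif_add unif_const)
  finally show ?thesis .
qed

lemma expect_sel_product_le:
  assumes "2 \<le> n" "\<And>k. 0 \<le> f k" "\<And>k. 0 \<le> g k"
  shows "expect (sel_pmf R n E) (\<lambda>(u, v). f (comp_size n E u) * g (comp_size n E v))
    \<le> 4 * (size_avg n E f * size_avg n E g)"
proof -
  let ?h = "\<lambda>(u, v). f (comp_size n E u) * g (comp_size n E v)"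
  have "expect (sel_pmf R n E) ?h \<le> 2 * unif n ?h"
    using assms by (intro expect_sel_le) auto
  also have "\<dots> \<le> 2 * (2 / n\<^sup>2 * (\<Sum>u=1..n. \<Sum>v=1..n. ?h (u, v)))"
    using unif_le[of n ?h] assms by simp
  also have "\<dots> = 4 * (size_avg n E f * size_avg n E g)"
    using assms(1) by (simp only: prod.case sum_pairs_size_avg) (simp add: field_simps)
  finally show ?thesis .
qed

text \<open>Properties that survive every step become more likely with time. This is how monotonicity of a statistic
along each trajectory is used, without ever forming the joint law of several steps.\<close>

lemma dist_from_persist:
  assumes "2 \<le> n" "i \<le> j" "\<And>E E'. P E \<Longrightarrow> E' \<in> set_pmf (graph_step R n E) \<Longrightarrow> P E'"
  shows "pr (dist_from R n E0 i) P \<le> pr (dist_from R n E0 j) P"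
  using assms(2)
proof (induction rule: dec_induct)
  case (step k)
  have "pr (dist_from R n E0 k) P \<le>
      expect (dist_from R n E0 k) (\<lambda>E. pr (graph_step R n E) P)"
  proof (rule expect_mono)
    fix E
    have "pr (graph_step R n E) P = expect (graph_step R n E) (\<lambda>_. 1)" if "P E"
      using assms(3)[OF that] by (intro expect_cong) auto
    then show "of_bool (P E) \<le> pr (graph_step R n E) P" by (auto simp: pr_nonneg)
  qed (use assms in simp)
  with step show ?case using assms by (simp add: expect_bind)
qed simp

section \<open>Susceptibility along the chain\<close>

abbreviation susc :: "nat \<Rightarrow> graph \<Rightarrow> real" where
  "susc n E \<equiv> size_avg n E real"

abbreviation susc2 :: "nat \<Rightarrow> graph \<Rightarrow> real" where
  "susc2 n E \<equiv> size_avg n E (\<lambda>k. (real k)\<^sup>2)"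

lemma mono_real: "mono (real :: nat \<Rightarrow> real)"
  by (simp add: mono_def)

lemma susc_ge_1: "0 < n \<Longrightarrow> 1 \<le> susc n E"
  using size_avg_mono[of n "\<lambda>_. 1" real E] by (simp add: size_avg_const)

lemma susc2_nonneg: "0 \<le> susc2 n E"
  by (rule size_avg_nonneg) simp

lemma susc_nonneg: "0 \<le> susc n E"
  by (rule size_avg_nonneg) simp

lemma gain_real_le: "gain n E real (u, v) \<le> 2 * (real (comp_size n E u) * real (comp_size n E v))"
  by (simp add: gain_def merge_gain_def algebra_simps)

lemma gain_sq_le: "gain n E (\<lambda>k. (real k)\<^sup>2) (u, v) \<le>
    3 * ((real (comp_size n E u))\<^sup>2 * real (comp_size n E v)) +
    3 * (real (comp_size n E u) * (real (comp_size n E v))\<^sup>2)"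
  by (simp add: gain_def merge_gain_def algebra_simps power2_eq_square)

text \<open>A step that merges sizes \<open>a\<close> and \<open>b\<close> raises \<open>\<Sum>\<^sub>v |C(v)|\<close> by \<open>2ab\<close>, and the endvertices are close to
independent; hence the mean growth per unit of time is of the order of the square of the susceptibility.\<close>

lemma expect_step_susc:
  assumes "2 \<le> n"
  shows "expect (graph_step R n E) (susc n) \<le> susc n E + 8 * (susc n E)\<^sup>2 / n"
proof -
  have "expect (sel_pmf R n E) (gain n E real) \<le>
      expect (sel_pmf R n E) (\<lambda>e. 2 * (\<lambda>(u, v). real (comp_size n E u) * real (comp_size n E v)) e)"
    using assms by (intro expect_mono) (auto intro: gain_real_le)
  also have "\<dots> = 2 * expect (sel_pmf R n E) (\<lambda>(u, v). real (comp_size n E u) * real (comp_size n E v))"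
    by simp
  also have "\<dots> \<le> 2 * (4 * (susc n E * susc n E))"
    using assms by (intro mult_left_mono expect_sel_product_le) auto
  finally show ?thesis
    using assms by (simp add: expect_step_size_avg power2_eq_square divide_right_mono)
qed

text \<open>The second moment of the component size of a random vertex grows at most exponentially, at a rate
governed by the susceptibility: merging sizes \<open>a\<close> and \<open>b\<close> adds \<open>3a\<^sup>2b + 3ab\<^sup>2\<close>.\<close>

lemma expect_step_susc2:
  assumes "2 \<le> n"
  shows "expect (graph_step R n E) (susc2 n) \<le> susc2 n E * (1 + 24 * susc n E / n)"
proof -
  let ?h = "\<lambda>f g (u, v). f (real (comp_size n E u)) * g (real (comp_size n E v))"
  have "expect (sel_pmf R n E) (gain n E (\<lambda>k. (real k)\<^sup>2)) \<le>
      expect (sel_pmf R n E) (\<lambda>e. 3 * ?h (\<lambda>x. x\<^sup>2) (\<lambda>x. x) e + 3 * ?h (\<lambda>x. x) (\<lambda>x. x\<^sup>2) e)"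
    using assms by (intro expect_mono) (auto intro: gain_sq_le)
  also have "\<dots> = 3 * expect (sel_pmf R n E) (?h (\<lambda>x. x\<^sup>2) (\<lambda>x. x)) +
      3 * expect (sel_pmf R n E) (?h (\<lambda>x. x) (\<lambda>x. x\<^sup>2))"
    using assms by (subst expect_add) auto
  also have "\<dots> \<le> 3 * (4 * (susc2 n E * susc n E)) + 3 * (4 * (susc n E * susc2 n E))"
    using assms by (intro add_mono mult_left_mono expect_sel_product_le) auto
  also have "\<dots> = 24 * susc2 n E * susc n E" by simp
  finally show ?thesis
    using assms by (simp add: expect_step_size_avg divide_right_mono algebra_simps)
qed

lemma expect_step_susc_increment_sq:
  assumes "2 \<le> n"
  shows "expect (graph_step R n E) (\<lambda>E'. (susc n E' - susc n E)\<^sup>2) \<le> 16 * (susc2 n E)\<^sup>2 / n\<^sup>2"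
proof -
  let ?h = "\<lambda>(u, v). (real (comp_size n E u))\<^sup>2 * (real (comp_size n E v))\<^sup>2"
  have "expect (graph_step R n E) (\<lambda>E'. (susc n E' - susc n E)\<^sup>2) \<le>
      expect (sel_pmf R n E) (\<lambda>e. 4 / n\<^sup>2 * ?h e)"
    unfolding expect_step
  proof (rule expect_mono)
    fix e assume "e \<in> set_pmf (sel_pmf R n E)"
    then have e: "e \<in> potential_edges n" using set_sel_pmf[OF assms] by blast
    obtain u v where uv: "e = (u, v)" by (cases e)
    have "(susc n (add_edge E e) - susc n E)\<^sup>2 = (gain n E real e)\<^sup>2 / n\<^sup>2"
      by (simp add: size_avg_add_edge[OF e] power_divide)
    also have "(gain n E real e)\<^sup>2 \<le> (2 * (real (comp_size n E u) * real (comp_size n E v)))\<^sup>2"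
      using gain_nonneg[OF mono_real, of n E e] gain_real_le[of n E u v] unfolding uv
      by (intro power_mono)
    also have "\<dots> = 4 * ?h e" by (simp add: uv power_mult_distrib)
    finally show "(susc n (add_edge E e) - susc n E)\<^sup>2 \<le> 4 / n\<^sup>2 * ?h e"
      by (simp add: divide_right_mono)
  qed (use assms in simp)
  also have "\<dots> = 4 / n\<^sup>2 * expect (sel_pmf R n E) ?h" by simp
  also have "\<dots> \<le> 4 / n\<^sup>2 * (4 * (susc2 n E * susc2 n E))"
    using assms by (intro mult_left_mono expect_sel_product_le) auto
  finally show ?thesis by (simp add: power2_eq_square)
qed

text \<open>The recursion is only demanded below the final index, because the hypotheses under which it is derived hold
up to a time horizon.\<close>

lemma discrete_gronwall:
  fixes \<phi> :: "nat \<Rightarrow> real"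
  assumes "0 \<le> a" "0 \<le> b" "0 \<le> \<phi> 0"
    "\<And>i. i < m \<Longrightarrow> \<phi> (Suc i) \<le> (1 + a) * \<phi> i + b"
  shows "\<phi> m \<le> exp (a * m) * (\<phi> 0 + m * b)"
  using assms(4)
proof (induction m)
  case (Suc m)
  have e: "1 \<le> exp (a * Suc m)" using assms by simp
  have "\<phi> (Suc m) \<le> (1 + a) * \<phi> m + b" using Suc.prems by simp
  also have "\<dots> \<le> exp a * (exp (a * m) * (\<phi> 0 + m * b)) + b"
  proof -
    have "(1 + a) * \<phi> m \<le> (1 + a) * (exp (a * m) * (\<phi> 0 + m * b))"
      using Suc assms by (intro mult_left_mono) auto
    also have "\<dots> \<le> exp a * (exp (a * m) * (\<phi> 0 + m * b))"
      using assms by (intro mult_right_mono) auto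
    finally show ?thesis by simp
  qed
  also have "\<dots> \<le> exp (a * Suc m) * (\<phi> 0 + m * b) + exp (a * Suc m) * b"
  proof -
    have "exp (a * Suc m) = exp a * exp (a * m)" by (simp add: exp_add[symmetric] algebra_simps)
    then show ?thesis using mult_right_mono[OF e assms(2)] by (simp add: mult.assoc)
  qed
  finally show ?case by (simp add: algebra_simps)
qed simp

text \<open>As long as the susceptibility stays below \<open>K\<close>, the second moment is bounded in mean. The event
\<open>susc \<le> K\<close> can only be left, never re-entered, so multiplying by its indicator does the work of a
stopping time. The consequence used later is uniform integrability: no part of the susceptibility is carried
by components whose size tends to infinity.\<close>

lemma susc2_bound:
  assumes "2 \<le> n" "0 \<le> K"
  shows "expect (gdist R n m) (\<lambda>E. susc2 n E * of_bool (susc n E \<le> K)) \<le> exp (24 * K / n * m)"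
proof -
  let ?F = "\<lambda>E. susc2 n E * of_bool (susc n E \<le> K)"
  have one_step: "expect (graph_step R n E) ?F \<le> (1 + 24 * K / n) * ?F E" for E
  proof (cases "susc n E \<le> K")
    case True
    have "expect (graph_step R n E) ?F \<le> expect (graph_step R n E) (susc2 n)"
      using assms by (intro expect_mono) (auto simp: susc2_nonneg)
    also have "\<dots> \<le> susc2 n E * (1 + 24 * susc n E / n)" by (rule expect_step_susc2[OF assms(1)])
    also have "\<dots> \<le> susc2 n E * (1 + 24 * K / n)"
      using True by (intro mult_left_mono add_mono divide_right_mono) (auto simp: susc2_nonneg)
    finally show ?thesis using True by (simp add: mult.commute)
  next
    case False
    have "expect (graph_step R n E) ?F = expect (graph_step R n E) (\<lambda>_. 0)"
      using False size_avg_step_mono[OF assms(1) mono_real] by (intro expect_cong) force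
    then show ?thesis using False by simp
  qed
  have "expect (gdist R n m) ?F \<le> exp (24 * K / n * m) * (expect (gdist R n 0) ?F + real m * 0)"
  proof (rule discrete_gronwall[where \<phi> = "\<lambda>i. expect (gdist R n i) ?F" and b = 0])
    fix i
    have "expect (gdist R n (Suc i)) ?F = expect (gdist R n i) (\<lambda>E. expect (graph_step R n E) ?F)"
      using assms by (simp add: expect_bind)
    also have "\<dots> \<le> expect (gdist R n i) (\<lambda>E. (1 + 24 * K / n) * ?F E)"
      using assms one_step by (intro expect_mono) auto
    finally show "expect (gdist R n (Suc i)) ?F \<le> (1 + 24 * K / n) * expect (gdist R n i) ?F + 0"
      by simp
  qed (use assms in \<open>auto intro!: expect_nonneg simp: susc2_nonneg\<close>)
  also have "expect (gdist R n 0) ?F \<le> 1" using assms by (simp add: size_avg_empty)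
  finally show ?thesis by simp
qed

lemma pos_part_sq_le:
  fixes x \<xi> :: real
  shows "(max 0 (x + \<xi>))\<^sup>2 \<le> (max 0 x)\<^sup>2 + 2 * max 0 x * \<xi> + \<xi>\<^sup>2"
proof (cases "0 \<le> x")
  case True
  have "(max 0 (x + \<xi>))\<^sup>2 \<le> (x + \<xi>)\<^sup>2" by (auto simp: max_def)
  then show ?thesis using True by (simp add: power2_sum)
next
  case False
  then have "\<bar>max 0 (x + \<xi>)\<bar> \<le> \<bar>\<xi>\<bar>" by auto
  then have "(max 0 (x + \<xi>))\<^sup>2 \<le> \<xi>\<^sup>2" by (simp only: abs_le_square_iff)
  then show ?thesis using False by simp
qed

text \<open>A bounded susceptibility cannot double within \<open>n / (64M)\<close> steps. The drift of the susceptibility is at most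
\<open>32M\<^sup>2/n\<close> while it is below \<open>2M\<close>, so it should stay below the line \<open>a i\<close>, which ends at \<open>3M/2\<close>. The
potential \<open>W\<close> is the squared excess over that line plus a small multiple of the second moment; it is at
least 1 as soon as the susceptibility exceeds \<open>2M\<close> or the second moment exceeds \<open>A'\<close>, and until then it is
a supermartingale up to an error \<open>C/n\<^sup>2\<close> per step, which comes from the variance of the increments. Capping
\<open>W\<close> at 1 turns these two exits into absorption.\<close>

lemma susc_forward:
  assumes n: "2 \<le> n" and M: "0 < M" and A: "0 < A" and A': "0 < A'" and j: "real j \<le> n / (64 * M)"
  shows "pr (gdist R n (i0 + j)) (\<lambda>E. susc n E > 2 * M) \<le>
    pr (gdist R n i0) (\<lambda>E. susc n E > M) + pr (gdist R n i0) (\<lambda>E. susc2 n E > A) + 3 * A / A' +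
    (32 * A'\<^sup>2 + 2048 * M ^ 4) * 4 / M\<^sup>2 * (1 / (64 * M)) / n"
proof -
  define C where "C = (32 * A'\<^sup>2 + 2048 * M ^ 4) * 4 / M\<^sup>2"
  have C0: "0 \<le> C" using M by (simp add: C_def)
  define a where "a i = M + 32 * M\<^sup>2 * real i / n" for i
  (* the weights r i undo the growth factor q of the second moment while the susceptibility is below 2 M *)
  define q where "q = 1 + 48 * M / n"
  define r where "r i = q ^ (j - i) / A'" for i
  define y where "y i E = max 0 (susc n E - a i)" for i E
  define W where "W i E = (y i E)\<^sup>2 * 4 / M\<^sup>2 + r i * susc2 n E" for i E
  define Z where "Z i E = min 1 (W i E)" for i E
  have q1: "1 \<le> q" using M by (simp add: q_def)
  have r0: "0 \<le> r i" for i using q1 A' by (simp add: r_def)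
  have W0: "0 \<le> W i E" for i E using M r0 by (simp add: W_def susc2_nonneg)
  have Z0: "0 \<le> Z i E" for i E using W0 by (simp add: Z_def)
  have a_le: "a i \<le> 3 / 2 * M" if "i \<le> j" for i
  proof -
    have "64 * M * real i \<le> n" using that j M by (simp add: field_simps) (smt (verit) mult_left_mono of_nat_mono)
    then have "M * (64 * M * real i) \<le> M * n" using M by (intro mult_left_mono) auto
    then show ?thesis using n by (simp add: a_def field_simps power2_eq_square)
  qed
  have dead: "Z i E = 1" if i: "i \<le> j" and d: "susc n E > 2 * M \<or> susc2 n E > A'" for i E
  proof (cases "susc n E > 2 * M")
    case True
    then have "M / 2 \<le> susc n E - a i" using a_le[OF i] by simp
    then have "M / 2 \<le> y i E" unfolding y_def by (rule max.coboundedI2)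
    then have "(M / 2)\<^sup>2 \<le> (y i E)\<^sup>2" using M by (intro power_mono) auto
    then have "1 \<le> (y i E)\<^sup>2 * 4 / M\<^sup>2" using M by (simp add: field_simps)
    then have "1 \<le> W i E" using r0[of i] susc2_nonneg[of n E] by (simp add: W_def add_increasing2)
    then show ?thesis by (simp add: Z_def)
  next
    case False
    have "1 / A' * A' \<le> r i * susc2 n E"
      using False d A' q1 r0 by (intro mult_mono) (auto simp: r_def divide_right_mono)
    then have "1 \<le> W i E" using A' by (simp add: W_def add_increasing)
    then show ?thesis by (simp add: Z_def)
  qed
  (* a capped potential cannot grow once it equals 1, so only states below both thresholds matter *)
  have one_step: "expect (graph_step R n E) (Z (Suc i)) \<le> Z i E + C / n\<^sup>2" if i: "i < j" for i E
  proof (cases "Z i E = 1")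
    case True
    have "expect (graph_step R n E) (Z (Suc i)) \<le> expect (graph_step R n E) (\<lambda>_. 1)"
      using n by (intro expect_mono) (auto simp: Z_def)
    then show ?thesis using True C0 by (simp add: add_increasing2)
  next
    case False
    then have alive: "susc n E \<le> 2 * M" "susc2 n E \<le> A'"
      using dead[of i E] i by force+
    have ZW: "Z i E = W i E" using False by (auto simp: Z_def)
    define d where "d = 32 * M\<^sup>2 / n"
    have da: "a (Suc i) = a i + d" by (simp add: a_def d_def distrib_left add_divide_distrib)
    have sq: "(y (Suc i) E')\<^sup>2 \<le>
        (y i E)\<^sup>2 + 2 * y i E * (susc n E' - susc n E - d) + (susc n E' - susc n E - d)\<^sup>2" for E'
    proof -
      define x where "x = susc n E - a i"
      define \<xi> where "\<xi> = susc n E' - susc n E - d"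
      have "(max 0 (x + \<xi>))\<^sup>2 \<le> (max 0 x)\<^sup>2 + 2 * max 0 x * \<xi> + \<xi>\<^sup>2"
        by (rule pos_part_sq_le)
      then show ?thesis by (simp add: y_def x_def \<xi>_def da algebra_simps)
    qed
    have drift: "expect (graph_step R n E) (\<lambda>E'. susc n E' - susc n E - d) \<le> 0"
    proof -
      have "(susc n E)\<^sup>2 \<le> (2 * M)\<^sup>2" using alive susc_nonneg by (intro power_mono) auto
      then have "8 * (susc n E)\<^sup>2 / n \<le> d"
        unfolding d_def by (intro divide_right_mono) (auto simp: power2_eq_square)
      then show ?thesis
        using expect_step_susc[OF n, of R E] n by (simp add: expect_diff)
    qed
    have var: "expect (graph_step R n E) (\<lambda>E'. (susc n E' - susc n E - d)\<^sup>2) \<le> C * M\<^sup>2 / 4 / n\<^sup>2"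
    proof -
      have "(susc n E' - susc n E - d)\<^sup>2 \<le> 2 * (susc n E' - susc n E)\<^sup>2 + 2 * d\<^sup>2" for E'
        using zero_le_power2[of "susc n E' - susc n E + d"] by (simp add: power2_eq_square algebra_simps)
      then have "expect (graph_step R n E) (\<lambda>E'. (susc n E' - susc n E - d)\<^sup>2) \<le>
          expect (graph_step R n E) (\<lambda>E'. 2 * (susc n E' - susc n E)\<^sup>2 + 2 * d\<^sup>2)"
        using n by (intro expect_mono) auto
      also have "\<dots> = 2 * expect (graph_step R n E) (\<lambda>E'. (susc n E' - susc n E)\<^sup>2) + 2 * d\<^sup>2"
        using n by (subst expect_add) auto
      also have "\<dots> \<le> 2 * (16 * (susc2 n E)\<^sup>2 / n\<^sup>2) + 2 * d\<^sup>2"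
        using expect_step_susc_increment_sq[OF n, of R E] by simp
      also have "\<dots> \<le> 2 * (16 * A'\<^sup>2 / n\<^sup>2) + 2 * d\<^sup>2"
        using alive susc2_nonneg
        by (intro add_mono mult_left_mono divide_right_mono power_mono) (auto simp: d_def)
      also have "\<dots> = C * M\<^sup>2 / 4 / n\<^sup>2"
        using M n by (simp add: C_def d_def field_simps power2_eq_square power4_eq_xxxx)
      finally show ?thesis .
    qed
    have "expect (graph_step R n E) (\<lambda>E'. (y (Suc i) E')\<^sup>2) \<le> expect (graph_step R n E)
        (\<lambda>E'. ((y i E)\<^sup>2 + 2 * y i E * (susc n E' - susc n E - d)) + (susc n E' - susc n E - d)\<^sup>2)"
      using n sq by (intro expect_mono) auto
    also have "\<dots> = (y i E)\<^sup>2 + 2 * y i E * expect (graph_step R n E) (\<lambda>E'. susc n E' - susc n E - d) +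
        expect (graph_step R n E) (\<lambda>E'. (susc n E' - susc n E - d)\<^sup>2)"
      using n by (subst expect_add, simp, subst expect_add) auto
    also have "\<dots> \<le> (y i E)\<^sup>2 + C * M\<^sup>2 / 4 / n\<^sup>2"
      using var mult_nonneg_nonpos[OF _ drift, of "2 * y i E"] by (simp add: y_def)
    finally have Ey: "expect (graph_step R n E) (\<lambda>E'. (y (Suc i) E')\<^sup>2) \<le> (y i E)\<^sup>2 + C * M\<^sup>2 / 4 / n\<^sup>2" .
    have "expect (graph_step R n E) (susc2 n) \<le> susc2 n E * q"
    proof -
      have "susc2 n E * (1 + 24 * susc n E / n) \<le> susc2 n E * q"
        unfolding q_def using alive susc2_nonneg
        by (intro mult_left_mono add_mono divide_right_mono) auto
      then show ?thesis using expect_step_susc2[OF n, of R E] by linarith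
    qed
    then have "r (Suc i) * expect (graph_step R n E) (susc2 n) \<le> r (Suc i) * (susc2 n E * q)"
      using r0 by (intro mult_left_mono)
    also have "\<dots> = r i * susc2 n E"
      using i by (simp add: r_def Suc_diff_Suc[symmetric])
    finally have EX: "r (Suc i) * expect (graph_step R n E) (susc2 n) \<le> r i * susc2 n E" .
    have "expect (graph_step R n E) (Z (Suc i)) \<le> expect (graph_step R n E) (W (Suc i))"
      using n by (intro expect_mono) (auto simp: Z_def)
    also have "\<dots> = expect (graph_step R n E) (\<lambda>E'. (y (Suc i) E')\<^sup>2) * 4 / M\<^sup>2 +
        r (Suc i) * expect (graph_step R n E) (susc2 n)"
      unfolding W_def using n by (subst expect_add) auto
    also have "\<dots> \<le> ((y i E)\<^sup>2 + C * M\<^sup>2 / 4 / n\<^sup>2) * 4 / M\<^sup>2 + r i * susc2 n E"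
      using Ey EX by (intro add_mono divide_right_mono mult_right_mono) auto
    also have "\<dots> = W i E + C / n\<^sup>2" using M by (simp add: W_def field_simps)
    finally show ?thesis by (simp add: ZW)
  qed
  have chain: "expect (gdist R n (i0 + i)) (Z i) \<le> expect (gdist R n i0) (Z 0) + i * (C / n\<^sup>2)"
    if "i \<le> j" for i
    using that
  proof (induction i)
    case (Suc i)
    have "expect (gdist R n (i0 + Suc i)) (Z (Suc i)) =
        expect (gdist R n (i0 + i)) (\<lambda>E. expect (graph_step R n E) (Z (Suc i)))"
      using n by (simp add: expect_bind)
    also have "\<dots> \<le> expect (gdist R n (i0 + i)) (\<lambda>E. Z i E + C / n\<^sup>2)"
      using n one_step Suc.prems by (intro expect_mono) auto
    also have "\<dots> = expect (gdist R n (i0 + i)) (Z i) + C / n\<^sup>2"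
      using n by (subst expect_add) auto
    finally show ?case using Suc by (simp add: distrib_right add_divide_distrib)
  qed simp
  have "pr (gdist R n (i0 + j)) (\<lambda>E. susc n E > 2 * M) \<le> expect (gdist R n (i0 + j)) (Z j)"
    using n dead[of j] Z0 by (intro expect_mono) (auto simp: of_bool_def)
  also have "\<dots> \<le> expect (gdist R n i0) (Z 0) + j * (C / n\<^sup>2)" using chain by simp
  also have "expect (gdist R n i0) (Z 0) \<le> expect (gdist R n i0)
      (\<lambda>E. (of_bool (susc n E > M) + of_bool (susc2 n E > A)) + 3 * A / A')"
  proof (rule expect_mono)
    fix E
    show "Z 0 E \<le> (of_bool (susc n E > M) + of_bool (susc2 n E > A)) + 3 * A / A'"
    proof (cases "susc n E \<le> M \<and> susc2 n E \<le> A")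
      case True
      have "q ^ j \<le> exp (48 * M / n) ^ j"
        unfolding q_def using M by (intro power_mono exp_ge_add_one_self) simp
      also have "\<dots> = exp (48 * M / n * j)" by (simp add: exp_of_nat_mult[symmetric] mult.commute)
      also have "\<dots> \<le> exp 1"
      proof -
        have "48 * M * j \<le> 48 * M * (n / (64 * M))" using j M by (intro mult_left_mono) auto
        then show ?thesis using M n by (simp add: field_simps)
      qed
      also have "\<dots> \<le> 3" using exp_le by simp
      finally have "r 0 * susc2 n E \<le> 3 / A' * A"
        using True A' A susc2_nonneg by (intro mult_mono) (auto simp: r_def divide_right_mono)
      moreover have "y 0 E = 0" using True by (simp add: y_def a_def)
      ultimately show ?thesis using True by (simp add: Z_def W_def)
    next
      case False
      have "0 \<le> 3 * A / A'" using A A' by simp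
      then show ?thesis using False unfolding Z_def of_bool_def by (auto split: if_splits)
    qed
  qed (use n in simp)
  also have "\<dots> = pr (gdist R n i0) (\<lambda>E. susc n E > M) + pr (gdist R n i0) (\<lambda>E. susc2 n E > A) + 3 * A / A'"
    using n by (simp add: expect_add)
  also have "j * (C / n\<^sup>2) \<le> C * (1 / (64 * M)) / n"
  proof -
    have "j * (C / n\<^sup>2) \<le> (n / (64 * M)) * (C / n\<^sup>2)" using j C0 by (intro mult_right_mono) auto
    then show ?thesis using n by (simp add: power2_eq_square field_simps)
  qed
  finally show ?thesis by (simp add: C_def)
qed

section \<open>Counting components\<close>

text \<open>The average of \<open>1/|C(v)|\<close> is the number of components divided by \<open>n\<close>.\<close>

lemma gain_inverse:
  assumes "u \<in> {1..n}" "v \<in> {1..n}"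
  shows "gain n E (\<lambda>k. 1 / k) (u, v) = - of_bool (v \<notin> component n E u)"
  using comp_size_pos[of u n E] comp_size_pos[of v n E] assms
  by (auto simp: gain_def merge_gain_def)

lemma sum_same_component:
  "(\<Sum>u=1..n. \<Sum>v=1..n. g (comp_size n E u) * of_bool (v \<in> component n E u)) =
     n * size_avg n E (\<lambda>k. g k * real k)"
proof -
  have "(\<Sum>v=1..n. g (comp_size n E u) * of_bool (v \<in> component n E u)) =
      g (comp_size n E u) * real (comp_size n E u)" for u
  proof -
    have "(\<Sum>v=1..n. of_bool (v \<in> component n E u)) = real (comp_size n E u)"
      using Int_absorb1[OF component_subset[of n E u]] by (simp add: comp_size_def)
    then show ?thesis by (simp only: sum_distrib_left[symmetric])
  qed
  then have "(\<Sum>u=1..n. \<Sum>v=1..n. g (comp_size n E u) * of_bool (v \<in> component n E u)) =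
      (\<Sum>u=1..n. g (comp_size n E u) * real (comp_size n E u))" by (simp only:)
  also have "\<dots> = n * size_avg n E (\<lambda>k. g k * real k)" by (rule sum_size_avg)
  finally show ?thesis .
qed

lemma pr_sel_same_component:
  assumes "2 \<le> n"
  shows "pr (sel_pmf R n E) (\<lambda>(u, v). v \<in> component n E u) \<le> 4 * susc n E / n"
proof -
  let ?h = "\<lambda>e. of_bool ((\<lambda>(u, v). v \<in> component n E u) e) :: real"
  have "expect (sel_pmf R n E) ?h \<le> 2 * (2 / n\<^sup>2 * (\<Sum>u=1..n. \<Sum>v=1..n. ?h (u, v)))"
    using expect_sel_le[OF assms, of ?h R E] unif_le[OF assms, of ?h] by simp
  also have "\<dots> = 4 * susc n E / n"
    using sum_same_component[of "\<lambda>_. 1" n E] by (simp add: power2_eq_square)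
  finally show ?thesis .
qed

text \<open>There are \<open>n\<close> components at the start and a step merges two of them unless its edge falls inside a component,
which has probability at most \<open>4K/n\<close> while the susceptibility is at most \<open>K\<close>. Hence the susceptibility
cannot stay bounded for much more than \<open>n\<close> steps.\<close>

lemma susc_bounded_time:
  assumes "2 \<le> n" "0 \<le> K" "4 * K \<le> n"
  shows "pr (gdist R n m) (\<lambda>E. susc n E \<le> K) * (m / n * (1 - 4 * K / n)) \<le> 1"
proof -
  let ?F = "\<lambda>E. size_avg n E (\<lambda>k. 1 / k)"
  let ?p = "pr (gdist R n m) (\<lambda>E. susc n E \<le> K)"
  have one_step: "expect (graph_step R n E) ?F \<le> ?F E - of_bool (susc n E \<le> K) * ((1 - 4 * K / n) / n)" for E
  proof -
    have "expect (sel_pmf R n E) (gain n E (\<lambda>k. 1 / k)) =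
        expect (sel_pmf R n E) (\<lambda>e. - of_bool (\<not> (\<lambda>(u, v). v \<in> component n E u) e))"
      using set_sel_pmf[OF assms(1), of R E]
      by (intro expect_cong) (auto simp: potential_edges_def gain_inverse)
    also have "\<dots> = pr (sel_pmf R n E) (\<lambda>(u, v). v \<in> component n E u) - 1"
      using pr_not[of "sel_pmf R n E"] assms by simp
    finally have "expect (graph_step R n E) ?F =
        ?F E + (pr (sel_pmf R n E) (\<lambda>(u, v). v \<in> component n E u) - 1) / n"
      using assms by (simp add: expect_step_size_avg)
    moreover have "(pr (sel_pmf R n E) (\<lambda>(u, v). v \<in> component n E u) - 1) / n \<le>
        (- (of_bool (susc n E \<le> K) * (1 - 4 * K / n))) / n"
    proof (rule divide_right_mono)
      show "pr (sel_pmf R n E) (\<lambda>(u, v). v \<in> component n E u) - 1 \<le>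
          - (of_bool (susc n E \<le> K) * (1 - 4 * K / n))"
      proof (cases "susc n E \<le> K")
        case True
        have "4 * susc n E / n \<le> 4 * K / n" using True by (intro divide_right_mono) auto
        with pr_sel_same_component[OF assms(1), of R E] show ?thesis using True by simp
      qed (use assms in \<open>simp add: pr_le_1\<close>)
    qed simp
    moreover have "(- (of_bool (susc n E \<le> K) * (1 - 4 * K / n))) / n =
        - (of_bool (susc n E \<le> K) * ((1 - 4 * K / n) / n))" by simp
    ultimately show ?thesis by linarith
  qed
  have "expect (gdist R n i) ?F \<le> 1 - i * (?p * ((1 - 4 * K / n) / n))" if "i \<le> m" for i
    using that
  proof (induction i)
    case (Suc i)
    have "?p \<le> pr (gdist R n i) (\<lambda>E. susc n E \<le> K)"
    proof -
      have "pr (gdist R n i) (\<lambda>E. \<not> susc n E \<le> K) \<le> pr (gdist R n m) (\<lambda>E. \<not> susc n E \<le> K)"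
        by (rule dist_from_persist)
          (use assms Suc.prems in \<open>auto dest: size_avg_step_mono[OF _ mono_real]\<close>)
      then show ?thesis using assms by (simp add: pr_not)
    qed
    then have le: "?p * ((1 - 4 * K / n) / n) \<le>
        pr (gdist R n i) (\<lambda>E. susc n E \<le> K) * ((1 - 4 * K / n) / n)"
      using assms by (intro mult_right_mono) auto
    have "expect (gdist R n (Suc i)) ?F = expect (gdist R n i) (\<lambda>E. expect (graph_step R n E) ?F)"
      using assms by (simp add: expect_bind)
    also have "\<dots> \<le> expect (gdist R n i) (\<lambda>E. ?F E - of_bool (susc n E \<le> K) * ((1 - 4 * K / n) / n))"
      using assms one_step by (intro expect_mono) auto
    also have "\<dots> = expect (gdist R n i) ?F - pr (gdist R n i) (\<lambda>E. susc n E \<le> K) * ((1 - 4 * K / n) / n)"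
      using assms by (subst expect_diff) auto
    finally have "expect (gdist R n (Suc i)) ?F \<le>
        1 - i * (?p * ((1 - 4 * K / n) / n)) - ?p * ((1 - 4 * K / n) / n)"
      using Suc le by linarith
    then show ?case by (simp add: distrib_right add_divide_distrib)
  qed (use assms in \<open>simp add: size_avg_empty\<close>)
  from this[of m] have "expect (gdist R n m) ?F \<le> 1 - m * (?p * ((1 - 4 * K / n) / n))" by simp
  moreover have "0 \<le> expect (gdist R n m) ?F" by (intro expect_nonneg size_avg_nonneg) auto
  ultimately show ?thesis by (simp add: mult_ac)
qed

section \<open>Concentration from one-sided drift\<close>

text \<open>The statistic \<open>Y\<close> is meant to stay below the moving line \<open>b\<close>. Its drift is controlled only on the event
\<open>J\<close>, which is never re-entered once left, only at good states, and only above the line; the squared excess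
needs no more, since the cross term \<open>2 max 0 (Y - b) \<xi>\<close> vanishes below the line. With increments of order
\<open>1/n\<close> the variance terms \<open>c\<^sup>2\<close> add up to \<open>O(1/n)\<close>, and a bad state costs \<open>O(1/n)\<close> times its probability,
so it is enough that bad states are unlikely at each single time.\<close>

lemma drift_concentration:
  fixes Y :: "graph \<Rightarrow> real" and b :: "nat \<Rightarrow> real"
  assumes n: "2 \<le> n" and le: "i0 \<le> i1" and nonneg: "0 \<le> c" "0 \<le> M" "0 \<le> r"
    and J: "\<And>E E'. E' \<in> set_pmf (graph_step R n E) \<Longrightarrow> J E' \<Longrightarrow> J E"
    and jump: "\<And>i E E'. J E \<Longrightarrow> E' \<in> set_pmf (graph_step R n E) \<Longrightarrow> i0 \<le> i \<Longrightarrow> i < i1 \<Longrightarrow>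
      \<bar>Y E' - Y E - (b (Suc i) - b i)\<bar> \<le> c"
    and M: "\<And>i E. J E \<Longrightarrow> i0 \<le> i \<Longrightarrow> i < i1 \<Longrightarrow> Y E - b i \<le> M"
    and drift: "\<And>i E. J E \<Longrightarrow> G E \<Longrightarrow> i0 \<le> i \<Longrightarrow> i < i1 \<Longrightarrow> b i \<le> Y E \<Longrightarrow>
      expect (graph_step R n E) Y \<le> Y E + (b (Suc i) - b i)"
    and bad: "\<And>i. i0 \<le> i \<Longrightarrow> i < i1 \<Longrightarrow> pr (gdist R n i) (\<lambda>E. \<not> G E) \<le> r"
  shows "expect (gdist R n i1) (\<lambda>E. of_bool (J E) * (max 0 (Y E - b i1))\<^sup>2) \<le>
    expect (gdist R n i0) (\<lambda>E. of_bool (J E) * (max 0 (Y E - b i0))\<^sup>2) +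
    (real i1 - real i0) * (c\<^sup>2 + 2 * M * c * r)"
proof -
  define V where "V i E = of_bool (J E) * (max 0 (Y E - b i))\<^sup>2" for i E
  have one_step: "expect (graph_step R n E) (V (Suc i)) \<le> V i E + c\<^sup>2 + 2 * M * c * of_bool (\<not> G E)"
    if i: "i0 \<le> i" "i < i1" for i E
  proof (cases "J E")
    case False
    have "expect (graph_step R n E) (V (Suc i)) = expect (graph_step R n E) (\<lambda>_. 0)"
      using False J by (intro expect_cong) (auto simp: V_def)
    then show ?thesis using nonneg by (simp add: V_def)
  next
    case True
    define x where "x = max 0 (Y E - b i)"
    define \<xi> where "\<xi> E' = Y E' - Y E - (b (Suc i) - b i)" for E'
    have \<xi>: "\<bar>\<xi> E'\<bar> \<le> c" if "E' \<in> set_pmf (graph_step R n E)" for E'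
      using jump[OF True that i] by (simp add: \<xi>_def)
    have x: "0 \<le> x" "x \<le> M" using M[OF True i] nonneg by (auto simp: x_def)
    have "V (Suc i) E' \<le> (x\<^sup>2 + c\<^sup>2) + 2 * x * \<xi> E'" if "E' \<in> set_pmf (graph_step R n E)" for E'
    proof -
      have "V (Suc i) E' \<le> (max 0 ((Y E - b i) + \<xi> E'))\<^sup>2" by (simp add: V_def \<xi>_def algebra_simps)
      also have "\<dots> \<le> x\<^sup>2 + 2 * x * \<xi> E' + (\<xi> E')\<^sup>2" unfolding x_def by (rule pos_part_sq_le)
      also have "(\<xi> E')\<^sup>2 \<le> c\<^sup>2" using \<xi>[OF that] by (simp add: abs_le_square_iff[symmetric])
      finally show ?thesis by simp
    qed
    then have "expect (graph_step R n E) (V (Suc i)) \<le>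
        expect (graph_step R n E) (\<lambda>E'. (x\<^sup>2 + c\<^sup>2) + 2 * x * \<xi> E')"
      using n by (intro expect_mono) auto
    also have "\<dots> = x\<^sup>2 + c\<^sup>2 + 2 * x * expect (graph_step R n E) \<xi>"
      using n by (subst expect_add) auto
    also have "2 * x * expect (graph_step R n E) \<xi> \<le> 2 * M * c * of_bool (\<not> G E)"
    proof (cases "x = 0 \<or> G E")
      case True
      have "x * expect (graph_step R n E) \<xi> \<le> 0"
      proof (cases "x = 0")
        case False
        then have "b i \<le> Y E" "G E" using True by (auto simp: x_def max_def split: if_splits)
        then have "expect (graph_step R n E) Y \<le> Y E + (b (Suc i) - b i)"
          using drift \<open>J E\<close> i by blast
        then have "expect (graph_step R n E) \<xi> \<le> 0"
          using n expect_diff[of "graph_step R n E" Y "\<lambda>_. Y E + (b (Suc i) - b i)"]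
          by (simp add: \<xi>_def[abs_def] diff_diff_eq)
        then show ?thesis using x by (simp add: mult_nonneg_nonpos)
      qed simp
      moreover have "0 \<le> 2 * M * c * of_bool (\<not> G E)" using nonneg by simp
      ultimately show ?thesis by linarith
    next
      case False
      have "expect (graph_step R n E) \<xi> \<le> expect (graph_step R n E) (\<lambda>_. c)"
        using n \<xi> by (intro expect_mono) force+
      then have "x * expect (graph_step R n E) \<xi> \<le> M * c"
        using x nonneg by (intro order.trans[OF mult_left_mono mult_right_mono]) auto
      then show ?thesis using False by simp
    qed
    finally show ?thesis using True by (simp add: V_def x_def)
  qed
  have "expect (gdist R n i) (V i) \<le> expect (gdist R n i0) (V i0) +
      (real i - real i0) * (c\<^sup>2 + 2 * M * c * r)" if "i0 \<le> i" "i \<le> i1" for i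
    using that
  proof (induction i rule: dec_induct)
    case (step i)
    have i: "i0 \<le> i" "i < i1" using step by auto
    have "expect (gdist R n (Suc i)) (V (Suc i)) =
        expect (gdist R n i) (\<lambda>E. expect (graph_step R n E) (V (Suc i)))"
      using n by (simp add: expect_bind)
    also have "\<dots> \<le> expect (gdist R n i) (\<lambda>E. V i E + (c\<^sup>2 + 2 * M * c * of_bool (\<not> G E)))"
      using n one_step[OF i] by (intro expect_mono) (auto simp: add.assoc)
    also have "\<dots> = expect (gdist R n i) (V i) + (c\<^sup>2 + 2 * M * c * pr (gdist R n i) (\<lambda>E. \<not> G E))"
      using n by (subst expect_add, simp, subst expect_add) auto
    also have "\<dots> \<le> expect (gdist R n i) (V i) + (c\<^sup>2 + 2 * M * c * r)"
      using nonneg bad[OF i] by (intro add_left_mono mult_left_mono) auto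
    finally show ?case using step by (simp add: distrib_right diff_divide_distrib algebra_simps)
  qed simp
  from this[of i1] show ?thesis using le by (simp add: V_def[abs_def])
qed

lemma drift_tail:
  assumes "2 \<le> n" "0 < s"
    and V: "expect (gdist R n i) (\<lambda>E. of_bool (J E) * (max 0 (Y E - b))\<^sup>2) \<le> v"
    and P: "\<And>E. P E \<Longrightarrow> J E \<and> b + s \<le> Y E"
  shows "pr (gdist R n i) P \<le> v / s\<^sup>2"
proof -
  have "pr (gdist R n i) P \<le> expect (gdist R n i) (\<lambda>E. of_bool (J E) * (max 0 (Y E - b))\<^sup>2) / s\<^sup>2"
  proof (rule pr_markov)
    fix E assume "P E"
    then have "J E" "s \<le> max 0 (Y E - b)" using P[of E] by auto
    then show "s\<^sup>2 \<le> of_bool (J E) * (max 0 (Y E - b))\<^sup>2"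
      using assms by (simp add: power_mono)
  qed (use assms in auto)
  also have "\<dots> \<le> v / s\<^sup>2" using V by (rule divide_right_mono) simp
  finally show ?thesis .
qed

text \<open>A statistic with \<open>s' \<ge> 2\<kappa>s\<^sup>2\<close> would be infinite by time \<open>1/(2\<kappa>K)\<close> if it started from \<open>K\<close>. The reciprocal
\<open>Y = 1/s\<close> has drift at most \<open>-\<kappa>/n\<close> and bounded range, and it concentrates below a line that becomes
negative; since \<open>Y > 0\<close>, the event \<open>J\<close> that the drift bound is still in force must have ended. The bounds
on \<open>s\<close> are what makes the increments of \<open>Y\<close> of order \<open>1/n\<close>.\<close>

lemma reciprocal_growth:
  fixes s :: "graph \<Rightarrow> real"
  assumes n: "2 \<le> n" and le: "i0 \<le> i1"
    and pos: "0 < \<sigma>" "0 < \<kappa>" "0 < K" "0 < D" "0 \<le> r" "0 < T"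
    and J: "\<And>E E'. E' \<in> set_pmf (graph_step R n E) \<Longrightarrow> J E' \<Longrightarrow> J E"
    and low: "\<And>E. \<sigma> \<le> s E"
    and incr: "\<And>E E'. E' \<in> set_pmf (graph_step R n E) \<Longrightarrow> s E \<le> s E' \<and> s E' \<le> s E + D / n"
    and D: "D / n \<le> \<sigma>"
    and drift: "\<And>E. J E \<Longrightarrow> G E \<Longrightarrow> s E + 2 * \<kappa> * (s E)\<^sup>2 / n \<le> expect (graph_step R n E) s"
    and start: "pr (gdist R n i0) (\<lambda>E. s E < K) \<le> r0"
    and bad: "\<And>i. i0 \<le> i \<Longrightarrow> i < i1 \<Longrightarrow> pr (gdist R n i) (\<lambda>E. \<not> G E) \<le> r"
    and T: "T / 2 \<le> (real i1 - real i0) / n" "(real i1 - real i0) / n \<le> 2 * T"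
    and K: "2 / K \<le> \<kappa> * (T / 2)"
  shows "pr (gdist R n i1) J \<le>
    (r0 / \<sigma>\<^sup>2 + 2 * T * ((D / \<sigma>\<^sup>2 + \<kappa>)\<^sup>2 / n + 2 * (1 / \<sigma> + 2 * \<kappa> * T) * (D / \<sigma>\<^sup>2 + \<kappa>) * r)) * 16 / (\<kappa> * T)\<^sup>2"
proof -
  define Y where "Y E = 1 / s E" for E
  define b where "b i = 1 / K - \<kappa> * (real i - real i0) / n" for i
  define B where "B = D / \<sigma>\<^sup>2 + \<kappa>"
  define M where "M = 1 / \<sigma> + 2 * \<kappa> * T"
  define x where "x = (real i1 - real i0) / n"
  have B0: "0 \<le> B" and M0: "0 \<le> M" using pos by (auto simp: B_def M_def)
  have s0: "0 < s E" for E using low[of E] pos by linarith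
  have Y: "0 < Y E" "Y E \<le> 1 / \<sigma>" for E
    using s0[of E] low[of E] pos by (auto simp: Y_def frac_le)
  have b_step: "b (Suc i) - b i = - (\<kappa> / n)" for i
    by (simp add: b_def diff_divide_distrib add_divide_distrib right_diff_distrib distrib_left)
  have main: "expect (gdist R n i1) (\<lambda>E. of_bool (J E) * (max 0 (Y E - b i1))\<^sup>2) \<le>
    expect (gdist R n i0) (\<lambda>E. of_bool (J E) * (max 0 (Y E - b i0))\<^sup>2) +
    (real i1 - real i0) * ((B / n)\<^sup>2 + 2 * M * (B / n) * r)"
  proof (rule drift_concentration[where G = G])
    fix i E E' assume E': "E' \<in> set_pmf (graph_step R n E)"
    have "Y E - Y E' = (s E' - s E) / (s E * s E')" using s0[of E] s0[of E']
      by (simp add: Y_def field_simps)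
    moreover have "0 \<le> \<dots>" using incr[OF E'] s0[of E] s0[of E'] by simp
    moreover have "\<dots> \<le> (D / n) / (\<sigma> * \<sigma>)"
      using incr[OF E'] low[of E] low[of E'] pos by (intro frac_le mult_mono) auto
    ultimately
    have "\<bar>Y E' - Y E - (b (Suc i) - b i)\<bar> \<le> (D / n) / (\<sigma> * \<sigma>) + \<kappa> / n"
    proof -
      have "0 < \<kappa> / n" using pos n by simp
      moreover have "\<bar>y' - y - - k\<bar> \<le> d + k" if "0 \<le> y - y'" "y - y' \<le> d" "0 < k" for y y' d k :: real
        using that by linarith
      ultimately show ?thesis
        unfolding b_step using \<open>Y E - Y E' = _\<close> \<open>0 \<le> (s E' - s E) / _\<close> \<open>_ \<le> (D / n) / _\<close>
        by metis
    qed
    also have "\<dots> = B / n" by (simp add: B_def add_divide_distrib power2_eq_square)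
    finally show "\<bar>Y E' - Y E - (b (Suc i) - b i)\<bar> \<le> B / n" .
  next
    fix i E assume i: "i0 \<le> i" "i < i1"
    have "(real i - real i0) / n \<le> 2 * T"
      using i T(2) divide_right_mono[of "real i - real i0" "real i1 - real i0" n] by simp
    then have "\<kappa> * ((real i - real i0) / n) \<le> \<kappa> * (2 * T)" using pos by (intro mult_left_mono) auto
    then have "\<kappa> * (real i - real i0) / n \<le> 2 * \<kappa> * T" by simp
    moreover have "0 < 1 / K" using pos by simp
    ultimately show "Y E - b i \<le> M" using Y(2)[of E] unfolding b_def M_def by linarith
  next
    fix i E assume "J E" "G E"
    note d = drift[OF this]
    have "expect (graph_step R n E) Y \<le> expect (graph_step R n E) (\<lambda>E'. Y E - (s E' - s E) / (2 * (s E)\<^sup>2))"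
    proof (rule expect_mono)
      fix E' assume E': "E' \<in> set_pmf (graph_step R n E)"
      have "s E' \<le> 2 * s E" using incr[OF E'] low[of E] D by linarith
      then have "s E * s E' \<le> 2 * (s E)\<^sup>2" using s0[of E] by (simp add: power2_eq_square)
      then have "(s E' - s E) / (2 * (s E)\<^sup>2) \<le> (s E' - s E) / (s E * s E')"
        using incr[OF E'] s0[of E] s0[of E'] by (intro divide_left_mono) auto
      also have "\<dots> = Y E - Y E'" using s0[of E] s0[of E'] by (simp add: Y_def field_simps)
      finally show "Y E' \<le> Y E - (s E' - s E) / (2 * (s E)\<^sup>2)" by simp
    qed (use n in simp)
    also have "\<dots> = Y E - (expect (graph_step R n E) s - s E) / (2 * (s E)\<^sup>2)"
      using n by (simp add: expect_diff)
    also have "\<dots> \<le> Y E - (2 * \<kappa> * (s E)\<^sup>2 / n) / (2 * (s E)\<^sup>2)"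
      using d by (intro diff_left_mono divide_right_mono) auto
    also have "\<dots> = Y E + (b (Suc i) - b i)" using s0[of E] by (simp add: b_step)
    finally show "expect (graph_step R n E) Y \<le> Y E + (b (Suc i) - b i)" .
  qed (use n le B0 M0 pos J bad in auto)
  have "expect (gdist R n i0) (\<lambda>E. of_bool (J E) * (max 0 (Y E - b i0))\<^sup>2) \<le>
      expect (gdist R n i0) (\<lambda>E. of_bool (s E < K) * (1 / \<sigma>\<^sup>2))"
  proof (rule expect_mono)
    fix E
    show "of_bool (J E) * (max 0 (Y E - b i0))\<^sup>2 \<le> of_bool (s E < K) * (1 / \<sigma>\<^sup>2)"
    proof (cases "s E < K")
      case True
      have "max 0 (Y E - b i0) \<le> 1 / \<sigma>" using Y[of E] pos by (simp add: b_def) (smt (verit) zero_less_divide_1_iff)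
      then have "(max 0 (Y E - b i0))\<^sup>2 \<le> (1 / \<sigma>)\<^sup>2" by (intro power_mono) auto
      then show ?thesis using True by (simp add: power_divide)
    next
      case False
      then have "Y E \<le> b i0" using pos by (simp add: Y_def b_def frac_le)
      then show ?thesis by simp
    qed
  qed (use n in simp)
  also have "\<dots> \<le> r0 / \<sigma>\<^sup>2" using start by (simp add: divide_right_mono)
  finally have V: "expect (gdist R n i1) (\<lambda>E. of_bool (J E) * (max 0 (Y E - b i1))\<^sup>2) \<le>
    r0 / \<sigma>\<^sup>2 + (real i1 - real i0) * ((B / n)\<^sup>2 + 2 * M * (B / n) * r)" using main by linarith
  also have "(real i1 - real i0) * ((B / n)\<^sup>2 + 2 * M * (B / n) * r) = x * (B\<^sup>2 / n + 2 * M * B * r)"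
    using n by (simp add: x_def power2_eq_square field_simps)
  also have "\<dots> \<le> 2 * T * (B\<^sup>2 / n + 2 * M * B * r)"
    using T B0 M0 pos by (intro mult_right_mono) (auto simp: x_def)
  finally have V: "expect (gdist R n i1) (\<lambda>E. of_bool (J E) * (max 0 (Y E - b i1))\<^sup>2) \<le>
    r0 / \<sigma>\<^sup>2 + 2 * T * (B\<^sup>2 / n + 2 * M * B * r)" by simp
  have "pr (gdist R n i1) J \<le> (r0 / \<sigma>\<^sup>2 + 2 * T * (B\<^sup>2 / n + 2 * M * B * r)) / (\<kappa> * T / 4)\<^sup>2"
  proof (rule drift_tail[OF n _ V])
    fix E assume "J E"
    have "\<kappa> * (T / 2) \<le> \<kappa> * x" using T pos by (intro mult_left_mono) (auto simp: x_def)
    then have "b i1 + \<kappa> * T / 4 \<le> 0" using K pos by (simp add: b_def x_def)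
    then show "J E \<and> b i1 + \<kappa> * T / 4 \<le> Y E" using \<open>J E\<close> Y(1)[of E] by linarith
  qed (use pos in simp)
  also have "\<dots> = (r0 / \<sigma>\<^sup>2 + 2 * T * (B\<^sup>2 / n + 2 * M * B * r)) * 16 / (\<kappa> * T)\<^sup>2"
    by (simp add: power_divide)
  finally show ?thesis unfolding B_def M_def .
qed

section \<open>Uniform sprinkling inside the process\<close>

text \<open>The law of the added edge dominates \<open>\<eta>\<close> times the uniform law: the process contains a sprinkling of uniformly
random edges at rate \<open>\<eta>\<close>.\<close>

definition elliptic :: "size_rule \<Rightarrow> nat \<Rightarrow> real \<Rightarrow> graph \<Rightarrow> bool" where
  "elliptic R n \<eta> E \<longleftrightarrow>
     (\<forall>h. (\<forall>e. 0 \<le> h e) \<longrightarrow> \<eta> * unif n h \<le> expect (sel_pmf R n E) h)"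

text \<open>Uniformity in the step, rather than validity at all steps at once, is what drift arguments need: they pay for
the probability of a bad state step by step.\<close>

definition rare :: "size_rule \<Rightarrow> real \<Rightarrow> real \<Rightarrow> (nat \<Rightarrow> graph \<Rightarrow> bool) \<Rightarrow> bool" where
  "rare R t1 t2 P \<longleftrightarrow> (\<forall>\<epsilon>>0. \<forall>\<^sub>F n in sequentially.
     \<forall>i. t1 * real n \<le> real i \<and> real i \<le> t2 * real n \<longrightarrow> pr (gdist R n i) (P n) \<le> \<epsilon>)"

lemma rare_or:
  assumes "rare R t1 t2 P" "rare R t1 t2 Q"
  shows "rare R t1 t2 (\<lambda>n E. P n E \<or> Q n E)"
  unfolding rare_def
proof (intro allI impI)
  fix \<epsilon> :: real assume "0 < \<epsilon>"
  then have "0 < \<epsilon> / 2" by simp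
  with assms have "\<forall>\<^sub>F n in sequentially. \<forall>i. t1 * real n \<le> real i \<and> real i \<le> t2 * real n \<longrightarrow> pr (gdist R n i) (P n) \<le> \<epsilon> / 2"
    "\<forall>\<^sub>F n in sequentially. \<forall>i. t1 * real n \<le> real i \<and> real i \<le> t2 * real n \<longrightarrow> pr (gdist R n i) (Q n) \<le> \<epsilon> / 2"
    unfolding rare_def by blast+
  then show "\<forall>\<^sub>F n in sequentially. \<forall>i. t1 * real n \<le> real i \<and> real i \<le> t2 * real n \<longrightarrow>
      pr (gdist R n i) (\<lambda>E. P n E \<or> Q n E) \<le> \<epsilon>"
    using eventually_ge_at_top[of 2]
  proof eventually_elim
    case (elim n)
    show ?case
    proof (intro allI impI)
      fix i assume i: "t1 * real n \<le> real i \<and> real i \<le> t2 * real n"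
      have "pr (gdist R n i) (\<lambda>E. P n E \<or> Q n E) \<le> pr (gdist R n i) (P n) + pr (gdist R n i) (Q n)"
        using elim by (intro pr_Un) auto
      with elim i show "pr (gdist R n i) (\<lambda>E. P n E \<or> Q n E) \<le> \<epsilon>" by fastforce
    qed
  qed
qed

lemma rare_mono:
  assumes "rare R t1 t2 P" "t1 \<le> s1" "s2 \<le> t2"
    "\<forall>\<^sub>F n in sequentially. \<forall>E. Q n E \<longrightarrow> P n E"
  shows "rare R s1 s2 Q"
  unfolding rare_def
proof (intro allI impI)
  fix \<epsilon> :: real assume "0 < \<epsilon>"
  with assms(1) have "\<forall>\<^sub>F n in sequentially. \<forall>i. t1 * real n \<le> real i \<and> real i \<le> t2 * real n \<longrightarrow> pr (gdist R n i) (P n) \<le> \<epsilon>"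
    unfolding rare_def by blast
  then show "\<forall>\<^sub>F n in sequentially. \<forall>i. s1 * real n \<le> real i \<and> real i \<le> s2 * real n \<longrightarrow> pr (gdist R n i) (Q n) \<le> \<epsilon>"
    using eventually_ge_at_top[of 2] assms(4)
  proof eventually_elim
    case (elim n)
    show ?case
    proof (intro allI impI)
      fix i assume i: "s1 * real n \<le> real i \<and> real i \<le> s2 * real n"
      have "t1 * n \<le> s1 * n" "s2 * n \<le> t2 * n" using assms by (auto intro: mult_right_mono)
      then have "pr (gdist R n i) (P n) \<le> \<epsilon>" using elim(1) i by fastforce
      moreover have "pr (gdist R n i) (Q n) \<le> pr (gdist R n i) (P n)"
        using elim by (intro pr_mono) auto
      ultimately show "pr (gdist R n i) (Q n) \<le> \<epsilon>" by linarith
    qed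
  qed
qed

text \<open>The only place where the take-it-or-leave-it property is exploited: a rejected first edge is replaced by an edge
that is uniform given the rejection.\<close>

lemma expect_sel_take_it:
  assumes "2 \<le> n" "\<And>a b c d. R a b c d = T a b"
  shows "expect (sel_pmf R n E) h =
    unif n (\<lambda>e. if T (comp_size n E (fst e)) (comp_size n E (snd e)) then h e else unif n h)"
  unfolding expect_sel_choice[OF assms(1)]
proof -
  have "unif n (\<lambda>(v3, v4). h (sel_pair R n E ((v1, v2), (v3, v4)))) =
      (if T (comp_size n E v1) (comp_size n E v2) then h (v1, v2) else unif n h)" for v1 v2
    by (simp add: sel_pair_def assms case_prod_unfold unif_const)
  then show "unif n (\<lambda>(v1, v2). unif n (\<lambda>(v3, v4). h (sel_pair R n E ((v1, v2), (v3, v4))))) =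
      unif n (\<lambda>e. if T (comp_size n E (fst e)) (comp_size n E (snd e)) then h e else unif n h)"
    by (intro arg_cong[where f = "unif n"]) (auto simp: fun_eq_iff)
qed

lemma sum_all_pairs:
  "(\<Sum>u=1..n. \<Sum>v=1..n. (h (u, v) :: real)) = (\<Sum>e\<in>potential_edges n. h e) + (\<Sum>v=1..n. h (v, v))"
proof -
  have U: "{1..n} \<times> {1..n} = potential_edges n \<union> (\<lambda>v. (v, v)) ` {1..n}"
    by (auto simp: potential_edges_def)
  have "(\<Sum>u=1..n. \<Sum>v=1..n. h (u, v)) = (\<Sum>e\<in>{1..n} \<times> {1..n}. h e)"
    by (simp add: sum.cartesian_product)
  also have "\<dots> = (\<Sum>e\<in>potential_edges n. h e) + (\<Sum>e\<in>(\<lambda>v. (v, v)) ` {1..n}. h e)"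
    unfolding U by (rule sum.union_disjoint, simp, simp) (auto simp: potential_edges_def)
  also have "(\<Sum>e\<in>(\<lambda>v. (v, v)) ` {1..n}. h e) = (\<Sum>v=1..n. h (v, v))"
    by (subst sum.reindex) (auto simp: inj_on_def)
  finally show ?thesis .
qed

text \<open>Passing from distinct pairs to all pairs loses at most the diagonal.\<close>

lemma unif_pairs_ge:
  assumes "2 \<le> n" "\<And>u v. 0 \<le> h (u, v)" "\<And>u. h (u, u) \<le> c"
  shows "(\<Sum>u=1..n. \<Sum>v=1..n. h (u, v)) / n\<^sup>2 - c / n \<le> unif n h"
proof -
  let ?s = "\<Sum>u=1..n. \<Sum>v=1..n. h (u, v)"
  have "(\<Sum>v=1..n. h (v, v)) \<le> (\<Sum>v=1..n. c)" using assms by (intro sum_mono) auto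
  then have s: "?s - c * n \<le> (\<Sum>e\<in>potential_edges n. h e)"
    using sum_all_pairs[of h n] by (simp add: mult.commute)
  show ?thesis
  proof (cases "?s - c * n \<ge> 0")
    case True
    have "?s / n\<^sup>2 - c / n = (?s - c * n) / n\<^sup>2"
      using assms(1) by (simp add: diff_divide_distrib power2_eq_square)
    also have "\<dots> \<le> (?s - c * n) / (real n * (real n - 1))"
      using True assms(1) by (intro divide_left_mono) (auto simp: power2_eq_square)
    also have "\<dots> \<le> unif n h" unfolding unif_eq[OF assms(1)]
      using s assms(1) by (intro divide_right_mono) auto
    finally show ?thesis by simp
  next
    case False
    then have "?s / n\<^sup>2 - c / n \<le> 0" using assms(1) by (simp add: field_simps power2_eq_square)
    moreover have "0 \<le> unif n h" using assms by (intro unif_nonneg) auto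
    ultimately show ?thesis by simp
  qed
qed

lemma unif_sizes_ge:
  assumes "2 \<le> n"
  shows "frac_of_size n E a * frac_of_size n E b - 1 / n \<le>
    unif n (\<lambda>e. of_bool (comp_size n E (fst e) = a \<and> comp_size n E (snd e) = b))"
proof -
  have "(\<Sum>u=1..n. \<Sum>v=1..n. of_bool (comp_size n E u = a \<and> comp_size n E v = b)) =
      n\<^sup>2 * (frac_of_size n E a * frac_of_size n E b)"
    using sum_pairs_size_avg[of "\<lambda>k. of_bool (k = a)" n E "\<lambda>k. of_bool (k = b)"]
    by (simp add: of_bool_conj)
  then show ?thesis
    using unif_pairs_ge[OF assms, of "\<lambda>e. of_bool (comp_size n E (fst e) = a \<and> comp_size n E (snd e) = b)" 1]
      assms by simp
qed

lemma frac_of_size_jump: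
  assumes "2 \<le> n" "E' \<in> set_pmf (graph_step R n E)"
  shows "\<bar>frac_of_size n E' a - frac_of_size n E a\<bar> \<le> 2 * real a / n"
proof -
  obtain u v where uv: "u \<in> {1..n}" "v \<in> {1..n}" "u \<noteq> v" "E' = add_edge E (u, v)"
    using step_cases[OF assms] by blast
  have "\<bar>merge_gain (\<lambda>k. of_bool (k = a)) x y\<bar> \<le> 2 * real a" for x y
    unfolding merge_gain_def by (auto simp: of_bool_def)
  then have "\<bar>gain n E (\<lambda>k. of_bool (k = a)) (u, v)\<bar> \<le> 2 * real a"
    by (simp add: gain_def)
  then show ?thesis
    using uv by (simp add: size_avg_add_edge potential_edges_def divide_right_mono)
qed

text \<open>Vertices leave components of size \<open>a\<close> at a rate proportional to their number, which gives the loss term; the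
gain term only counts merges that create a component of size \<open>a\<close>.\<close>

lemma frac_of_size_drift:
  assumes "2 \<le> n" "1 \<le> a"
  shows "frac_of_size n E a - 8 * a * frac_of_size n E a / n + a * pr (sel_pmf R n E)
      (\<lambda>e. comp_size n E (fst e) + comp_size n E (snd e) = a \<and> snd e \<notin> component n E (fst e)) / n
    \<le> expect (graph_step R n E) (\<lambda>E'. frac_of_size n E' a)"
proof -
  let ?P = "\<lambda>e. comp_size n E (fst e) + comp_size n E (snd e) = a \<and> snd e \<notin> component n E (fst e)"
  let ?f = "\<lambda>k. of_bool (k = a) :: real"
  let ?l = "\<lambda>f g. (\<lambda>(u, v). f (comp_size n E u) * g (comp_size n E v) :: real)"
  let ?e = "expect (sel_pmf R n E)"
  have "?e (\<lambda>e. a * of_bool (?P e) - a * ?l ?f (\<lambda>_. 1) e - a * ?l (\<lambda>_. 1) ?f e) \<le>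
      ?e (gain n E ?f)"
  proof (rule expect_mono)
    fix e assume "e \<in> set_pmf (sel_pmf R n E)"
    then have "e \<in> potential_edges n" using set_sel_pmf[OF assms(1)] by blast
    then show "a * of_bool (?P e) - a * ?l ?f (\<lambda>_. 1) e - a * ?l (\<lambda>_. 1) ?f e \<le> gain n E ?f e"
      by (auto simp: gain_def merge_gain_def of_bool_def split: prod.splits)
  qed (use assms in simp)
  moreover have "?e (\<lambda>e. a * of_bool (?P e) - a * ?l ?f (\<lambda>_. 1) e - a * ?l (\<lambda>_. 1) ?f e) =
      a * pr (sel_pmf R n E) ?P - a * ?e (?l ?f (\<lambda>_. 1)) - a * ?e (?l (\<lambda>_. 1) ?f)"
    using assms by (subst expect_diff, simp, subst expect_diff) auto
  moreover have "?e (?l ?f (\<lambda>_. 1)) \<le> 4 * frac_of_size n E a" "?e (?l (\<lambda>_. 1) ?f) \<le> 4 * frac_of_size n E a"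
    using expect_sel_product_le[OF assms(1), of ?f "\<lambda>_. 1" R E]
      expect_sel_product_le[OF assms(1), of "\<lambda>_. 1" ?f R E] assms(1)
    by (simp_all add: size_avg_const)
  then have "a * ?e (?l ?f (\<lambda>_. 1)) \<le> a * (4 * frac_of_size n E a)"
    "a * ?e (?l (\<lambda>_. 1) ?f) \<le> a * (4 * frac_of_size n E a)"
    by (intro mult_left_mono; simp)+
  ultimately have "a * pr (sel_pmf R n E) ?P - 8 * a * frac_of_size n E a \<le> ?e (gain n E ?f)"
    by linarith
  then have "(a * pr (sel_pmf R n E) ?P - 8 * a * frac_of_size n E a) / n \<le> ?e (gain n E ?f) / n"
    by (rule divide_right_mono) simp
  then show ?thesis
    using expect_step_size_avg[OF assms(1), of R E ?f] by (simp add: diff_divide_distrib)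
qed

lemma frac_of_size_nonneg: "0 \<le> frac_of_size n E a"
  by (rule size_avg_nonneg) simp

text \<open>The fraction of isolated vertices decays at most exponentially: it stays above the line \<open>exp (-16 i/n)\<close>
up to fluctuations of order \<open>1 / sqrt n\<close>.\<close>

lemma isolated_persist:
  assumes "0 \<le> t2"
  shows "\<exists>c>0. rare R 0 t2 (\<lambda>n E. frac_of_size n E 1 < c)"
proof (intro exI conjI)
  let ?c = "exp (- 16 * t2) / 2"
  show "0 < ?c" by simp
  show "rare R 0 t2 (\<lambda>n E. frac_of_size n E 1 < ?c)"
    unfolding rare_def
  proof (intro allI impI)
    fix \<epsilon> :: real assume \<epsilon>: "0 < \<epsilon>"
    have "(\<lambda>n. t2 * 324 / ?c\<^sup>2 / real n) \<longlonglongrightarrow> 0" by (rule lim_const_over_n)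
    then have "\<forall>\<^sub>F n in sequentially. t2 * 324 / ?c\<^sup>2 / real n < \<epsilon>"
      using \<epsilon> by (rule order_tendstoD)
    then show "\<forall>\<^sub>F n in sequentially. \<forall>i. 0 * real n \<le> real i \<and> real i \<le> t2 * real n \<longrightarrow>
        pr (gdist R n i) (\<lambda>E. frac_of_size n E 1 < ?c) \<le> \<epsilon>"
      using eventually_ge_at_top[of 16]
    proof eventually_elim
      case (elim n)
      have n: "2 \<le> n" using elim by simp
      define z where "z = 8 / real n"
      have z: "0 < z" "z \<le> 1 / 2" using elim by (auto simp: z_def field_simps)
      have ez: "z \<le> 1 - exp (- 2 * z)" "1 - exp (- 2 * z) \<le> 2 * z"
      proof -
        have "1 \<le> (1 - z) * (1 + 2 * z)" using z by (simp add: algebra_simps)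
        also have "\<dots> \<le> (1 - z) * exp (2 * z)" using z exp_ge_add_one_self[of "2 * z"] by (intro mult_left_mono) auto
        finally have "exp (- 2 * z) * 1 \<le> exp (- 2 * z) * ((1 - z) * exp (2 * z))"
          by (intro mult_left_mono) auto
        also have "\<dots> = 1 - z" by (simp add: mult.left_commute exp_add[symmetric])
        finally show "z \<le> 1 - exp (- 2 * z)" by simp
        show "1 - exp (- 2 * z) \<le> 2 * z" using exp_ge_add_one_self[of "- 2 * z"] by simp
      qed
      define b where "b i = - exp (- 2 * z * real i)" for i
      have b_step: "b (Suc i) - b i = exp (- 2 * z * i) * (1 - exp (- 2 * z))" for i
        by (simp add: b_def algebra_simps exp_add[symmetric])
      have b1: "- 1 \<le> b i" for i using z by (simp add: b_def)
      show ?case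
      proof (intro allI impI)
        fix i assume i: "0 * real n \<le> real i \<and> real i \<le> t2 * real n"
        have "expect (gdist R n i) (\<lambda>E. of_bool True * (max 0 (- frac_of_size n E 1 - b i))\<^sup>2) \<le>
          expect (gdist R n 0) (\<lambda>E. of_bool True * (max 0 (- frac_of_size n E 1 - b 0))\<^sup>2) +
          (real i - real 0) * ((18 / n)\<^sup>2 + 2 * 1 * (18 / n) * 0)"
        proof (rule drift_concentration[where G = "\<lambda>_. True"])
          fix k E E' assume "E' \<in> set_pmf (graph_step R n E)"
          then have "\<bar>frac_of_size n E' 1 - frac_of_size n E 1\<bar> \<le> 2 / n"
            using frac_of_size_jump[OF n, of E' R E 1] by simp
          moreover have "0 \<le> b (Suc k) - b k" unfolding b_step using ez z by (intro mult_nonneg_nonneg) auto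
          moreover have "b (Suc k) - b k \<le> 1 * (2 * z)" unfolding b_step using ez z by (intro mult_mono) auto
          moreover have "1 * (2 * z) = 16 / n" by (simp add: z_def)
          moreover have "18 / real n = 2 / n + 16 / n" by (simp add: field_simps)
          ultimately show "\<bar>- frac_of_size n E' 1 - - frac_of_size n E 1 - (b (Suc k) - b k)\<bar> \<le> 18 / n"
            by linarith
        next
          fix k E show "- frac_of_size n E 1 - b k \<le> 1"
            using b1[of k] frac_of_size_nonneg[of n E 1] by linarith
        next
          fix k E assume "b k \<le> - frac_of_size n E 1"
          then have x: "frac_of_size n E 1 \<le> exp (- 2 * z * k)" by (simp add: b_def)
          have "frac_of_size n E 1 - z * frac_of_size n E 1 \<le> expect (graph_step R n E) (\<lambda>E'. frac_of_size n E' 1)"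
          proof -
            have "0 \<le> real 1 * pr (sel_pmf R n E) (\<lambda>e. comp_size n E (fst e) + comp_size n E (snd e) = 1 \<and> snd e \<notin> component n E (fst e)) / n"
              using pr_nonneg by (intro divide_nonneg_nonneg mult_nonneg_nonneg) auto
            moreover have "z * frac_of_size n E 1 = 8 * real 1 * frac_of_size n E 1 / n"
              by (simp add: z_def)
            ultimately show ?thesis using frac_of_size_drift[OF n order.refl, of E R] by linarith
          qed
          moreover have "z * frac_of_size n E 1 \<le> b (Suc k) - b k"
            unfolding b_step using mult_mono[OF ez(1) x] z ez(1) frac_of_size_nonneg[of n E 1]
            by (simp add: mult.commute)
          ultimately show "expect (graph_step R n E) (\<lambda>E'. - frac_of_size n E' 1) \<le>
              - frac_of_size n E 1 + (b (Suc k) - b k)" by simp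
        qed (use n in auto)
        also have "expect (gdist R n 0) (\<lambda>E. of_bool True * (max 0 (- frac_of_size n E 1 - b 0))\<^sup>2) = 0"
          using n by (simp add: size_avg_empty b_def)
        also have "0 + (real i - real 0) * ((18 / n)\<^sup>2 + 2 * 1 * (18 / n) * 0) = real i * 324 / n\<^sup>2"
          by (simp add: power_divide)
        also have "\<dots> \<le> t2 * n * 324 / n\<^sup>2" using i by (intro divide_right_mono mult_right_mono) auto
        also have "\<dots> = t2 * 324 / n" using n by (simp add: power2_eq_square)
        finally have V: "expect (gdist R n i) (\<lambda>E. of_bool True * (max 0 (- frac_of_size n E 1 - b i))\<^sup>2) \<le> t2 * 324 / n" .
        have "pr (gdist R n i) (\<lambda>E. frac_of_size n E 1 < ?c) \<le> t2 * 324 / n / ?c\<^sup>2"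
        proof (rule drift_tail[OF n _ V])
          fix E assume E: "frac_of_size n E 1 < ?c"
          have "2 * z * i \<le> 16 * t2" using i n by (simp add: z_def field_simps)
          then have "exp (- 16 * t2) \<le> exp (- 2 * z * i)" by simp
          then show "True \<and> b i + ?c \<le> - frac_of_size n E 1"
            using E unfolding b_def by (intro conjI TrueI) linarith
        qed simp
        also have "t2 * 324 / n / ?c\<^sup>2 = t2 * 324 / ?c\<^sup>2 / n"
          by (simp only: divide_divide_eq_left mult.commute)
        finally show "pr (gdist R n i) (\<lambda>E. frac_of_size n E 1 < ?c) \<le> \<epsilon>" using elim by linarith
      qed
    qed
  qed
qed

text \<open>If an isolated vertex is always allowed to join a component of size \<open>j < a\<close>, then components of every size up to
\<open>a\<close> hold a positive fraction of the vertices at all times bounded away from 0. By induction, size \<open>a\<close> and size 1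
have positive density from time \<open>t1/2\<close> on, so size \<open>a + 1\<close> is fed at a rate of at least \<open>f0\<close>; the slope \<open>l\<close> of
the line is chosen so that feeding beats the loss all the way up to time \<open>t2\<close>.\<close>

lemma size_persist:
  assumes T: "\<And>a b c d. R a b c d = T a b" and "1 \<le> a" "\<And>j. 1 \<le> j \<Longrightarrow> j < a \<Longrightarrow> T 1 j"
    and "0 < t1" "t1 \<le> t2"
  shows "\<exists>c>0. rare R t1 t2 (\<lambda>n E. frac_of_size n E a < c)"
  using assms(2-)
proof (induction a arbitrary: t1 rule: dec_induct)
  case base
  obtain c where "c > 0" and c: "rare R 0 t2 (\<lambda>n E. frac_of_size n E 1 < c)"
    using isolated_persist[of t2 R] base by auto
  moreover have "rare R t1 t2 (\<lambda>n E. frac_of_size n E 1 < c)"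
    using c by (rule rare_mono) (use base in auto)
  ultimately show ?case by blast
next
  case (step a)
  have t: "0 < t1 / 2" "t1 / 2 \<le> t2" "0 < t2" using step.prems by auto
  obtain c1 where c1: "c1 > 0" "rare R 0 t2 (\<lambda>n E. frac_of_size n E 1 < c1)"
    using isolated_persist[of t2 R] t by auto
  obtain c' where c': "c' > 0" "rare R (t1 / 2) t2 (\<lambda>n E. frac_of_size n E a < c')"
    using step.IH[OF _ t(1,2)] step.prems by auto
  (* either ingredient of a new component of size a + 1, an isolated vertex or a component of size a, may be scarce *)
  define Bad where "Bad n E \<longleftrightarrow> frac_of_size n E 1 < c1 \<or> frac_of_size n E a < c'" for n E
  have "rare R (t1 / 2) t2 (\<lambda>n E. frac_of_size n E 1 < c1)"
    using c1(2) by (rule rare_mono) (use t in auto)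
  then have bad: "rare R (t1 / 2) t2 Bad" using rare_or[OF _ c'(2)] by (simp add: Bad_def[abs_def])
  define f0 where "f0 = c1 * c' / 2"
  define A where "A = real (Suc a)"
  define l where "l = f0 / (1 + 8 * A * t2)"
  define C where "C = 2 * A + l"
  define s where "s = l * t1 / 8"
  define m where "m = l * t2"
  have f0: "0 < f0" using c1 c' by (simp add: f0_def)
  have A: "1 \<le> A" by (simp add: A_def)
  have den: "0 < 1 + 8 * A * t2" using A t by (intro add_pos_pos mult_pos_pos) auto
  have l: "0 < l" unfolding l_def using f0 den by simp
  (* what remains of the feeding rate after the loss at the top of the line is exactly its slope *)
  have l_eq: "f0 - 8 * A * (l * t2) = l"
  proof -
    have "l * (1 + 8 * A * t2) = f0" using den by (simp add: l_def)
    then show ?thesis by (simp add: algebra_simps)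
  qed
  have pos: "0 < C" "0 < s" "0 < m" using A l t step.prems by (auto simp: C_def s_def m_def)
  show ?case
  proof (intro exI conjI)
    show "0 < s" by (rule pos)
    show "rare R t1 t2 (\<lambda>n E. frac_of_size n E (Suc a) < s)"
      unfolding rare_def
    proof (intro allI impI)
      fix \<epsilon> :: real assume \<epsilon>: "0 < \<epsilon>"
      define r where "r = \<epsilon> * s\<^sup>2 / (4 * t2 * m * C)"
      have r: "0 < r" using \<epsilon> pos t by (simp add: r_def)
      have "(\<lambda>n. t2 * C\<^sup>2 / s\<^sup>2 / real n) \<longlonglongrightarrow> 0" by (rule lim_const_over_n)
      moreover have "0 < \<epsilon> / 2" using \<epsilon> by simp
      ultimately have e1: "\<forall>\<^sub>F n in sequentially. t2 * C\<^sup>2 / s\<^sup>2 / real n < \<epsilon> / 2" by (rule order_tendstoD)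
      have "(\<lambda>n. 1 / real n) \<longlonglongrightarrow> 0" by (rule lim_const_over_n)
      then have e2: "\<forall>\<^sub>F n in sequentially. 1 / real n < f0" using f0 by (rule order_tendstoD)
      have "(\<lambda>n. 1 / real n) \<longlonglongrightarrow> 0" by (rule lim_const_over_n)
      then have e3: "\<forall>\<^sub>F n in sequentially. 1 / real n < t1 / 4"
        by (rule order_tendstoD) (use step.prems in simp)
      have e4: "\<forall>\<^sub>F n in sequentially. \<forall>i. t1 / 2 * real n \<le> real i \<and> real i \<le> t2 * real n \<longrightarrow>
          pr (gdist R n i) (Bad n) \<le> r"
        using bad r unfolding rare_def by blast
      show "\<forall>\<^sub>F n in sequentially. \<forall>i. t1 * real n \<le> real i \<and> real i \<le> t2 * real n \<longrightarrow>
          pr (gdist R n i) (\<lambda>E. frac_of_size n E (Suc a) < s) \<le> \<epsilon>"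
        using e1 e2 e3 e4 eventually_ge_at_top[of 2]
      proof eventually_elim
        case (elim n)
        have n: "2 \<le> n" by fact
        have t1n: "1 < t1 / 4 * n" using elim(3) n by (simp add: field_simps)
        define i0 where "i0 = nat \<lceil>t1 / 2 * n\<rceil>"
        have i0: "t1 / 2 * n \<le> i0" "i0 \<le> t1 / 2 * n + 1"
          unfolding i0_def using step.prems by (auto simp: of_nat_nat intro: real_nat_ceiling_ge)
        define b where "b k = - (l * (real k - real i0) / n)" for k
        have b_step: "b (Suc k) - b k = - (l / n)" for k
          by (simp add: b_def diff_divide_distrib add_divide_distrib right_diff_distrib distrib_left)
        show ?case
        proof (intro allI impI)
          fix i assume i: "t1 * real n \<le> real i \<and> real i \<le> t2 * real n"
          have i0i: "i0 \<le> i" using i i0 t1n by linarith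
          have bk: "- b k \<le> m" if "k < i" for k
          proof -
            have "(real k - real i0) / n \<le> t2" using that i n by (simp add: field_simps)
            then have "l * ((real k - real i0) / n) \<le> l * t2" using l by (intro mult_left_mono) auto
            then show ?thesis by (simp add: b_def m_def)
          qed
          have "expect (gdist R n i) (\<lambda>E. of_bool True * (max 0 (- frac_of_size n E (Suc a) - b i))\<^sup>2) \<le>
            expect (gdist R n i0) (\<lambda>E. of_bool True * (max 0 (- frac_of_size n E (Suc a) - b i0))\<^sup>2) +
            (real i - real i0) * ((C / n)\<^sup>2 + 2 * m * (C / n) * r)"
          proof (rule drift_concentration[where G = "\<lambda>E. \<not> Bad n E"])
            fix k E E' assume "E' \<in> set_pmf (graph_step R n E)"
            then have "\<bar>frac_of_size n E' (Suc a) - frac_of_size n E (Suc a)\<bar> \<le> 2 * A / n"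
              using frac_of_size_jump[OF n, of E' R E "Suc a"] by (simp add: A_def)
            moreover have "C / n = 2 * A / n + l / n" by (simp add: C_def add_divide_distrib)
            moreover have "0 \<le> l / n" using l by simp
            ultimately show "\<bar>- frac_of_size n E' (Suc a) - - frac_of_size n E (Suc a) - (b (Suc k) - b k)\<bar> \<le> C / n"
              unfolding b_step by linarith
          next
            fix k E assume "k < i"
            from bk[OF this] show "- frac_of_size n E (Suc a) - b k \<le> m"
              using frac_of_size_nonneg[of n E "Suc a"] by linarith
          next
            fix k E assume "i0 \<le> k" "k < i" and good: "\<not> Bad n E" and Y: "b k \<le> - frac_of_size n E (Suc a)"
            let ?P = "\<lambda>e. comp_size n E (fst e) + comp_size n E (snd e) = Suc a \<and> snd e \<notin> component n E (fst e)"
            have "c1 * c' \<le> frac_of_size n E 1 * frac_of_size n E a"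
              using good c1 c' by (intro mult_mono) (auto simp: Bad_def)
            then have "f0 \<le> frac_of_size n E 1 * frac_of_size n E a - 1 / n"
              using elim(2) by (simp add: f0_def)
            also have "\<dots> \<le> unif n (\<lambda>e. of_bool (comp_size n E (fst e) = 1 \<and> comp_size n E (snd e) = a))"
              by (rule unif_sizes_ge[OF n])
            also have "\<dots> \<le> pr (sel_pmf R n E) ?P"
              unfolding expect_sel_take_it[OF n T]
            proof (rule unif_mono[OF n])
              fix e assume e: "e \<in> potential_edges n"
              show "of_bool (comp_size n E (fst e) = 1 \<and> comp_size n E (snd e) = a) \<le>
                (if T (comp_size n E (fst e)) (comp_size n E (snd e)) then of_bool (?P e)
                 else unif n (\<lambda>e. of_bool (?P e)))"
              proof (cases "comp_size n E (fst e) = 1 \<and> comp_size n E (snd e) = a")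
                case True
                have "fst e \<in> component n E (fst e)" "card (component n E (fst e)) = 1"
                  using e True self_in_component[of "fst e" n E]
                  by (auto simp: potential_edges_def comp_size_def)
                then have "component n E (fst e) = {fst e}" by (auto simp: card_1_singleton_iff)
                then show ?thesis using True e step by (auto simp: potential_edges_def)
              qed (auto intro!: unif_nonneg)
            qed
            finally have "f0 \<le> pr (sel_pmf R n E) ?P" .
            then have "1 * f0 \<le> A * pr (sel_pmf R n E) ?P"
              using A f0 by (intro mult_mono) auto
            moreover have "8 * A * frac_of_size n E (Suc a) \<le> 8 * A * (l * t2)"
              using Y bk[OF \<open>k < i\<close>] A unfolding m_def by (intro mult_left_mono) auto
            ultimately have "l \<le> A * pr (sel_pmf R n E) ?P - 8 * A * frac_of_size n E (Suc a)"
              using l_eq by linarith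
            then have "l / n \<le> (A * pr (sel_pmf R n E) ?P - 8 * A * frac_of_size n E (Suc a)) / n"
              by (rule divide_right_mono) simp
            then have "frac_of_size n E (Suc a) + l / n \<le> expect (graph_step R n E) (\<lambda>E'. frac_of_size n E' (Suc a))"
              using frac_of_size_drift[OF n, of "Suc a" E R] unfolding A_def diff_divide_distrib by simp
            then show "expect (graph_step R n E) (\<lambda>E'. - frac_of_size n E' (Suc a)) \<le>
              - frac_of_size n E (Suc a) + (b (Suc k) - b k)" unfolding b_step by simp
          next
            fix k assume "i0 \<le> k" "k < i"
            then show "pr (gdist R n k) (\<lambda>E. \<not> \<not> Bad n E) \<le> r"
              using elim(4) i i0 by simp
          qed (use n i0i pos r in auto)
          also have "expect (gdist R n i0) (\<lambda>E. of_bool True * (max 0 (- frac_of_size n E (Suc a) - b i0))\<^sup>2) = 0"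
          proof -
            have "max 0 (- frac_of_size n E (Suc a) - b i0) = 0" for E
              using frac_of_size_nonneg[of n E "Suc a"] by (simp add: b_def)
            then show ?thesis by simp
          qed
          also have "0 + (real i - real i0) * ((C / n)\<^sup>2 + 2 * m * (C / n) * r) \<le>
              t2 * n * ((C / n)\<^sup>2 + 2 * m * (C / n) * r)"
            using i pos r by (simp add: mult_right_mono)
          also have "\<dots> = t2 * C\<^sup>2 / n + 2 * t2 * m * C * r"
            using n by (simp add: power2_eq_square field_simps)
          finally have V: "expect (gdist R n i) (\<lambda>E. of_bool True * (max 0 (- frac_of_size n E (Suc a) - b i))\<^sup>2) \<le>
              t2 * C\<^sup>2 / n + 2 * t2 * m * C * r" .
          have "pr (gdist R n i) (\<lambda>E. frac_of_size n E (Suc a) < s) \<le> (t2 * C\<^sup>2 / n + 2 * t2 * m * C * r) / s\<^sup>2"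
          proof (rule drift_tail[OF n _ V])
            fix E assume E: "frac_of_size n E (Suc a) < s"
            have "t1 / 4 \<le> (real i - real i0) / n" using i i0 t1n n by (simp add: field_simps)
            then have "l * (t1 / 4) \<le> l * ((real i - real i0) / n)" using l by (intro mult_left_mono) auto
            then have "b i \<le> - 2 * s" by (simp add: b_def s_def)
            then show "True \<and> b i + s \<le> - frac_of_size n E (Suc a)" using E by simp
          qed (rule pos)
          also have "\<dots> = t2 * C\<^sup>2 / s\<^sup>2 / n + \<epsilon> / 2"
            using pos t by (simp add: r_def add_divide_distrib mult.commute)
          finally show "pr (gdist R n i) (\<lambda>E. frac_of_size n E (Suc a) < s) \<le> \<epsilon>" using elim(1) by linarith
        qed
      qed
    qed
  qed
qed

lemma rare_never:
  assumes "\<forall>\<^sub>F n in sequentially. \<forall>E. \<not> P n E"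
  shows "rare R t1 t2 P"
  unfolding rare_def using assms by (auto elim!: eventually_mono)

text \<open>If the rule accepts every pair of sizes, the process is the uniform random graph process. Otherwise let \<open>(a, b)\<close>
be a rejected pair of sizes with minimal sum. All pairs with a smaller sum are accepted, so sizes \<open>a\<close> and \<open>b\<close>
both appear with positive density, the first edge is rejected with probability bounded below, and then a
uniformly random edge is added.\<close>

lemma elliptic_rarely_fails:
  assumes "take_it_or_leave_it R" "0 < t1" "t1 \<le> t2"
  shows "\<exists>\<eta>>0. rare R t1 t2 (\<lambda>n E. \<not> elliptic R n \<eta> E)"
proof -
  obtain T where T: "\<And>a b c d. R a b c d = T a b"
    using assms(1) unfolding take_it_or_leave_it_def by blast
  show ?thesis
  proof (cases "\<forall>a\<ge>1. \<forall>b\<ge>1. T a b")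
    case True
    have "elliptic R n 1 E" if n: "2 \<le> n" for n E
      unfolding elliptic_def
    proof (intro allI impI)
      fix h :: "nat \<times> nat \<Rightarrow> real"
      have "unif n h \<le> expect (sel_pmf R n E) h"
        unfolding expect_sel_take_it[OF n T]
      proof (rule unif_mono[OF n])
        fix e assume "e \<in> potential_edges n"
        then have "T (comp_size n E (fst e)) (comp_size n E (snd e))"
          using True comp_size_pos[of _ n E] by (simp add: potential_edges_def case_prod_unfold)
        then show "h e \<le> (if T (comp_size n E (fst e)) (comp_size n E (snd e)) then h e else unif n h)"
          by simp
      qed
      then show "1 * unif n h \<le> expect (sel_pmf R n E) h" by simp
    qed
    then have "\<forall>\<^sub>F n in sequentially. \<forall>E. \<not> \<not> elliptic R n 1 E"
      by (intro eventually_sequentiallyI[of 2]) simp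
    then have "rare R t1 t2 (\<lambda>n E. \<not> elliptic R n 1 E)" by (rule rare_never)
    then show ?thesis by (intro exI[of _ 1]) simp
  next
    case False
    define P where "P = (\<lambda>(a, b). 1 \<le> a \<and> 1 \<le> b \<and> \<not> T a b)"
    obtain a0 b0 where "1 \<le> a0" "1 \<le> b0" "\<not> T a0 b0" using False by blast
    then have "P (a0, b0)" by (simp add: P_def)
    from ex_has_least_nat[where P = P and m = "\<lambda>p. fst p + snd p", OF this]
    obtain p where "P p" and least: "\<And>q. P q \<Longrightarrow> fst p + snd p \<le> fst q + snd q"
      by auto
    obtain a b where p: "p = (a, b)" by (cases p)
    have ab: "1 \<le> a" "1 \<le> b" "\<not> T a b" using \<open>P p\<close> by (auto simp: P_def p)
    have min: "T c d" if "1 \<le> c" "1 \<le> d" "c + d < a + b" for c d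
      using least[of "(c, d)"] that by (auto simp: P_def p)
    have Ta: "T 1 j" if "1 \<le> j" "j < a" for j
      by (rule min) (use that ab in auto)
    have Tb: "T 1 j" if "1 \<le> j" "j < b" for j
      by (rule min) (use that ab in auto)
    have "\<exists>c>0. rare R t1 t2 (\<lambda>n E. frac_of_size n E a < c)"
      by (rule size_persist[where T = T, OF T ab(1)]) (use Ta assms in auto)
    then obtain ca where ca: "ca > 0" "rare R t1 t2 (\<lambda>n E. frac_of_size n E a < ca)"
      by (elim exE conjE)
    have "\<exists>c>0. rare R t1 t2 (\<lambda>n E. frac_of_size n E b < c)"
      by (rule size_persist[where T = T, OF T ab(2)]) (use Tb assms in auto)
    then obtain cb where cb: "cb > 0" "rare R t1 t2 (\<lambda>n E. frac_of_size n E b < cb)"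
      by (elim exE conjE)
    define \<eta> where "\<eta> = ca * cb / 2"
    have \<eta>: "0 < \<eta>" using ca cb by (simp add: \<eta>_def)
    have ell: "elliptic R n \<eta> E" if n: "2 \<le> n" "1 / real n < \<eta>"
      and E: "ca \<le> frac_of_size n E a" "cb \<le> frac_of_size n E b" for n E
      unfolding elliptic_def
    proof (intro allI impI)
      fix h :: "nat \<times> nat \<Rightarrow> real" assume h: "\<forall>e. 0 \<le> h e"
      have u: "0 \<le> unif n h" using h by (intro unif_nonneg) auto
      have "ca * cb \<le> frac_of_size n E a * frac_of_size n E b"
        using E ca cb by (intro mult_mono) auto
      then have "\<eta> \<le> frac_of_size n E a * frac_of_size n E b - 1 / n"
        using n(2) by (simp add: \<eta>_def)
      also have "\<dots> \<le> unif n (\<lambda>e. of_bool (comp_size n E (fst e) = a \<and> comp_size n E (snd e) = b))"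
        by (rule unif_sizes_ge[OF n(1)])
      finally have "unif n h * \<eta> \<le> unif n h *
          unif n (\<lambda>e. of_bool (comp_size n E (fst e) = a \<and> comp_size n E (snd e) = b))"
        using u by (rule mult_left_mono)
      also have "\<dots> = unif n (\<lambda>e. unif n h * of_bool (comp_size n E (fst e) = a \<and> comp_size n E (snd e) = b))"
        by (simp only: unif_cmult)
      also have "\<dots> \<le> expect (sel_pmf R n E) h"
        unfolding expect_sel_take_it[OF n(1) T]
      proof (rule unif_mono[OF n(1)])
        fix e
        show "unif n h * of_bool (comp_size n E (fst e) = a \<and> comp_size n E (snd e) = b) \<le>
            (if T (comp_size n E (fst e)) (comp_size n E (snd e)) then h e else unif n h)"
          using ab(3) spec[OF h, of e] u by (cases "comp_size n E (fst e) = a \<and> comp_size n E (snd e) = b") auto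
      qed
      finally show "\<eta> * unif n h \<le> expect (sel_pmf R n E) h" by (simp add: mult.commute)
    qed
    have "(\<lambda>n. 1 / real n) \<longlonglongrightarrow> 0" by (rule lim_const_over_n)
    then have "\<forall>\<^sub>F n in sequentially. 1 / real n < \<eta>" using \<eta> by (rule order_tendstoD)
    then have "\<forall>\<^sub>F n in sequentially. \<forall>E. \<not> elliptic R n \<eta> E \<longrightarrow>
        frac_of_size n E a < ca \<or> frac_of_size n E b < cb"
      using eventually_ge_at_top[of 2] 
    proof eventually_elim
      case (elim n)
      show ?case
      proof (intro allI impI)
        fix E assume "\<not> elliptic R n \<eta> E"
        then show "frac_of_size n E a < ca \<or> frac_of_size n E b < cb"
          using ell[OF elim(2,1), of E] by linarith
      qed
    qed
    then have "rare R t1 t2 (\<lambda>n E. \<not> elliptic R n \<eta> E)"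
      by (rule rare_mono[OF rare_or[OF ca(2) cb(2)] order.refl order.refl])
    then show ?thesis using \<eta> by blast
  qed
qed

section \<open>From large truncated susceptibility to a giant component\<close>

lemma reciprocal_growth_limit:
  fixes s :: "nat \<Rightarrow> graph \<Rightarrow> real" and i0 i1 :: "nat \<Rightarrow> nat"
  assumes pos: "0 < \<sigma>" "0 < \<kappa>" "0 < K" "0 < D" "0 < T" and K: "2 / K \<le> \<kappa> * (T / 2)"
    and J: "\<And>n E E'. 2 \<le> n \<Longrightarrow> E' \<in> set_pmf (graph_step R n E) \<Longrightarrow> J n E' \<Longrightarrow> J n E"
    and low: "\<And>n E. 2 \<le> n \<Longrightarrow> \<sigma> \<le> s n E"
    and incr: "\<And>n E E'. 2 \<le> n \<Longrightarrow> E' \<in> set_pmf (graph_step R n E) \<Longrightarrow>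
      s n E \<le> s n E' \<and> s n E' \<le> s n E + D / n"
    and drift: "\<forall>\<^sub>F n in sequentially. \<forall>E. J n E \<longrightarrow> G n E \<longrightarrow>
      s n E + 2 * \<kappa> * (s n E)\<^sup>2 / n \<le> expect (graph_step R n E) (s n)"
    and start: "(\<lambda>n. pr (gdist R n (i0 n)) (\<lambda>E. s n E < K)) \<longlonglongrightarrow> 0"
    and bad: "\<And>r. 0 < r \<Longrightarrow> \<forall>\<^sub>F n in sequentially. \<forall>i. i0 n \<le> i \<and> i < i1 n \<longrightarrow>
      pr (gdist R n i) (\<lambda>E. \<not> G n E) \<le> r"
    and T: "\<forall>\<^sub>F n in sequentially. i0 n \<le> i1 n \<and> T / 2 \<le> (real (i1 n) - real (i0 n)) / n \<and>
      (real (i1 n) - real (i0 n)) / n \<le> 2 * T"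
  shows "(\<lambda>n. pr (gdist R n (i1 n)) (J n)) \<longlonglongrightarrow> 0"
proof (rule pr_tendsto_0I)
  fix \<epsilon> :: real assume \<epsilon>: "0 < \<epsilon>"
  define B where "B = D / \<sigma>\<^sup>2 + \<kappa>"
  define M where "M = 1 / \<sigma> + 2 * \<kappa> * T"
  define W where "W = 16 / (\<kappa> * T)\<^sup>2"
  have c: "0 < B" "0 < M" "0 < W" using pos by (auto simp: B_def M_def W_def add_pos_pos)
  define r where "r = \<epsilon> / (8 * T * M * B * W)"
  have r: "0 < r" using \<epsilon> c pos by (simp add: r_def)
  have "(\<lambda>n. (pr (gdist R n (i0 n)) (\<lambda>E. s n E < K) / \<sigma>\<^sup>2 + 2 * T * (B\<^sup>2 / real n)) * W) \<longlonglongrightarrow>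
      (0 / \<sigma>\<^sup>2 + 2 * T * 0) * W"
    using pos by (intro tendsto_intros start lim_const_over_n) auto
  then have "\<forall>\<^sub>F n in sequentially.
      (pr (gdist R n (i0 n)) (\<lambda>E. s n E < K) / \<sigma>\<^sup>2 + 2 * T * (B\<^sup>2 / real n)) * W < \<epsilon> / 2"
    by (rule order_tendstoD) (use \<epsilon> in simp)
  moreover have "(\<lambda>n. D / real n) \<longlonglongrightarrow> 0" by (rule lim_const_over_n)
  then have "\<forall>\<^sub>F n in sequentially. D / real n < \<sigma>" by (rule order_tendstoD) (rule pos)
  ultimately show "\<forall>\<^sub>F n in sequentially. pr (gdist R n (i1 n)) (J n) < \<epsilon>"
    using drift bad[OF r] T eventually_ge_at_top[of 2]
  proof eventually_elim
    case (elim n)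
    have n: "2 \<le> n" by fact
    have "pr (gdist R n (i1 n)) (J n) \<le> (pr (gdist R n (i0 n)) (\<lambda>E. s n E < K) / \<sigma>\<^sup>2 +
        2 * T * ((D / \<sigma>\<^sup>2 + \<kappa>)\<^sup>2 / n + 2 * (1 / \<sigma> + 2 * \<kappa> * T) * (D / \<sigma>\<^sup>2 + \<kappa>) * r)) * 16 / (\<kappa> * T)\<^sup>2"
    proof (rule reciprocal_growth[where G = "G n" and s = "s n", OF n])
      show "\<And>E E'. E' \<in> set_pmf (graph_step R n E) \<Longrightarrow> J n E' \<Longrightarrow> J n E" using J[OF n] by blast
      show "\<And>E. J n E \<Longrightarrow> G n E \<Longrightarrow> s n E + 2 * \<kappa> * (s n E)\<^sup>2 / n \<le> expect (graph_step R n E) (s n)"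
        using elim(3) by simp
      show "\<And>i. i0 n \<le> i \<Longrightarrow> i < i1 n \<Longrightarrow> pr (gdist R n i) (\<lambda>E. \<not> G n E) \<le> r"
        using elim(4) by blast
    qed (use elim pos K r low[OF n] incr[OF n] in auto)
    also have "\<dots> = (pr (gdist R n (i0 n)) (\<lambda>E. s n E < K) / \<sigma>\<^sup>2 +
        2 * T * (B\<^sup>2 / n + 2 * M * B * r)) * 16 / (\<kappa> * T)\<^sup>2"
      unfolding B_def M_def ..
    also have "\<dots> = (pr (gdist R n (i0 n)) (\<lambda>E. s n E < K) / \<sigma>\<^sup>2 +
        2 * T * (B\<^sup>2 / n)) * W + (4 * T * M * B * W) * r"
      unfolding W_def by (simp add: add_divide_distrib algebra_simps)
    also have "(4 * T * M * B * W) * r = \<epsilon> / 2" using c pos by (simp add: r_def)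
    finally show ?case using elim(1) by linarith
  qed
qed

text \<open>Two independent vertices lie in the same component only with probability \<open>|C(u)|/n\<close>, given the first one.\<close>

lemma unif_different_components_ge:
  assumes "2 \<le> n" "\<And>k. 0 \<le> f k"
  shows "(size_avg n E f)\<^sup>2 - size_avg n E (\<lambda>k. (f k)\<^sup>2 * k) / n \<le>
    unif n (\<lambda>e. of_bool (snd e \<notin> component n E (fst e)) *
      (f (comp_size n E (fst e)) * f (comp_size n E (snd e))))"
proof -
  let ?c = "comp_size n E"
  let ?h = "\<lambda>e. of_bool (snd e \<notin> component n E (fst e)) * (f (?c (fst e)) * f (?c (snd e)))"
  have "(\<Sum>u=1..n. \<Sum>v=1..n. ?h (u, v)) =
      (\<Sum>u=1..n. \<Sum>v=1..n. f (?c u) * f (?c v) - (f (?c u))\<^sup>2 * of_bool (v \<in> component n E u))"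
    by (intro sum.cong refl) (auto simp: power2_eq_square of_bool_def dest: comp_size_component[rotated])
  also have "\<dots> = n\<^sup>2 * (size_avg n E f * size_avg n E f) - n * size_avg n E (\<lambda>k. (f k)\<^sup>2 * k)"
    using sum_same_component[of "\<lambda>k. (f k)\<^sup>2" n E] sum_pairs_size_avg[of f n E f]
    by (simp only: sum_subtractf of_nat_power)
  finally have "(\<Sum>u=1..n. \<Sum>v=1..n. ?h (u, v)) / n\<^sup>2 =
      (size_avg n E f)\<^sup>2 - size_avg n E (\<lambda>k. (f k)\<^sup>2 * k) / n"
    using assms(1) by (simp add: diff_divide_distrib power2_eq_square)
  moreover have "(\<Sum>u=1..n. \<Sum>v=1..n. ?h (u, v)) / n\<^sup>2 \<le> unif n ?h"
  proof -
    have "(\<Sum>u=1..n. \<Sum>v=1..n. ?h (u, v)) = (\<Sum>e\<in>potential_edges n. ?h e)"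
      using self_in_component by (subst sum_all_pairs) auto
    moreover have "(\<Sum>e\<in>potential_edges n. ?h e) / n\<^sup>2 \<le> (\<Sum>e\<in>potential_edges n. ?h e) / (real n * (real n - 1))"
      using assms by (intro divide_left_mono sum_nonneg) (auto simp: power2_eq_square)
    ultimately show ?thesis by (simp add: unif_eq[OF assms(1)])
  qed
  ultimately show ?thesis by simp
qed

abbreviation trunc_susc :: "nat \<Rightarrow> nat \<Rightarrow> graph \<Rightarrow> real" where
  "trunc_susc k n E \<equiv> size_avg n E (\<lambda>c. real (min c k))"

abbreviation frac_ge :: "nat \<Rightarrow> nat \<Rightarrow> graph \<Rightarrow> real" where
  "frac_ge h n E \<equiv> size_avg n E (\<lambda>c. of_bool (h \<le> c))"

lemma mono_trunc: "mono (\<lambda>c. real (min c k))"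
  by (auto simp: mono_def)

lemma mono_ge: "mono (\<lambda>c::nat. of_bool (h \<le> c) :: real)"
  by (auto simp: mono_def)

lemma trunc_gain_le: "1 \<le> h \<Longrightarrow> gain n E (\<lambda>c. real (min c (2 * h))) e \<le> 8 * (real h)\<^sup>2"
proof -
  assume h: "1 \<le> h"
  let ?f = "\<lambda>c. real (min c (2 * h))"
  have *: "real a * (?f (a + b) - ?f a) \<le> 4 * (real h)\<^sup>2" for a b
  proof (cases "a \<le> 2 * h")
    case True
    have "real a * (?f (a + b) - ?f a) \<le> real (2 * h) * real (2 * h)"
      using True by (intro mult_mono) auto
    then show ?thesis by (simp add: power2_eq_square)
  qed simp
  have "merge_gain ?f a b \<le> 8 * (real h)\<^sup>2" for a b
  proof -
    have "merge_gain ?f a b = real a * (?f (a + b) - ?f a) + real b * (?f (b + a) - ?f b)"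
      by (simp add: merge_gain_def algebra_simps)
    then show ?thesis using *[of a b] *[of b a] by linarith
  qed
  then show ?thesis by (auto simp: gain_def split: prod.split)
qed

lemma size_avg_step_increment:
  assumes "2 \<le> n" "E' \<in> set_pmf (graph_step R n E)" "mono f" "\<And>e. gain n E f e \<le> D"
  shows "size_avg n E f \<le> size_avg n E' f \<and> size_avg n E' f \<le> size_avg n E f + D / n"
proof -
  obtain u v where uv: "u \<in> {1..n}" "v \<in> {1..n}" "u \<noteq> v" "E' = add_edge E (u, v)"
    using step_cases[OF assms(1,2)] by blast
  have "gain n E f (u, v) / n \<le> D / n" using assms(4) by (intro divide_right_mono) auto
  then show ?thesis
    using uv size_avg_step_mono[OF assms(1,3,2)] by (simp add: size_avg_add_edge potential_edges_def)
qed

lemma expect_gain_elliptic: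
  assumes "2 \<le> n" "elliptic R n \<eta> E" "0 \<le> \<eta>" "mono f" "\<And>e. h e \<le> gain n E f e" "c \<le> unif n h"
  shows "\<eta> * c \<le> expect (sel_pmf R n E) (gain n E f)"
proof -
  have "c \<le> unif n (gain n E f)" using assms unif_mono[OF assms(1), of h "gain n E f"] by force
  then have "\<eta> * c \<le> \<eta> * unif n (gain n E f)" using assms by (intro mult_left_mono)
  moreover have "\<eta> * unif n (gain n E f) \<le> expect (sel_pmf R n E) (gain n E f)"
    using assms(2) gain_nonneg[OF assms(4)] unfolding elliptic_def by simp
  ultimately show ?thesis by linarith
qed

text \<open>As long as fewer than \<open>C0 n/h\<close> vertices lie in components of size at least \<open>h\<close>, at least half of the truncated
susceptibility \<open>A\<close> at level \<open>2h\<close> comes from components of size at most \<open>h\<close>. Two of these merge without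
being truncated, so the sprinkled edges alone give \<open>A\<close> a drift of order \<open>\<eta>A\<^sup>2\<close>. From a large value this blows
up within the time available, which is impossible for the bounded statistic \<open>A\<close>.\<close>

lemma many_vertices_in_large_components:
  assumes "0 < \<eta>" "0 < T" "0 < C0" "1 \<le> h" and K: "4 * C0 \<le> K" "32 / (\<eta> * T) \<le> K" "1 \<le> K"
    and start: "(\<lambda>n. pr (gdist R n (i0 n)) (\<lambda>E. trunc_susc (2 * h) n E < K)) \<longlonglongrightarrow> 0"
    and ell: "\<And>r. 0 < r \<Longrightarrow> \<forall>\<^sub>F n in sequentially. \<forall>i. i0 n \<le> i \<and> i < i1 n \<longrightarrow>
      pr (gdist R n i) (\<lambda>E. \<not> elliptic R n \<eta> E) \<le> r"
    and T: "\<forall>\<^sub>F n in sequentially. i0 n \<le> i1 n \<and> T / 2 \<le> (real (i1 n) - real (i0 n)) / n \<and>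
      (real (i1 n) - real (i0 n)) / n \<le> 2 * T"
  shows "(\<lambda>n. pr (gdist R n (i1 n)) (\<lambda>E. real h * frac_ge h n E < C0)) \<longlonglongrightarrow> 0"
proof (rule reciprocal_growth_limit[where \<sigma> = 1 and \<kappa> = "\<eta> / 8" and K = K and D = "8 * (real h)\<^sup>2"
      and T = T and s = "trunc_susc (2 * h)" and ?i0.0 = i0
      and G = "\<lambda>n E. elliptic R n \<eta> E \<and> K \<le> trunc_susc (2 * h) n E"])
  show "2 / K \<le> \<eta> / 8 * (T / 2)" using assms(1,2) K by (simp add: field_simps)
  fix n :: nat and E E'
  assume n: "2 \<le> n"
  show "1 \<le> trunc_susc (2 * h) n E"
    using size_avg_mono[of n "\<lambda>_. 1" "\<lambda>c. real (min c (2 * h))" E] \<open>1 \<le> h\<close> n by (simp add: size_avg_const)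
  assume E': "E' \<in> set_pmf (graph_step R n E)"
  show "real h * frac_ge h n E < C0" if "real h * frac_ge h n E' < C0"
    using that mult_left_mono[OF size_avg_step_mono[OF n mono_ge E'], of "real h" h] by linarith
  show "trunc_susc (2 * h) n E \<le> trunc_susc (2 * h) n E' \<and>
      trunc_susc (2 * h) n E' \<le> trunc_susc (2 * h) n E + 8 * (real h)\<^sup>2 / n"
    using n E' mono_trunc trunc_gain_le[OF \<open>1 \<le> h\<close>] by (rule size_avg_step_increment)
next
  have "(\<lambda>n. 2 * (real h) ^ 3 / real n) \<longlonglongrightarrow> 0" by (rule lim_const_over_n)
  then have "\<forall>\<^sub>F n in sequentially. 2 * (real h) ^ 3 / real n < 1 / 4" by (rule order_tendstoD) simp
  then show "\<forall>\<^sub>F n in sequentially. \<forall>E. real h * frac_ge h n E < C0 \<longrightarrow>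
      elliptic R n \<eta> E \<and> K \<le> trunc_susc (2 * h) n E \<longrightarrow>
      trunc_susc (2 * h) n E + 2 * (\<eta> / 8) * (trunc_susc (2 * h) n E)\<^sup>2 / n
        \<le> expect (graph_step R n E) (trunc_susc (2 * h) n)"
    using eventually_ge_at_top[of 2]
  proof (eventually_elim, intro allI impI)
    fix n :: nat and E
    assume hn: "2 * (real h) ^ 3 / real n < 1 / 4" and n: "2 \<le> n" and J: "real h * frac_ge h n E < C0"
      and G: "elliptic R n \<eta> E \<and> K \<le> trunc_susc (2 * h) n E"
    let ?A = "trunc_susc (2 * h) n E" and ?c = "comp_size n E"
    define f where "f = (\<lambda>k. real k * of_bool (k \<le> h))"
    (* min k (2 h) is at most k for k below h, and at most 2 h otherwise *)
    have "?A \<le> size_avg n E (\<lambda>k. f k + 2 * real h * of_bool (h \<le> k))"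
      by (rule size_avg_mono) (auto simp: f_def)
    also have "\<dots> = size_avg n E f + 2 * (real h * frac_ge h n E)"
      by (simp only: size_avg_add size_avg_cmult mult.assoc)
    finally have "?A / 2 \<le> size_avg n E f" using J K G by linarith
    then have "(?A / 2)\<^sup>2 \<le> (size_avg n E f)\<^sup>2" using G K by (intro power_mono) auto
    moreover have "size_avg n E (\<lambda>k. (f k)\<^sup>2 * k) \<le> size_avg n E (\<lambda>k. (real h) ^ 3)"
      by (rule size_avg_mono)
        (auto simp: f_def power2_eq_square power3_eq_cube intro!: mult_mono)
    then have "size_avg n E (\<lambda>k. (f k)\<^sup>2 * k) / n \<le> (real h) ^ 3 / n"
      using n by (intro divide_right_mono) (auto simp: size_avg_const)
    moreover have "1 \<le> ?A\<^sup>2" using G K by simp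
    ultimately have "?A\<^sup>2 / 8 \<le> (size_avg n E f)\<^sup>2 - size_avg n E (\<lambda>k. (f k)\<^sup>2 * k) / n"
      using hn by (simp add: power_divide)
    also have "\<dots> \<le> unif n (\<lambda>e. of_bool (snd e \<notin> component n E (fst e)) * (f (?c (fst e)) * f (?c (snd e))))"
      by (rule unif_different_components_ge[OF n]) (simp add: f_def)
    finally have "2 * (?A\<^sup>2 / 8) \<le> unif n (\<lambda>e. 2 * (of_bool (snd e \<notin> component n E (fst e)) * (f (?c (fst e)) * f (?c (snd e)))))"
      unfolding unif_cmult by simp
    then have "\<eta> * (2 * (?A\<^sup>2 / 8)) \<le> expect (sel_pmf R n E) (gain n E (\<lambda>c. real (min c (2 * h))))"
    proof (rule expect_gain_elliptic[OF n _ _ mono_trunc, rotated -1])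
      fix e
      have "0 \<le> gain n E (\<lambda>c. real (min c (2 * h))) e" by (rule gain_nonneg[OF mono_trunc])
      then show "2 * (of_bool (snd e \<notin> component n E (fst e)) * (f (?c (fst e)) * f (?c (snd e))))
          \<le> gain n E (\<lambda>c. real (min c (2 * h))) e"
        by (cases e) (auto simp: gain_def merge_gain_def f_def of_bool_def algebra_simps)
    qed (use G \<open>0 < \<eta>\<close> in auto)
    then have "(\<eta> * (2 * (?A\<^sup>2 / 8))) / n \<le>
        expect (sel_pmf R n E) (gain n E (\<lambda>c. real (min c (2 * h)))) / n"
      by (rule divide_right_mono) simp
    then show "?A + 2 * (\<eta> / 8) * ?A\<^sup>2 / n \<le> expect (graph_step R n E) (trunc_susc (2 * h) n)"
      by (simp add: expect_step_size_avg[OF n])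
  qed
next
  fix r :: real assume "0 < r"
  then have r: "0 < r / 2" by simp
  have "\<forall>\<^sub>F n in sequentially. pr (gdist R n (i0 n)) (\<lambda>E. trunc_susc (2 * h) n E < K) < r / 2"
    using start r by (rule order_tendstoD)
  then show "\<forall>\<^sub>F n in sequentially. \<forall>i. i0 n \<le> i \<and> i < i1 n \<longrightarrow>
      pr (gdist R n i) (\<lambda>E. \<not> (elliptic R n \<eta> E \<and> K \<le> trunc_susc (2 * h) n E)) \<le> r"
    using ell[OF r] eventually_ge_at_top[of 2]
  proof (eventually_elim, intro allI impI)
    fix n i
    assume s: "pr (gdist R n (i0 n)) (\<lambda>E. trunc_susc (2 * h) n E < K) < r / 2"
      and e: "\<forall>i. i0 n \<le> i \<and> i < i1 n \<longrightarrow> pr (gdist R n i) (\<lambda>E. \<not> elliptic R n \<eta> E) \<le> r / 2"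
      and n: "2 \<le> n" and i: "i0 n \<le> i \<and> i < i1 n"
    have "pr (gdist R n (i0 n)) (\<lambda>E. \<not> trunc_susc (2 * h) n E < K) \<le>
        pr (gdist R n i) (\<lambda>E. \<not> trunc_susc (2 * h) n E < K)"
    proof (rule dist_from_persist)
      fix E E' assume P: "\<not> trunc_susc (2 * h) n E < K" and E': "E' \<in> set_pmf (graph_step R n E)"
      show "\<not> trunc_susc (2 * h) n E' < K"
        using P size_avg_step_mono[OF n mono_trunc E', of "2 * h"] by linarith
    qed (use n i in auto)
    then have "pr (gdist R n i) (\<lambda>E. trunc_susc (2 * h) n E < K) \<le> r / 2"
      using s n by (simp add: pr_not)
    moreover have "pr (gdist R n i) (\<lambda>E. \<not> (elliptic R n \<eta> E \<and> K \<le> trunc_susc (2 * h) n E)) \<le>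
        pr (gdist R n i) (\<lambda>E. \<not> elliptic R n \<eta> E) + pr (gdist R n i) (\<lambda>E. trunc_susc (2 * h) n E < K)"
      using n by (intro pr_Un) auto
    ultimately show "pr (gdist R n i) (\<lambda>E. \<not> (elliptic R n \<eta> E \<and> K \<le> trunc_susc (2 * h) n E)) \<le> r"
      using e i by force
  qed
qed (use assms in auto)

text \<open>\<open>c * merge_weight h c = c/h - min 1 (c/h)\<close>: the sum over all vertices of this weight grows by exactly 1 when two
components of size at least \<open>h\<close> merge and never decreases. It is a count of such merges that needs no memory.\<close>

definition merge_weight :: "nat \<Rightarrow> nat \<Rightarrow> real" where
  "merge_weight h c = 1 / real h - 1 / real (max c h)"

lemma merge_weight_gain:
  fixes h :: nat
  assumes "1 \<le> h"
  defines "f \<equiv> merge_weight h"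
  shows "mono f" "gain n E f e \<le> 1"
    "0 \<le> f c" "real h * f c \<le> of_bool (h \<le> c)"
    "of_bool (snd e \<notin> component n E (fst e)) * (of_bool (h \<le> comp_size n E (fst e)) *
      of_bool (h \<le> comp_size n E (snd e))) \<le> gain n E f e"
proof -
  show m: "mono f"
    unfolding f_def mono_def merge_weight_def using assms(1) by (auto intro!: divide_left_mono)
  have cf: "real c * f c = c / h - min 1 (c / h)" for c
    using assms(1) by (cases "c \<le> h") (auto simp: f_def merge_weight_def max_def min_def field_simps)
  have mg: "merge_gain f a b = min 1 (a / h) + min 1 (b / h) - min 1 ((a + b) / h)" for a b
    unfolding merge_gain_def using cf[of a] cf[of b] cf[of "a + b"] by (simp add: add_divide_distrib)
  have "merge_gain f a b \<le> 1" for a b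
  proof -
    have "0 \<le> real a / h" "0 \<le> real b / h" by auto
    then show ?thesis unfolding mg by (simp add: add_divide_distrib min_def)
  qed
  then show "gain n E f e \<le> 1" by (simp add: gain_def split: prod.split)
  show "0 \<le> f c" using assms(1) by (auto simp: f_def merge_weight_def intro!: divide_left_mono)
  show "real h * f c \<le> of_bool (h \<le> c)"
    using assms(1) by (cases "h \<le> c") (auto simp: f_def merge_weight_def field_simps)
  have "merge_gain f a b = 1" if "h \<le> a" "h \<le> b" for a b
  proof -
    have "1 \<le> real a / h" "1 \<le> real b / h" using that assms(1) by auto
    then show ?thesis unfolding mg by (simp add: add_divide_distrib)
  qed
  then show "of_bool (snd e \<notin> component n E (fst e)) * (of_bool (h \<le> comp_size n E (fst e)) *
      of_bool (h \<le> comp_size n E (snd e))) \<le> gain n E f e"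
    using gain_nonneg[OF m, of n E e] by (cases e) (auto simp: gain_def of_bool_def)
qed

text \<open>If at least \<open>C0 n/h\<close> vertices lie in components of size at least \<open>h\<close> and no component has size \<open>\<alpha>n\<close>, then a
sprinkled edge joins two different large components with probability of order \<open>\<theta>\<^sup>2\<close>, where \<open>\<theta>\<close> is the fraction of
vertices in large components. Large components have at least \<open>h\<close> vertices each, so the merge
count is at most \<open>\<theta>n/h\<close>. Hence \<open>\<theta>\<close> is at least both \<open>C0/h\<close> and \<open>h\<close> times the normalised
merge count, and the sum \<open>s\<close> of the two lower bounds satisfies \<open>s' \<ge> const \<eta>h s\<^sup>2\<close>, which again blows up
too early unless a component of size \<open>\<alpha>n\<close> appears.\<close>

lemma giant_from_large_components:
  assumes pos: "0 < \<eta>" "0 < T" "1 \<le> h" and C0: "64 / (\<eta> * T) \<le> C0" "0 < C0"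
    and start: "(\<lambda>n. pr (gdist R n (i0 n)) (\<lambda>E. real h * frac_ge h n E < C0)) \<longlonglongrightarrow> 0"
    and ell: "\<And>r. 0 < r \<Longrightarrow> \<forall>\<^sub>F n in sequentially. \<forall>i. i0 n \<le> i \<and> i < i1 n \<longrightarrow>
      pr (gdist R n i) (\<lambda>E. \<not> elliptic R n \<eta> E) \<le> r"
    and T: "\<forall>\<^sub>F n in sequentially. i0 n \<le> i1 n \<and> T / 2 \<le> (real (i1 n) - real (i0 n)) / n \<and>
      (real (i1 n) - real (i0 n)) / n \<le> 2 * T"
  shows "(\<lambda>n. pr (gdist R n (i1 n)) (\<lambda>E. size_avg n E (\<lambda>c. of_bool (C0 / (2 * real h) * real n \<le> real c)) \<le> 0))
    \<longlonglongrightarrow> 0"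
proof -
  define f where "f = merge_weight h"
  note f = merge_weight_gain[OF pos(3), folded f_def]
  define s where "s n E = C0 / h + h * size_avg n E f" for n E
  have h: "0 < real h" using pos by simp
  show ?thesis
  proof (rule reciprocal_growth_limit[where \<sigma> = "C0 / real h" and \<kappa> = "\<eta> * real h / 16" and K = "C0 / real h"
        and D = "real h" and T = T and s = s and ?i0.0 = i0
        and G = "\<lambda>n E. elliptic R n \<eta> E \<and> \<not> real h * frac_ge h n E < C0"])
    show "2 / (C0 / h) \<le> \<eta> * h / 16 * (T / 2)"
    proof -
      have "64 \<le> C0 * (\<eta> * T)" using C0 pos by (simp add: field_simps)
      then have "64 * real h \<le> C0 * (\<eta> * T) * real h" using h by (intro mult_right_mono) auto
      then show ?thesis using C0 pos by (simp add: field_simps)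
    qed
    fix n :: nat and E E'
    assume n: "2 \<le> n"
    have "0 \<le> size_avg n E f" using f(3) by (rule size_avg_nonneg)
    then show "C0 / h \<le> s n E" using h by (simp add: s_def)
    assume E': "E' \<in> set_pmf (graph_step R n E)"
    have "mono (\<lambda>c::nat. of_bool (C0 / (2 * real h) * real n \<le> real c) :: real)"
      by (auto simp: mono_def)
    from size_avg_step_mono[OF n this E']
    show "size_avg n E (\<lambda>c. of_bool (C0 / (2 * real h) * real n \<le> real c)) \<le> 0"
      if "size_avg n E' (\<lambda>c. of_bool (C0 / (2 * real h) * real n \<le> real c)) \<le> 0" using that by linarith
    have "size_avg n E f \<le> size_avg n E' f \<and> size_avg n E' f \<le> size_avg n E f + 1 / n"
      using n E' f(1,2) by (rule size_avg_step_increment)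
    then have "h * size_avg n E f \<le> h * size_avg n E' f \<and> h * size_avg n E' f \<le> h * (size_avg n E f + 1 / n)"
      by (intro conjI mult_left_mono) auto
    then show "s n E \<le> s n E' \<and> s n E' \<le> s n E + real h / n"
      by (simp add: s_def distrib_left)
  next
    show "\<forall>\<^sub>F n in sequentially. \<forall>E. size_avg n E (\<lambda>c. of_bool (C0 / (2 * real h) * real n \<le> real c)) \<le> 0 \<longrightarrow>
        elliptic R n \<eta> E \<and> \<not> real h * frac_ge h n E < C0 \<longrightarrow>
        s n E + 2 * (\<eta> * real h / 16) * (s n E)\<^sup>2 / n \<le> expect (graph_step R n E) (s n)"
      using eventually_ge_at_top[of 2]
    proof (eventually_elim, intro allI impI)
      fix n :: nat and E
      assume n: "2 \<le> n" and J: "size_avg n E (\<lambda>c. of_bool (C0 / (2 * real h) * real n \<le> real c)) \<le> 0"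
        and G: "elliptic R n \<eta> E \<and> \<not> real h * frac_ge h n E < C0"
      let ?\<theta> = "frac_ge h n E" and ?c = "comp_size n E"
      let ?\<alpha> = "C0 / (2 * real h)"
      have \<theta>: "2 * ?\<alpha> \<le> ?\<theta>" using G h by (simp add: field_simps)
      (* the event J says that no component reaches size alpha n *)
      have small: "?c v < ?\<alpha> * n" if v: "v \<in> {1..n}" for v
      proof (rule ccontr)
        assume "\<not> ?thesis"
        then have "0 < (\<Sum>v=1..n. of_bool (?\<alpha> * n \<le> ?c v) :: real)"
          using v by (intro sum_pos2[of _ v]) auto
        then show False using J n by (simp add: size_avg_def divide_le_0_iff)
      qed
      have s2: "s n E \<le> 2 * ?\<theta>"
      proof -
        have "h * size_avg n E f = size_avg n E (\<lambda>c. h * f c)" by (rule size_avg_cmult[symmetric])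
        also have "\<dots> \<le> ?\<theta>" using f(4) by (rule size_avg_mono)
        finally show ?thesis using \<theta> by (simp add: s_def)
      qed
      have s0: "0 \<le> s n E" using C0 h f(3) size_avg_nonneg[of n f E] by (simp add: s_def)
      have same: "size_avg n E (\<lambda>k. (of_bool (h \<le> k))\<^sup>2 * real k) \<le> ?\<alpha> * n * ?\<theta>"
        unfolding size_avg_def times_divide_eq_right sum_distrib_left
        using small C0 h by (intro divide_right_mono sum_mono) (auto simp: of_bool_def less_imp_le)
      have "(s n E)\<^sup>2 / 8 \<le> (2 * ?\<theta>)\<^sup>2 / 8"
        using s2 s0 by (intro divide_right_mono power_mono) auto
      also have "\<dots> = ?\<theta> * (?\<theta> / 2)" by (simp add: power2_eq_square)
      also have "\<dots> \<le> ?\<theta> * (?\<theta> - ?\<alpha>)"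
        using \<theta> by (intro mult_left_mono) (auto intro: size_avg_nonneg)
      also have "\<dots> \<le> ?\<theta>\<^sup>2 - size_avg n E (\<lambda>k. (of_bool (h \<le> k))\<^sup>2 * real k) / n"
      proof -
        have "size_avg n E (\<lambda>k. (of_bool (h \<le> k))\<^sup>2 * real k) / n \<le> ?\<alpha> * n * ?\<theta> / n"
          using same by (rule divide_right_mono) simp
        also have "\<dots> = ?\<alpha> * ?\<theta>" using n by simp
        finally show ?thesis by (simp only: power2_eq_square right_diff_distrib mult.commute)
      qed
      also have "\<dots> \<le> unif n (\<lambda>e. of_bool (snd e \<notin> component n E (fst e)) *
          (of_bool (h \<le> ?c (fst e)) * of_bool (h \<le> ?c (snd e))))"
        by (rule unif_different_components_ge[OF n]) simp
      finally have "\<eta> * ((s n E)\<^sup>2 / 8) \<le> expect (sel_pmf R n E) (gain n E f)"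
        by (rule expect_gain_elliptic[OF n _ _ f(1) f(5), rotated -1]) (use G pos in auto)
      then have "h / n * (\<eta> * ((s n E)\<^sup>2 / 8)) \<le> h / n * expect (sel_pmf R n E) (gain n E f)"
        by (rule mult_left_mono) simp
      moreover have "expect (graph_step R n E) (s n) = C0 / h + h * expect (graph_step R n E) (\<lambda>E'. size_avg n E' f)"
        unfolding s_def using n by (subst expect_add) auto
      then have "expect (graph_step R n E) (s n) = s n E + h / n * expect (sel_pmf R n E) (gain n E f)"
        unfolding expect_step_size_avg[OF n] s_def by (simp add: distrib_left)
      moreover have "h / n * (\<eta> * ((s n E)\<^sup>2 / 8)) = 2 * (\<eta> * real h / 16) * (s n E)\<^sup>2 / n"
        by (simp add: mult_ac)
      ultimately show "s n E + 2 * (\<eta> * real h / 16) * (s n E)\<^sup>2 / n \<le> expect (graph_step R n E) (s n)"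
        by linarith
    qed
  next
    have "0 \<le> h * size_avg n E f" for n E using f(3) by (intro mult_nonneg_nonneg size_avg_nonneg) auto
    then have "\<not> s n E < C0 / h" for n E by (simp add: s_def not_less)
    then show "(\<lambda>n. pr (gdist R n (i0 n)) (\<lambda>E. s n E < C0 / h)) \<longlonglongrightarrow> 0" by simp
  next
    fix r :: real assume "0 < r"
    then have r: "0 < r / 2" by simp
    have "\<forall>\<^sub>F n in sequentially. pr (gdist R n (i0 n)) (\<lambda>E. real h * frac_ge h n E < C0) < r / 2"
      using start r by (rule order_tendstoD)
    then show "\<forall>\<^sub>F n in sequentially. \<forall>i. i0 n \<le> i \<and> i < i1 n \<longrightarrow>
        pr (gdist R n i) (\<lambda>E. \<not> (elliptic R n \<eta> E \<and> \<not> real h * frac_ge h n E < C0)) \<le> r"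
      using ell[OF r] eventually_ge_at_top[of 2]
    proof (eventually_elim, intro allI impI)
      fix n i
      assume s: "pr (gdist R n (i0 n)) (\<lambda>E. real h * frac_ge h n E < C0) < r / 2"
        and e: "\<forall>i. i0 n \<le> i \<and> i < i1 n \<longrightarrow> pr (gdist R n i) (\<lambda>E. \<not> elliptic R n \<eta> E) \<le> r / 2"
        and n: "2 \<le> n" and i: "i0 n \<le> i \<and> i < i1 n"
      have "pr (gdist R n (i0 n)) (\<lambda>E. \<not> real h * frac_ge h n E < C0) \<le>
          pr (gdist R n i) (\<lambda>E. \<not> real h * frac_ge h n E < C0)"
      proof (rule dist_from_persist)
        fix E E' assume P: "\<not> real h * frac_ge h n E < C0" and E': "E' \<in> set_pmf (graph_step R n E)"
        have "real h * frac_ge h n E \<le> real h * frac_ge h n E'"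
          using size_avg_step_mono[OF n mono_ge E'] by (rule mult_left_mono) simp
        then show "\<not> real h * frac_ge h n E' < C0" using P by linarith
      qed (use n i in auto)
      then have "pr (gdist R n i) (\<lambda>E. real h * frac_ge h n E < C0) \<le> r / 2"
        using s n by (simp add: pr_not)
      moreover have "pr (gdist R n i) (\<lambda>E. \<not> (elliptic R n \<eta> E \<and> \<not> real h * frac_ge h n E < C0)) \<le>
          pr (gdist R n i) (\<lambda>E. \<not> elliptic R n \<eta> E) + pr (gdist R n i) (\<lambda>E. real h * frac_ge h n E < C0)"
        using n by (intro pr_Un) auto
      ultimately show "pr (gdist R n i) (\<lambda>E. \<not> (elliptic R n \<eta> E \<and> \<not> real h * frac_ge h n E < C0)) \<le> r"
        using e i by force
    qed
  qed (use pos C0 h T in auto)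
qed

definition time_index :: "real \<Rightarrow> nat \<Rightarrow> nat" where
  "time_index t n = nat \<lfloor>t * real n\<rfloor>"

lemma time_index_bounds:
  assumes "0 \<le> t"
  shows "t * real n - 1 < real (time_index t n)" "real (time_index t n) \<le> t * real n"
  using assms by (auto simp: time_index_def of_nat_nat)

lemma time_index_mono: "s \<le> t \<Longrightarrow> time_index s n \<le> time_index t n"
  unfolding time_index_def by (intro nat_mono floor_mono mult_right_mono) auto

lemma time_index_diff:
  assumes "0 \<le> t" "0 < T"
  shows "\<forall>\<^sub>F n in sequentially. time_index t n \<le> time_index (t + T) n \<and>
    T / 2 \<le> (real (time_index (t + T) n) - real (time_index t n)) / n \<and>
    (real (time_index (t + T) n) - real (time_index t n)) / n \<le> 2 * T"
proof -
  have "(\<lambda>n. 1 / real n) \<longlonglongrightarrow> 0" by (rule lim_const_over_n)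
  then have "\<forall>\<^sub>F n in sequentially. 1 / real n < T / 2" by (rule order_tendstoD) (use assms in simp)
  then show ?thesis using eventually_gt_at_top[of 0]
  proof eventually_elim
    case (elim n)
    have "1 < T / 2 * n" using elim by (simp add: field_simps)
    then show ?case
      using time_index_bounds[of t n] time_index_bounds[of "t + T" n] assms elim
        time_index_mono[of t "t + T" n]
      by (auto simp: pos_le_divide_eq pos_divide_le_eq distrib_right)
  qed
qed

text \<open>The first half of the extra time produces many vertices in large components, the second half joins them. The
level \<open>k\<close>, and with it \<open>h\<close> and \<open>\<alpha>\<close>, depends on \<open>\<epsilon>\<close> and the rule only, so the giant component has
size \<open>\<alpha>n\<close> with probability tending to 1.\<close>

lemma giant_after_blowup:
  assumes R: "take_it_or_leave_it R" and t: "0 < t" and \<epsilon>: "0 < \<epsilon>"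
    and blowup: "\<And>K. \<exists>k. (\<lambda>n. pr (gdist R n (time_index t n)) (\<lambda>E. trunc_susc k n E < K)) \<longlonglongrightarrow> 0"
  shows "\<exists>\<alpha>>0. (\<lambda>n. pr (gdist R n (time_index (t + \<epsilon>) n))
    (\<lambda>E. \<alpha> * real n \<le> real (L1 n E))) \<longlonglongrightarrow> 1"
proof -
  (* each of the two phases lasts half of the extra time *)
  define T where "T = \<epsilon> / 2"
  have T: "0 < T" using \<epsilon> by (simp add: T_def)
  obtain \<eta> where \<eta>: "0 < \<eta>" and rare: "rare R (t / 2) (t + \<epsilon>) (\<lambda>n E. \<not> elliptic R n \<eta> E)"
    using elliptic_rarely_fails[OF R, of "t / 2" "t + \<epsilon>"] t \<epsilon> by auto
  define C0 where "C0 = 64 / (\<eta> * T)"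
  have C0: "0 < C0" using \<eta> T by (simp add: C0_def)
  define K where "K = max 1 (max (4 * C0) (32 / (\<eta> * T)))"
  have K: "4 * C0 \<le> K" "32 / (\<eta> * T) \<le> K" "1 \<le> K" by (auto simp: K_def)
  obtain k where k: "(\<lambda>n. pr (gdist R n (time_index t n)) (\<lambda>E. trunc_susc k n E < K)) \<longlonglongrightarrow> 0"
    using blowup by blast
  (* positive even for k = 0, and truncation at 2 h keeps at least what truncation at k keeps *)
  define h where "h = k + 1"
  have h: "1 \<le> h" by (simp add: h_def)
  have start: "(\<lambda>n. pr (gdist R n (time_index t n)) (\<lambda>E. trunc_susc (2 * h) n E < K)) \<longlonglongrightarrow> 0"
  proof (rule tendsto_sandwich[OF _ _ tendsto_const k])
    show "\<forall>\<^sub>F n in sequentially. pr (gdist R n (time_index t n)) (\<lambda>E. trunc_susc (2 * h) n E < K) \<le>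
        pr (gdist R n (time_index t n)) (\<lambda>E. trunc_susc k n E < K)"
      using eventually_ge_at_top[of 2]
    proof eventually_elim
      case (elim n)
      have "trunc_susc k n E \<le> trunc_susc (2 * h) n E" for E
        by (rule size_avg_mono) (simp add: h_def)
      then show ?case using elim by (intro pr_mono) (auto intro: le_less_trans)
    qed
  qed (simp add: pr_nonneg)
  have ell: "\<forall>\<^sub>F n in sequentially. \<forall>i. time_index s n \<le> i \<and> i < time_index s' n \<longrightarrow>
      pr (gdist R n i) (\<lambda>E. \<not> elliptic R n \<eta> E) \<le> r" if "t \<le> s" "s' \<le> t + \<epsilon>" "0 < r" for s s' r
  proof -
    have "(\<lambda>n. 1 / real n) \<longlonglongrightarrow> 0" by (rule lim_const_over_n)
    then have "\<forall>\<^sub>F n in sequentially. 1 / real n < t / 2" by (rule order_tendstoD) (use t in simp)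
    moreover note rare[unfolded rare_def, THEN spec, THEN mp, OF that(3)]
    ultimately show ?thesis using eventually_gt_at_top[of 0]
    proof (eventually_elim, intro allI impI)
      fix n :: nat and i
      assume n: "1 / real n < t / 2" "0 < n"
        and e: "\<forall>i. t / 2 * real n \<le> real i \<and> real i \<le> (t + \<epsilon>) * real n \<longrightarrow>
          pr (gdist R n i) (\<lambda>E. \<not> elliptic R n \<eta> E) \<le> r"
        and i: "time_index s n \<le> i \<and> i < time_index s' n"
      have "1 < t / 2 * n" using n by (simp add: field_simps)
      moreover have "real (time_index t n) \<le> i" "real i \<le> time_index (t + \<epsilon>) n"
        using i time_index_mono[OF that(1), of n] time_index_mono[OF that(2), of n] by linarith+
      ultimately have "t / 2 * real n \<le> real i \<and> real i \<le> (t + \<epsilon>) * real n"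
        using time_index_bounds(1)[OF less_imp_le[OF t], of n] time_index_bounds(2)[of "t + \<epsilon>" n] t \<epsilon>
        by (intro conjI) linarith+
      then show "pr (gdist R n i) (\<lambda>E. \<not> elliptic R n \<eta> E) \<le> r" using e by blast
    qed
  qed
  have s1: "(\<lambda>n. pr (gdist R n (time_index (t + T) n)) (\<lambda>E. real h * frac_ge h n E < C0)) \<longlonglongrightarrow> 0"
  proof (rule many_vertices_in_large_components[where ?i0.0 = "time_index t" and T = T and K = K])
    fix r :: real assume "0 < r"
    show "\<forall>\<^sub>F n in sequentially. \<forall>i. time_index t n \<le> i \<and> i < time_index (t + T) n \<longrightarrow>
        pr (gdist R n i) (\<lambda>E. \<not> elliptic R n \<eta> E) \<le> r"
      by (rule ell[OF order.refl _ \<open>0 < r\<close>]) (use \<epsilon> in \<open>simp add: T_def\<close>)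
  qed (fact \<eta> T C0 h K start time_index_diff[OF less_imp_le[OF t] T])+
  have tT: "t + T + T = t + \<epsilon>" and tT0: "0 \<le> t + T" using t T by (simp_all add: T_def)
  define \<alpha> where "\<alpha> = C0 / (2 * real h)"
  have \<alpha>: "0 < \<alpha>" using C0 h by (simp add: \<alpha>_def)
  have lim: "(\<lambda>n. pr (gdist R n (time_index (t + \<epsilon>) n)) (\<lambda>E. size_avg n E (\<lambda>c. of_bool (\<alpha> * real n \<le> real c)) \<le> 0)) \<longlonglongrightarrow> 0"
    unfolding \<alpha>_def
  proof (rule giant_from_large_components[where ?i0.0 = "time_index (t + T)" and T = T and \<eta> = \<eta>])
    show "64 / (\<eta> * T) \<le> C0" by (simp add: C0_def)
    fix r :: real assume "0 < r"
    show "\<forall>\<^sub>F n in sequentially. \<forall>i. time_index (t + T) n \<le> i \<and> i < time_index (t + \<epsilon>) n \<longrightarrow>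
        pr (gdist R n i) (\<lambda>E. \<not> elliptic R n \<eta> E) \<le> r"
      by (rule ell[OF _ order.refl \<open>0 < r\<close>]) (use T in simp)
  qed (fact \<eta> T C0 h s1 time_index_diff[OF tT0 T, unfolded tT])+
  let ?p = "\<lambda>n. pr (gdist R n (time_index (t + \<epsilon>) n)) (\<lambda>E. \<alpha> * real n \<le> real (L1 n E))"
  let ?q = "\<lambda>n. pr (gdist R n (time_index (t + \<epsilon>) n))
    (\<lambda>E. size_avg n E (\<lambda>c. of_bool (\<alpha> * real n \<le> real c)) \<le> 0)"
  have large: "\<alpha> * real n \<le> real (L1 n E)"
    if E: "\<not> size_avg n E (\<lambda>c. of_bool (\<alpha> * real n \<le> real c)) \<le> 0" for n E
  proof (rule ccontr)
    assume L: "\<not> \<alpha> * real n \<le> real (L1 n E)"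
    have "\<not> \<alpha> * real n \<le> real (comp_size n E v)" if v: "v \<in> {1..n}" for v
    proof -
      have "real (comp_size n E v) \<le> real (L1 n E)" using L1_ge[OF v] by simp
      then show ?thesis using L by linarith
    qed
    then have "size_avg n E (\<lambda>c. of_bool (\<alpha> * real n \<le> real c)) = 0"
      by (simp add: size_avg_def)
    then show False using E by simp
  qed
  have "1 - ?q n \<le> ?p n" if n: "2 \<le> n" for n
    unfolding pr_not[OF finite_dist_from[OF n], symmetric]
    by (rule pr_mono[OF finite_dist_from[OF n] large])
  then have lower: "\<forall>\<^sub>F n in sequentially. 1 - ?q n \<le> ?p n" by (rule eventually_sequentiallyI)
  have "?p n \<le> 1" if n: "2 \<le> n" for n
    by (rule pr_le_1[OF finite_dist_from[OF n]])
  then have upper: "\<forall>\<^sub>F n in sequentially. ?p n \<le> 1" by (rule eventually_sequentiallyI)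
  have "(\<lambda>n. 1 - ?q n) \<longlonglongrightarrow> 1 - 0" by (rule tendsto_diff[OF tendsto_const lim])
  then have "(\<lambda>n. 1 - ?q n) \<longlonglongrightarrow> 1" by (simp only: diff_zero)
  then have "?p \<longlonglongrightarrow> 1" by (rule tendsto_sandwich[OF lower upper _ tendsto_const])
  then show ?thesis using \<alpha> by (intro exI[of _ \<alpha>] conjI)
qed

section \<open>Stability of the drift\<close>

text \<open>The expectation of \<open>g\<close> at four independent sizes with laws \<open>p\<close>, \<open>q\<close>, \<open>r\<close>, \<open>s\<close>. The laws are
arbitrary weights here, so that differences of laws can be inserted in one slot at a time.\<close>

definition quad :: "nat \<Rightarrow> (nat \<Rightarrow> nat \<Rightarrow> nat \<Rightarrow> nat \<Rightarrow> real) \<Rightarrow> (nat \<Rightarrow> real) \<Rightarrow> (nat \<Rightarrow> real) \<Rightarrow>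
    (nat \<Rightarrow> real) \<Rightarrow> (nat \<Rightarrow> real) \<Rightarrow> real" where
  "quad M g p q r s =
     (\<Sum>a=1..M. \<Sum>b=1..M. \<Sum>c=1..M. \<Sum>d=1..M. p a * (q b * (r c * (s d * g a b c d))))"

lemma quad_nested:
  "quad M g p q r s =
     (\<Sum>a=1..M. p a * (\<Sum>b=1..M. q b * (\<Sum>c=1..M. r c * (\<Sum>d=1..M. s d * g a b c d))))"
  by (simp add: quad_def sum_distrib_left)

lemma quad_swap12: "quad M g p q r s = quad M (\<lambda>a b c d. g b a c d) q p r s"
  unfolding quad_def by (subst sum.swap) (simp add: mult.left_commute)

lemma quad_swap23: "quad M g p q r s = quad M (\<lambda>a b c d. g a c b d) p r q s"
proof -
  have "(\<Sum>b=1..M. \<Sum>c=1..M. \<Sum>d=1..M. p a * (q b * (r c * (s d * g a b c d)))) =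
      (\<Sum>c=1..M. \<Sum>b=1..M. \<Sum>d=1..M. p a * (r c * (q b * (s d * g a b c d))))" for a
    by (subst sum.swap) (simp add: mult.left_commute)
  then show ?thesis unfolding quad_def by simp
qed

lemma quad_swap34: "quad M g p q r s = quad M (\<lambda>a b c d. g a b d c) p q s r"
proof -
  have "(\<Sum>c=1..M. \<Sum>d=1..M. p a * (q b * (r c * (s d * g a b c d)))) =
      (\<Sum>d=1..M. \<Sum>c=1..M. p a * (q b * (s d * (r c * g a b c d))))" for a b
    by (subst sum.swap) (simp add: mult.left_commute)
  then show ?thesis unfolding quad_def by simp
qed

lemma quad_diff1: "quad M g (\<lambda>a. p a - p' a) q r s = quad M g p q r s - quad M g p' q r s"
  by (simp add: quad_def left_diff_distrib sum_subtractf)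

lemma quad_diff2: "quad M g p (\<lambda>a. q a - q' a) r s = quad M g p q r s - quad M g p q' r s"
  by (simp add: quad_swap12[of M g p] quad_diff1)

lemma quad_diff3: "quad M g p q (\<lambda>a. r a - r' a) s = quad M g p q r s - quad M g p q r' s"
  by (simp add: quad_swap23[of M g p q] quad_diff2)

lemma quad_diff4: "quad M g p q r (\<lambda>a. s a - s' a) = quad M g p q r s - quad M g p q r s'"
  by (simp add: quad_swap34[of M g p q r] quad_diff3)

definition size_distr :: "nat \<Rightarrow> real \<Rightarrow> (nat \<Rightarrow> real) \<Rightarrow> bool" where
  "size_distr M K p \<longleftrightarrow> (\<forall>a. 0 \<le> p a) \<and> (\<Sum>a=1..M. p a) = 1 \<and> (\<Sum>a=1..M. p a * real a) \<le> K"

lemma weighted_sum_le: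
  assumes "size_distr M K q" "0 \<le> k" "\<And>b. f b \<le> c + k * real b"
  shows "(\<Sum>b=1..M. q b * f b) \<le> c + k * K"
proof -
  have "(\<Sum>b=1..M. q b * f b) \<le> (\<Sum>b=1..M. q b * (c + k * real b))"
    using assms by (intro sum_mono mult_left_mono) (auto simp: size_distr_def)
  also have "\<dots> = c * (\<Sum>b=1..M. q b) + k * (\<Sum>b=1..M. q b * real b)"
    by (simp add: sum_distrib_left sum.distrib algebra_simps)
  also have "\<dots> \<le> c + k * K"
    using assms mult_left_mono[of "\<Sum>b=1..M. q b * real b" K k] by (auto simp: size_distr_def)
  finally show ?thesis .
qed

text \<open>The perturbation \<open>e\<close> may only be charged for the sizes \<open>b\<close>, \<open>c\<close>, \<open>d\<close> of the other three components, whose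
means are bounded by \<open>K\<close>, and not for its own size \<open>a\<close>, whose mean under \<open>\<bar>e\<bar>\<close> is not controlled by the total mass of \<open>\<bar>e\<bar>\<close>;
the remainder \<open>\<tau>\<close> takes the part that does not cancel exactly.\<close>

lemma quad_signed_le:
  assumes "size_distr M K q" "size_distr M K r" "size_distr M K s"
    and h: "\<And>a b c d. e a * h a b c d \<le> (2 * real b + 2 * real c + 2 * real d) * \<bar>e a\<bar> + \<tau> a"
  shows "quad M h e q r s \<le> 6 * K * (\<Sum>a=1..M. \<bar>e a\<bar>) + (\<Sum>a=1..M. \<tau> a)"
proof -
  have "quad M h e q r s =
      (\<Sum>a=1..M. \<Sum>b=1..M. q b * (\<Sum>c=1..M. r c * (\<Sum>d=1..M. s d * (e a * h a b c d))))"
    unfolding quad_nested by (simp add: sum_distrib_left mult.left_commute)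
  also have "\<dots> \<le> (\<Sum>a=1..M. 6 * K * \<bar>e a\<bar> + \<tau> a)"
  proof (rule sum_mono)
    fix a
    let ?E = "2 * \<bar>e a\<bar>"
    have 1: "(\<Sum>d=1..M. s d * (e a * h a b c d)) \<le> (?E * b + ?E * c + \<tau> a) + ?E * K" for b c
      using assms(3) by (rule weighted_sum_le) (use h[of a b c] in \<open>auto simp: algebra_simps\<close>)
    have 2: "(\<Sum>c=1..M. r c * (\<Sum>d=1..M. s d * (e a * h a b c d))) \<le> (?E * b + \<tau> a + ?E * K) + ?E * K" for b
      using assms(2) by (rule weighted_sum_le) (use 1[of b] in \<open>auto simp: algebra_simps\<close>)
    have "(\<Sum>b=1..M. q b * (\<Sum>c=1..M. r c * (\<Sum>d=1..M. s d * (e a * h a b c d)))) \<le>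
        (\<tau> a + ?E * K + ?E * K) + ?E * K"
      using assms(1) by (rule weighted_sum_le) (use 2 in \<open>auto simp: algebra_simps\<close>)
    then show "(\<Sum>b=1..M. q b * (\<Sum>c=1..M. r c * (\<Sum>d=1..M. s d * (e a * h a b c d)))) \<le>
        6 * K * \<bar>e a\<bar> + \<tau> a" by (simp add: algebra_simps)
  qed
  also have "\<dots> = 6 * K * (\<Sum>a=1..M. \<bar>e a\<bar>) + (\<Sum>a=1..M. \<tau> a)"
    by (simp add: sum.distrib sum_distrib_left)
  finally show ?thesis .
qed

definition sel_gain :: "size_rule \<Rightarrow> (nat \<Rightarrow> real) \<Rightarrow> nat \<Rightarrow> nat \<Rightarrow> nat \<Rightarrow> nat \<Rightarrow> real" where
  "sel_gain R w a b c d = (if R a b c d then merge_gain w a b else merge_gain w c d)"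

text \<open>Stability of the drift in the \<open>\<ell>\<^sub>1\<close> distance of the size laws, with a constant depending only on the
susceptibility bound. Here \<open>w\<close> stands for the signs of \<open>e = x - y\<close>. If the component of size \<open>a\<close> sampled from
\<open>e\<close> takes part in the merge, the new component of size \<open>a + b\<close> contributes at most \<open>(a + b)\<bar>e a\<bar>\<close>, while
losing the component of size \<open>a\<close> contributes \<open>-a\<bar>e a\<bar>\<close> when \<open>w a\<close> is the sign of \<open>e a\<close>: the
terms with the factor \<open>a\<close> cancel, up to the error made by replacing signs with \<open>w\<close>. This works for every
four-vertex size rule.\<close>

lemma drift_difference:
  assumes x: "size_distr M K x" and y: "size_distr M K y"
    and w: "\<And>a. \<bar>w a\<bar> \<le> 1"
  defines "e \<equiv> \<lambda>a. x a - y a"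
  shows "quad M (sel_gain R w) x x x x - quad M (sel_gain R w) y y y y \<le>
    24 * K * (\<Sum>a=1..M. \<bar>e a\<bar>) + 4 * (\<Sum>a=1..M. real a * (\<bar>e a\<bar> - e a * w a))"
proof -
  let ?g = "sel_gain R w"
  define \<tau> where "\<tau> a = real a * (\<bar>e a\<bar> - e a * w a)" for a
  have ew: "z * w b \<le> \<bar>z\<bar>" "- (z * w b) \<le> \<bar>z\<bar>" for z b
  proof -
    have "\<bar>z * w b\<bar> \<le> \<bar>z\<bar> * 1" unfolding abs_mult using w by (intro mult_left_mono) auto
    then show "z * w b \<le> \<bar>z\<bar>" "- (z * w b) \<le> \<bar>z\<bar>" by linarith+
  qed
  have \<tau>0: "0 \<le> \<tau> a" for a using ew(1)[of "e a" a] by (simp add: \<tau>_def)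
  have G1: "e a * merge_gain w a b \<le> 2 * real b * \<bar>e a\<bar> + \<tau> a" for a b
  proof -
    have "real (a + b) * (e a * w (a + b)) \<le> real (a + b) * \<bar>e a\<bar>"
      using ew(1) by (intro mult_left_mono) auto
    moreover have "real b * (- (e a * w b)) \<le> real b * \<bar>e a\<bar>"
      using ew(2) by (intro mult_left_mono) auto
    ultimately show ?thesis by (simp add: merge_gain_def \<tau>_def algebra_simps)
  qed
  have sym: "merge_gain w a b = merge_gain w b a" for a b
    by (simp add: merge_gain_def add.commute)
  have G2: "e a * merge_gain w c d \<le> (2 * real c + 2 * real d) * \<bar>e a\<bar> + \<tau> a" for a c d
  proof -
    have "real (c + d) * (e a * w (c + d)) \<le> real (c + d) * \<bar>e a\<bar>"
      using ew(1) by (intro mult_left_mono) auto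
    moreover have "real c * (- (e a * w c)) \<le> real c * \<bar>e a\<bar>" "real d * (- (e a * w d)) \<le> real d * \<bar>e a\<bar>"
      using ew(2) by (intro mult_left_mono; auto)+
    ultimately show ?thesis using \<tau>0[of a] by (simp add: merge_gain_def algebra_simps)
  qed
  have G1': "e a * merge_gain w a b \<le> (2 * real b + 2 * real c + 2 * real d) * \<bar>e a\<bar> + \<tau> a" for a b c d
  proof -
    have "2 * real b * \<bar>e a\<bar> + \<tau> a \<le> (2 * real b + 2 * real c + 2 * real d) * \<bar>e a\<bar> + \<tau> a"
      by (intro add_right_mono mult_right_mono) auto
    then show ?thesis by (rule order.trans[OF G1])
  qed
  have G2': "e a * merge_gain w c d \<le> (2 * real b + 2 * real c + 2 * real d) * \<bar>e a\<bar> + \<tau> a" for a b c d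
  proof -
    have "(2 * real c + 2 * real d) * \<bar>e a\<bar> + \<tau> a \<le> (2 * real b + 2 * real c + 2 * real d) * \<bar>e a\<bar> + \<tau> a"
      by (intro add_right_mono mult_right_mono) auto
    then show ?thesis by (rule order.trans[OF G2])
  qed
  let ?S = "6 * K * (\<Sum>a=1..M. \<bar>e a\<bar>) + (\<Sum>a=1..M. \<tau> a)"
  have 1: "quad M ?g e x x x \<le> ?S"
    using x x x by (rule quad_signed_le) (use G1' G2' in \<open>simp add: sel_gain_def\<close>)
  have 2: "quad M ?g y e x x \<le> ?S" unfolding quad_swap12[of M ?g y]
  proof (rule quad_signed_le[OF y x x])
    show "e a * ?g b a c d \<le> (2 * real b + 2 * real c + 2 * real d) * \<bar>e a\<bar> + \<tau> a" for a b c d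
      using G1'[of a b c d] G2'[of a c d b] by (simp add: sel_gain_def sym[of b a])
  qed
  have "quad M ?g y y e x = quad M (\<lambda>a b c d. ?g b c a d) e y y x"
    by (subst quad_swap23, subst quad_swap12) (rule refl)
  also have "\<dots> \<le> ?S"
  proof (rule quad_signed_le[OF y y x])
    show "e a * ?g b c a d \<le> (2 * real b + 2 * real c + 2 * real d) * \<bar>e a\<bar> + \<tau> a" for a b c d
      using G1'[of a d b c] G2'[of a b c d] by (simp add: sel_gain_def algebra_simps)
  qed
  finally have 3: "quad M ?g y y e x \<le> ?S" .
  have "quad M ?g y y y e = quad M (\<lambda>a b c d. ?g b c d a) e y y y"
    by (subst quad_swap34, subst quad_swap23, subst quad_swap12) (rule refl)
  also have "\<dots> \<le> ?S"
  proof (rule quad_signed_le[OF y y y])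
    show "e a * ?g b c d a \<le> (2 * real b + 2 * real c + 2 * real d) * \<bar>e a\<bar> + \<tau> a" for a b c d
      using G1'[of a d b c] G2'[of a b c d] by (simp add: sel_gain_def sym[of d a] algebra_simps)
  qed
  finally have 4: "quad M ?g y y y e \<le> ?S" .
  have "quad M ?g x x x x - quad M ?g y y y y =
      quad M ?g e x x x + quad M ?g y e x x + quad M ?g y y e x + quad M ?g y y y e"
    unfolding e_def quad_diff1 quad_diff2 quad_diff3 quad_diff4 by simp
  then show ?thesis using 1 2 3 4 by (simp add: \<tau>_def)
qed

section \<open>The drift of a linear statistic\<close>

definition avg_pair :: "nat \<Rightarrow> (nat \<times> nat \<Rightarrow> real) \<Rightarrow> real" where
  "avg_pair n h = (\<Sum>u=1..n. \<Sum>v=1..n. h (u, v)) / (real n)\<^sup>2"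

lemma unif_avg_pair:
  assumes n: "2 \<le> n" and h: "\<And>e. \<bar>h e\<bar> \<le> c"
  shows "\<bar>unif n h - avg_pair n h\<bar> \<le> 2 * c / n"
proof -
  have avg_add: "avg_pair n (\<lambda>e. c + k * h e) = c + k * avg_pair n h" for k
    using n by (simp add: avg_pair_def sum.distrib sum_distrib_left power2_eq_square add_divide_distrib)
  have "avg_pair n (\<lambda>e. c + k * h e) - 2 * c / n \<le> unif n (\<lambda>e. c + k * h e)" if "\<bar>k\<bar> = 1" for k
  proof -
    have *: "0 \<le> c + z \<and> c + z \<le> 2 * c" if "\<bar>z\<bar> \<le> c" for z :: real
      using that by linarith
    have "\<bar>k * h e\<bar> \<le> c" for e using h[of e] that by (simp add: abs_mult)
    from *[OF this] show ?thesis
      unfolding avg_pair_def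
      using unif_pairs_ge[OF n, where h = "\<lambda>e. c + k * h e" and c = "2 * c"] by blast
  qed
  then have "c + k * avg_pair n h - 2 * c / n \<le> c + k * unif n h" if "\<bar>k\<bar> = 1" for k
    using that unfolding avg_add unif_add[OF n] unif_const unif_cmult by simp
  (* k = 1 and k = -1 give the two sides of the absolute value *)
  from this[of 1] this[of "-1"] show ?thesis by simp
qed

lemma avg_pair_sizes:
  assumes "n \<le> M"
  shows "avg_pair n (\<lambda>(u, v). f (comp_size n E u) (comp_size n E v)) =
    (\<Sum>a=1..M. frac_of_size n E a * (\<Sum>b=1..M. frac_of_size n E b * f a b))"
proof -
  have "avg_pair n (\<lambda>(u, v). f (comp_size n E u) (comp_size n E v)) =
      size_avg n E (\<lambda>a. size_avg n E (\<lambda>b. f a b))"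
    by (simp add: avg_pair_def size_avg_def power2_eq_square sum_divide_distrib)
  also have "\<dots> = (\<Sum>a=1..M. frac_of_size n E a * size_avg n E (f a))"
    by (rule size_avg_as_sum[OF assms])
  also have "\<dots> = (\<Sum>a=1..M. frac_of_size n E a * (\<Sum>b=1..M. frac_of_size n E b * f a b))"
    by (intro sum.cong refl arg_cong2[where f = "(*)"] size_avg_as_sum[OF assms])
  finally show ?thesis .
qed

text \<open>Sampling distinct endvertices instead of independent ones, and ignoring that two endvertices may lie in the
same component, changes the drift of a statistic supported on sizes up to \<open>B\<close> by \<open>O(BS/n)\<close>.\<close>

lemma expect_sel_gain_approx:
  fixes B :: nat
  assumes n: "2 \<le> n" "n \<le> M" and w: "\<And>a. \<bar>w a\<bar> \<le> 1" "\<And>a. B < a \<Longrightarrow> w a = 0"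
    and x: "x = frac_of_size n E"
  shows "\<bar>expect (sel_pmf R n E) (gain n E w) - quad M (sel_gain R w) x x x x\<bar> \<le> 24 * real B * susc n E / real n"
proof -
  let ?c = "comp_size n E"
  let ?same = "\<lambda>e. of_bool (snd e \<in> component n E (fst e)) :: real"
  define g where "g e1 e2 = sel_gain R w (?c (fst e1)) (?c (snd e1)) (?c (fst e2)) (?c (snd e2))" for e1 e2
  define g' where "g' e1 e2 = gain n E w (sel_pair R n E (e1, e2))" for e1 e2
  have aw: "\<bar>real a * w a\<bar> \<le> B" for a
  proof (cases "a \<le> B")
    case True
    have "real a * \<bar>w a\<bar> \<le> real B * 1" using True w by (intro mult_mono) auto
    then show ?thesis by (simp add: abs_mult)
  qed (use w in simp)
  have mg: "\<bar>merge_gain w a b\<bar> \<le> 3 * real B" for a b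
    using aw[of "a + b"] aw[of a] aw[of b] unfolding merge_gain_def by (simp add: abs_le_iff)
  have g_le: "\<bar>g e1 e2\<bar> \<le> 3 * real B" for e1 e2 using mg by (simp add: g_def sel_gain_def)
  have diff: "\<bar>g' e1 e2 - g e1 e2\<bar> \<le> 3 * real B * ?same e1 + 3 * real B * ?same e2" for e1 e2
    using order.trans[OF mg, of "3 * real B"] order.trans[OF mg, of "6 * real B"]
    by (cases e1; cases e2) (simp add: g'_def g_def gain_def sel_gain_def sel_pair_def)
  have same: "unif n ?same \<le> 2 * susc n E / n"
    using unif_le[OF n(1), of ?same] sum_same_component[of "\<lambda>_. 1" n E] n(1)
    by (simp add: power2_eq_square)
  have E: "expect (sel_pmf R n E) (gain n E w) = unif n (\<lambda>e1. unif n (g' e1))"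
    unfolding expect_sel_choice[OF n(1)] by (simp add: g'_def[abs_def] case_prod_unfold)
  have d1: "unif n (\<lambda>e1. unif n (\<lambda>e2. k * g' e1 e2)) - unif n (\<lambda>e1. unif n (\<lambda>e2. k * g e1 e2))
      \<le> 12 * real B * susc n E / n" if k: "\<bar>k\<bar> = 1" for k
  proof -
    have "unif n (\<lambda>e1. unif n (\<lambda>e2. k * g' e1 e2)) \<le>
        unif n (\<lambda>e1. unif n (\<lambda>e2. k * g e1 e2 + (3 * real B * ?same e1 + 3 * real B * ?same e2)))"
    proof (intro unif_mono[OF n(1)])
      fix e1 e2
      have "k * (g' e1 e2 - g e1 e2) \<le> \<bar>k * (g' e1 e2 - g e1 e2)\<bar>" by simp
      also have "\<dots> = \<bar>g' e1 e2 - g e1 e2\<bar>" using k by (simp add: abs_mult)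
      finally show "k * g' e1 e2 \<le> k * g e1 e2 + (3 * real B * ?same e1 + 3 * real B * ?same e2)"
        using diff[of e1 e2] by (simp add: algebra_simps)
    qed
    also have "\<dots> = unif n (\<lambda>e1. unif n (\<lambda>e2. k * g e1 e2)) + 6 * real B * unif n ?same"
      unfolding unif_add[OF n(1)] unif_const unif_cmult by simp
    also have "6 * real B * unif n ?same \<le> 6 * real B * (2 * susc n E / n)"
      using same by (intro mult_left_mono) auto
    finally show ?thesis by simp
  qed
  have d1': "\<bar>unif n (\<lambda>e1. unif n (g' e1)) - unif n (\<lambda>e1. unif n (g e1))\<bar> \<le> 12 * real B * susc n E / n"
    using d1[of 1] d1[of "-1"] unfolding unif_cmult by simp
  have av_le: "\<bar>avg_pair n (g e1)\<bar> \<le> 3 * real B" for e1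
  proof -
    have "\<bar>\<Sum>u=1..n. \<Sum>v=1..n. g e1 (u, v)\<bar> \<le> (\<Sum>u=1..n. \<Sum>v=1..n. \<bar>g e1 (u, v)\<bar>)"
      by (rule order.trans[OF sum_abs]) (intro sum_mono sum_abs)
    also have "\<dots> \<le> (\<Sum>u=1..n. \<Sum>v=1..n. 3 * real B)" by (intro sum_mono g_le)
    finally have "\<bar>avg_pair n (g e1)\<bar> \<le> (\<Sum>u=1..n. \<Sum>v=1..n. 3 * real B) / (real n)\<^sup>2"
      by (simp add: avg_pair_def abs_divide divide_right_mono)
    then show ?thesis using n by (simp add: power2_eq_square)
  qed
  have d2: "\<bar>unif n (\<lambda>e1. unif n (g e1)) - unif n (\<lambda>e1. avg_pair n (g e1))\<bar> \<le> 6 * real B / n"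
  proof -
    have p: "\<bar>unif n (g e1) - avg_pair n (g e1)\<bar> \<le> 6 * real B / n" for e1
      using unif_avg_pair[OF n(1), of "g e1" "3 * real B"] g_le by simp
    have "unif n (\<lambda>e1. unif n (g e1)) \<le> unif n (\<lambda>e1. avg_pair n (g e1) + 6 * real B / n)"
      using p by (intro unif_mono[OF n(1)]) (simp add: abs_le_iff algebra_simps)
    moreover have "unif n (\<lambda>e1. avg_pair n (g e1)) \<le> unif n (\<lambda>e1. unif n (g e1) + 6 * real B / n)"
      using p by (intro unif_mono[OF n(1)]) (simp add: abs_le_iff algebra_simps)
    ultimately show ?thesis unfolding unif_add[OF n(1)] unif_const by (simp add: abs_le_iff)
  qed
  have d3: "\<bar>unif n (\<lambda>e1. avg_pair n (g e1)) - avg_pair n (\<lambda>e1. avg_pair n (g e1))\<bar> \<le> 6 * real B / n"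
    using unif_avg_pair[OF n(1), of "\<lambda>e1. avg_pair n (g e1)" "3 * real B"] av_le by simp
  have d4: "avg_pair n (\<lambda>e1. avg_pair n (g e1)) = quad M (sel_gain R w) x x x x"
  proof -
    define F where "F a b = (\<Sum>c=1..M. x c * (\<Sum>d=1..M. x d * sel_gain R w a b c d))" for a b
    have "avg_pair n (g e1) = F (?c (fst e1)) (?c (snd e1))" for e1
    proof -
      have "F a b = avg_pair n (\<lambda>(u, v). sel_gain R w a b (?c u) (?c v))" for a b
        unfolding F_def x by (rule avg_pair_sizes[OF n(2), symmetric])
      then show ?thesis by (simp add: g_def[abs_def] case_prod_unfold)
    qed
    then have "avg_pair n (\<lambda>e1. avg_pair n (g e1)) = avg_pair n (\<lambda>(u, v). F (?c u) (?c v))"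
      by (simp add: case_prod_unfold)
    also have "\<dots> = quad M (sel_gain R w) x x x x"
      unfolding quad_nested using avg_pair_sizes[OF n(2), of F E] by (simp only: F_def x)
    finally show ?thesis .
  qed
  have "real B / n * 1 \<le> real B / n * susc n E"
    using susc_ge_1[of n E] n by (intro mult_left_mono) auto
  then have "6 * (real B / n) + 6 * (real B / n) \<le> 12 * (real B * susc n E / n)"
    by simp
  then have "12 * real B * susc n E / n + 6 * real B / n + 6 * real B / n \<le> 24 * real B * susc n E / n"
  proof -
    have "12 * t + 6 * z + 6 * z \<le> 24 * t" if "6 * z + 6 * z \<le> 12 * t" for z t :: real
      using that by linarith
    from this[OF \<open>6 * (real B / n) + 6 * (real B / n) \<le> _\<close>] show ?thesis by (simp add: mult.assoc)
  qed
  moreover have "\<bar>a - d\<bar> \<le> s" if "p + q + r \<le> s" "\<bar>a - b\<bar> \<le> p" "\<bar>b - c\<bar> \<le> q" "\<bar>c - d\<bar> \<le> r"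
    for a b c d p q r s :: real using that by linarith
  ultimately show ?thesis using d1' d2 d3 unfolding E d4 by blast
qed

section \<open>Comparing two independent processes\<close>

text \<open>To compare processes on \<open>n \<le> m\<close> vertices, the smaller one makes a step with probability \<open>n/m\<close> whenever the
larger one makes a step. Both then run on the time scale of the larger process, and the drifts of their size
laws per joint step are \<open>1/m\<close> times the same function.\<close>

definition lazy_step :: "size_rule \<Rightarrow> nat \<Rightarrow> real \<Rightarrow> graph \<Rightarrow> graph pmf" where
  "lazy_step R n p E = bind_pmf (bernoulli_pmf p) (\<lambda>b. if b then graph_step R n E else return_pmf E)"

definition lazy :: "size_rule \<Rightarrow> nat \<Rightarrow> real \<Rightarrow> nat \<Rightarrow> graph pmf" where
  "lazy R n p j = bind_pmf (binomial_pmf j p) (\<lambda>i. gdist R n i)"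

lemma finite_lazy [simp]: "2 \<le> n \<Longrightarrow> 0 \<le> p \<Longrightarrow> p \<le> 1 \<Longrightarrow> finite (set_pmf (lazy R n p j))"
  by (simp add: lazy_def finite_set_pmf_binomial_pmf)

lemma finite_lazy_step [simp]: "2 \<le> n \<Longrightarrow> finite (set_pmf (lazy_step R n p E))"
  by (auto simp: lazy_step_def intro: finite_subset[OF subset_UNIV])

lemma lazy_0: "0 \<le> p \<Longrightarrow> p \<le> 1 \<Longrightarrow> lazy R n p 0 = return_pmf {}"
  by (simp add: lazy_def binomial_pmf_0 bind_return_pmf)

lemma lazy_Suc:
  assumes "0 \<le> p" "p \<le> 1"
  shows "lazy R n p (Suc j) = bind_pmf (lazy R n p j) (lazy_step R n p)"
proof -
  have "lazy R n p (Suc j) =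
      bind_pmf (bernoulli_pmf p) (\<lambda>b. bind_pmf (binomial_pmf j p) (\<lambda>k. gdist R n ((if b then 1 else 0) + k)))"
    using assms by (simp add: lazy_def binomial_pmf_Suc bind_assoc_pmf bind_return_pmf)
  also have "\<dots> = bind_pmf (bernoulli_pmf p) (\<lambda>b. bind_pmf (binomial_pmf j p)
      (\<lambda>k. bind_pmf (gdist R n k) (\<lambda>E. if b then graph_step R n E else return_pmf E)))"
    by (intro bind_pmf_cong refl) (simp add: bind_return_pmf')
  also have "\<dots> = bind_pmf (binomial_pmf j p) (\<lambda>k. bind_pmf (gdist R n k)
      (\<lambda>E. bind_pmf (bernoulli_pmf p) (\<lambda>b. if b then graph_step R n E else return_pmf E)))"
    by (subst bind_commute_pmf) (intro bind_pmf_cong refl bind_commute_pmf)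
  also have "\<dots> = bind_pmf (lazy R n p j) (lazy_step R n p)"
    by (simp add: lazy_def lazy_step_def[abs_def] bind_assoc_pmf)
  finally show ?thesis .
qed

lemma expect_lazy_step:
  assumes "2 \<le> n" "0 \<le> p" "p \<le> 1"
  shows "expect (lazy_step R n p E) F = p * expect (graph_step R n E) F + (1 - p) * F E"
  unfolding lazy_step_def using assms
  by (subst expect_bind) (auto intro: finite_subset[OF subset_UNIV])

lemma expect_swap:
  assumes "finite (set_pmf p)" "finite (set_pmf q)"
  shows "expect p (\<lambda>x. expect q (\<lambda>y. f x y)) = expect q (\<lambda>y. expect p (\<lambda>x. f x y))"
proof -
  have "expect p (\<lambda>x. expect q (\<lambda>y. f x y)) = expect (pair_pmf p q) (\<lambda>z. f (fst z) (snd z))"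
    using assms by (simp add: expect_pair)
  also have "\<dots> = expect (pair_pmf q p) (\<lambda>z. f (snd z) (fst z))"
    by (subst pair_commute_pmf) (simp add: case_prod_unfold)
  also have "\<dots> = expect q (\<lambda>y. expect p (\<lambda>x. f x y))"
    using assms by (simp add: expect_pair)
  finally show ?thesis .
qed

lemma susc2_bound_lazy:
  assumes n: "2 \<le> n" "n \<le> m" and K: "0 \<le> K"
  shows "expect (lazy R n (real n / real m) j) (\<lambda>E. susc2 n E * of_bool (susc n E \<le> K)) \<le> exp (24 * K / real m * real j)"
proof -
  let ?F = "\<lambda>E. susc2 n E * of_bool (susc n E \<le> K)"
  let ?p = "real n / real m"
  have p: "0 \<le> ?p" "?p \<le> 1" using n by auto
  have one_step: "expect (lazy_step R n ?p E) ?F \<le> (1 + 24 * K / m) * ?F E" for E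
  proof (cases "susc n E \<le> K")
    case True
    have "expect (graph_step R n E) ?F \<le> expect (graph_step R n E) (susc2 n)"
      using n by (intro expect_mono) (auto simp: susc2_nonneg)
    also have "\<dots> \<le> susc2 n E * (1 + 24 * susc n E / n)" by (rule expect_step_susc2[OF n(1)])
    also have "\<dots> \<le> susc2 n E * (1 + 24 * K / n)"
      using True by (intro mult_left_mono add_mono divide_right_mono) (auto simp: susc2_nonneg)
    finally have "?p * expect (graph_step R n E) ?F + (1 - ?p) * ?F E \<le>
        ?p * (susc2 n E * (1 + 24 * K / n)) + (1 - ?p) * ?F E"
      using p by (intro add_right_mono mult_left_mono) auto
    also have "\<dots> = (1 + 24 * K / m) * ?F E" using True n by (simp add: field_simps)
    finally show ?thesis using expect_lazy_step[OF n(1) p] by simp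
  next
    case False
    have "expect (graph_step R n E) ?F = expect (graph_step R n E) (\<lambda>_. 0)"
      using False size_avg_step_mono[OF n(1) mono_real] by (intro expect_cong) force
    then show ?thesis using False expect_lazy_step[OF n(1) p] by simp
  qed
  have "expect (lazy R n ?p j) ?F \<le> exp (24 * K / real m * real j) * (expect (lazy R n ?p 0) ?F + real j * 0)"
  proof (rule discrete_gronwall[where \<phi> = "\<lambda>i. expect (lazy R n ?p i) ?F" and b = 0])
    fix i
    have "expect (lazy R n ?p (Suc i)) ?F = expect (lazy R n ?p i) (\<lambda>E. expect (lazy_step R n ?p E) ?F)"
      using n p by (simp add: lazy_Suc expect_bind)
    also have "\<dots> \<le> expect (lazy R n ?p i) (\<lambda>E. (1 + 24 * K / m) * ?F E)"
      using n p one_step by (intro expect_mono) auto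
    finally show "expect (lazy R n ?p (Suc i)) ?F \<le> (1 + 24 * K / m) * expect (lazy R n ?p i) ?F + 0"
      by simp
  qed (use K in \<open>auto intro!: expect_nonneg simp: susc2_nonneg\<close>)
  also have "expect (lazy R n ?p 0) ?F \<le> 1" using n p by (simp add: lazy_0 size_avg_empty)
  finally show ?thesis by simp
qed

text \<open>The \<open>\<ell>\<^sub>1\<close> distance of the size laws restricted to sizes up to \<open>B\<close>, with \<open>\<bar>e\<bar>\<close> replaced by
\<open>sqrt (e\<^sup>2 + \<delta>\<^sup>2)\<close> so that one step can be expanded to second order.\<close>

definition smooth_dist :: "nat \<Rightarrow> real \<Rightarrow> nat \<Rightarrow> nat \<Rightarrow> graph \<Rightarrow> graph \<Rightarrow> real" where
  "smooth_dist B \<delta> n m E E' = (\<Sum>a=1..B. sqrt ((frac_of_size n E a - frac_of_size m E' a)\<^sup>2 + \<delta>\<^sup>2))"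

text \<open>Concavity of the square root: \<open>sqrt (u\<^sup>2 + z) \<le> u + z/(2u)\<close> with \<open>u = sqrt (e\<^sup>2 + \<delta>\<^sup>2) \<ge> \<delta>\<close>.\<close>

lemma sqrt_smooth_step:
  fixes e h \<delta> :: real
  assumes "0 < \<delta>"
  shows "sqrt ((e + h)\<^sup>2 + \<delta>\<^sup>2) \<le> sqrt (e\<^sup>2 + \<delta>\<^sup>2) + e / sqrt (e\<^sup>2 + \<delta>\<^sup>2) * h + h\<^sup>2 / (2 * \<delta>)"
proof -
  define u where "u = sqrt (e\<^sup>2 + \<delta>\<^sup>2)"
  have u2: "u\<^sup>2 = e\<^sup>2 + \<delta>\<^sup>2" by (simp add: u_def)
  have ud: "\<delta> \<le> u" unfolding u_def using assms by (intro real_le_rsqrt) simp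
  have u: "0 < u" using assms ud by linarith
  have le: "(e + h)\<^sup>2 + \<delta>\<^sup>2 \<le> (u + (2 * e * h + h\<^sup>2) / (2 * u))\<^sup>2"
  proof -
    have "(u + (2 * e * h + h\<^sup>2) / (2 * u))\<^sup>2 = u\<^sup>2 + (2 * e * h + h\<^sup>2) + ((2 * e * h + h\<^sup>2) / (2 * u))\<^sup>2"
      using u by (simp add: power2_sum)
    then show ?thesis using u2 by (simp add: power2_sum)
  qed
  have "u + (2 * e * h + h\<^sup>2) / (2 * u) = (u\<^sup>2 + (e + h)\<^sup>2 + \<delta>\<^sup>2) / (2 * u)"
    using u u2 by (simp add: field_simps power2_eq_square)
  moreover have "0 \<le> (u\<^sup>2 + (e + h)\<^sup>2 + \<delta>\<^sup>2) / (2 * u)" using u by simp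
  ultimately have "sqrt ((e + h)\<^sup>2 + \<delta>\<^sup>2) \<le> u + (2 * e * h + h\<^sup>2) / (2 * u)"
    using le by (intro real_le_lsqrt) auto
  also have "\<dots> = u + e / u * h + h\<^sup>2 / (2 * u)" using u by (simp add: field_simps)
  also have "h\<^sup>2 / (2 * u) \<le> h\<^sup>2 / (2 * \<delta>)" using ud assms by (intro divide_left_mono) auto
  finally show ?thesis by (simp add: u_def)
qed

lemma size_avg_as_partial_sum:
  assumes "\<And>a. a \<notin> {1..B} \<Longrightarrow> w a = 0"
  shows "size_avg n E w = (\<Sum>a=1..B. frac_of_size n E a * w a)"
proof -
  have "size_avg n E w = size_avg n E (\<lambda>k. \<Sum>a=1..B. w a * of_bool (k = a))"
  proof (rule size_avg_cong)
    fix k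
    have "(\<Sum>a=1..B. w a * of_bool (k = a)) = (\<Sum>a=1..B. if k = a then w a else 0)"
      by (intro sum.cong) auto
    also have "\<dots> = w k" using assms[of k] by (cases "k \<in> {1..B}") auto
    finally show "w k = (\<Sum>a=1..B. w a * of_bool (k = a))" ..
  qed
  also have "\<dots> = (\<Sum>a=1..B. w a * frac_of_size n E a)"
    unfolding size_avg_sum size_avg_cmult ..
  finally show ?thesis by (simp add: mult.commute)
qed

lemma size_distr_frac:
  assumes "2 \<le> n" "n \<le> M" "susc n E \<le> K"
  shows "size_distr M K (frac_of_size n E)"
  using size_avg_as_sum[OF assms(2), of E "\<lambda>_. 1"] size_avg_as_sum[OF assms(2), of E real] assms
  by (simp add: size_distr_def frac_of_size_nonneg size_avg_const)

lemma sum_frac_tail: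
  assumes "n \<le> M" "0 < B"
  shows "(\<Sum>a=1..M. (real a)\<^sup>2 / B * frac_of_size n E a) = susc2 n E / B"
  using size_avg_as_sum[OF assms(1), of E "\<lambda>k. (real k)\<^sup>2"]
  by (simp add: sum_divide_distrib mult.commute)

lemma l1_dist_le:
  assumes "n \<le> M" "m \<le> M" "1 \<le> B" "0 < \<delta>"
  shows "(\<Sum>a=1..M. \<bar>frac_of_size n E a - frac_of_size m E' a\<bar>) \<le>
    smooth_dist B \<delta> n m E E' + (susc2 n E + susc2 m E') / B"
proof -
  define e where "e a = frac_of_size n E a - frac_of_size m E' a" for a
  define s where "s a = sqrt ((e a)\<^sup>2 + \<delta>\<^sup>2)" for a
  have s: "\<bar>e a\<bar> \<le> s a" "0 \<le> s a" for a by (auto simp: s_def intro: real_le_rsqrt)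
  have "(\<Sum>a=1..M. \<bar>e a\<bar>) \<le> (\<Sum>a=1..M. of_bool (a \<le> B) * s a +
      ((real a)\<^sup>2 / B * frac_of_size n E a + (real a)\<^sup>2 / B * frac_of_size m E' a))"
  proof (rule sum_mono)
    fix a
    let ?x = "frac_of_size n E a" and ?y = "frac_of_size m E' a"
    have xy: "0 \<le> ?x" "0 \<le> ?y" by (rule frac_of_size_nonneg)+
    show "\<bar>e a\<bar> \<le> of_bool (a \<le> B) * s a + ((real a)\<^sup>2 / B * ?x + (real a)\<^sup>2 / B * ?y)"
    proof (cases "a \<le> B")
      case True
      have "0 \<le> (real a)\<^sup>2 / B * ?x + (real a)\<^sup>2 / B * ?y" using xy by simp
      then show ?thesis using True s(1)[of a] by simp
    next
      case False
      have "real B * 1 \<le> real a * real a" using False assms(3) by (intro mult_mono) auto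
      then have "1 \<le> (real a)\<^sup>2 / B" using assms(3) by (simp add: power2_eq_square)
      then have "1 * ?x \<le> (real a)\<^sup>2 / B * ?x" "1 * ?y \<le> (real a)\<^sup>2 / B * ?y"
        using xy by (intro mult_right_mono; simp)+
      then show ?thesis using False xy by (simp add: e_def)
    qed
  qed
  also have "\<dots> = (\<Sum>a=1..M. of_bool (a \<le> B) * s a) + (susc2 n E / B + susc2 m E' / B)"
    unfolding sum.distrib
    using sum_frac_tail[OF assms(1), of "real B"] sum_frac_tail[OF assms(2), of "real B"] assms(3) by simp
  also have "(\<Sum>a=1..M. of_bool (a \<le> B) * s a) \<le> (\<Sum>a=1..B. s a)"
  proof -
    have "(\<Sum>a=1..M. of_bool (a \<le> B) * s a) = (\<Sum>a\<in>{1..M} \<inter> {..B}. s a)"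
    proof -
      have "(\<Sum>a=1..M. of_bool (a \<le> B) * s a) = (\<Sum>a=1..M. if a \<in> {..B} then s a else 0)"
        by (intro sum.cong) auto
      then show ?thesis by (simp only: sum.inter_restrict finite_atLeastAtMost)
    qed
    also have "\<dots> \<le> (\<Sum>a=1..B. s a)" using s by (intro sum_mono2) auto
    finally show ?thesis .
  qed
  finally show ?thesis
    by (simp add: e_def s_def smooth_dist_def add_divide_distrib)
qed

text \<open>One joint step of the two independent processes. The first-order term is the difference of the drifts of the
linear statistic with weights \<open>w\<close>, the derivative of the smoothed distance, and is bounded by
\<open>drift_difference\<close>; the second-order term is small because a step moves at most \<open>2B\<close> vertices into or out of
each size class up to \<open>B\<close>. Sizes above \<open>B\<close> are controlled by the second moments.\<close>

lemma coupling_step: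
  fixes B :: nat and K \<delta> :: real
  assumes n: "2 \<le> n" "n \<le> m" and S: "susc n E \<le> K" "susc m E' \<le> K"
    and B: "1 \<le> B" and \<delta>: "0 < \<delta>"
  shows "expect (lazy_step R n (real n / real m) E) (\<lambda>E1. expect (graph_step R m E') (\<lambda>E1'. smooth_dist B \<delta> n m E1 E1')) \<le>
    (1 + 24 * K / m) * smooth_dist B \<delta> n m E E' +
    ((24 * K + 4) * (susc2 n E + susc2 m E') / B + 4 * (real B)\<^sup>2 * \<delta> + 48 * real B * K / real n +
      8 * (real B) ^ 3 / (\<delta> * n)) / m"
proof -
  let ?p = "real n / real m" and ?\<Phi> = "smooth_dist B \<delta> n m E E'"
  have m: "2 \<le> m" using n by simp
  have p: "0 \<le> ?p" "?p \<le> 1" using n by auto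
  define x where "x = frac_of_size n E"
  define y where "y = frac_of_size m E'"
  define e where "e a = x a - y a" for a
  define w where "w a = (if a \<in> {1..B} then e a / sqrt ((e a)\<^sup>2 + \<delta>\<^sup>2) else 0)" for a
  have root: "\<bar>e a\<bar> \<le> sqrt ((e a)\<^sup>2 + \<delta>\<^sup>2)" "0 < sqrt ((e a)\<^sup>2 + \<delta>\<^sup>2)" for a
    using \<delta> by (auto intro: real_le_rsqrt add_nonneg_pos)
  have w1: "\<bar>w a\<bar> \<le> 1" for a using root[of a] by (simp add: w_def abs_divide)
  have w0: "w a = 0" if "a \<notin> {1..B}" for a using that by (auto simp: w_def)
  have W: "size_avg k F w = (\<Sum>a=1..B. frac_of_size k F a * w a)" for k F
    by (rule size_avg_as_partial_sum) (rule w0)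
  define \<Delta> where "\<Delta> k F F' = (\<Sum>a=1..B. (frac_of_size k F' a - frac_of_size k F a)\<^sup>2)" for k F F'
  define f where "f E1 = (size_avg n E1 w - size_avg n E w) + 1 / \<delta> * \<Delta> n E E1" for E1
  define g where "g E1 = - (size_avg m E1 w - size_avg m E' w) + 1 / \<delta> * \<Delta> m E' E1" for E1
  have pointwise: "smooth_dist B \<delta> n m E1 E1' \<le> (?\<Phi> + f E1) + g E1'" for E1 E1'
  proof -
    define h where "h a = (frac_of_size n E1 a - x a) - (frac_of_size m E1' a - y a)" for a
    have "smooth_dist B \<delta> n m E1 E1' = (\<Sum>a=1..B. sqrt ((e a + h a)\<^sup>2 + \<delta>\<^sup>2))"
      unfolding smooth_dist_def by (intro sum.cong) (auto simp: e_def h_def)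
    also have "\<dots> \<le> (\<Sum>a=1..B. (sqrt ((e a)\<^sup>2 + \<delta>\<^sup>2) + w a * h a) +
        (1 / \<delta> * (frac_of_size n E1 a - x a)\<^sup>2 + 1 / \<delta> * (frac_of_size m E1' a - y a)\<^sup>2))"
    proof (rule sum_mono)
      fix a assume a: "a \<in> {1..B}"
      have "(h a)\<^sup>2 \<le> 2 * (frac_of_size n E1 a - x a)\<^sup>2 + 2 * (frac_of_size m E1' a - y a)\<^sup>2"
        using zero_le_power2[of "(frac_of_size n E1 a - x a) + (frac_of_size m E1' a - y a)"]
        unfolding h_def power2_sum power2_diff[of "frac_of_size n E1 a - x a"] by linarith
      then have "(h a)\<^sup>2 / (2 * \<delta>) \<le>
          (2 * (frac_of_size n E1 a - x a)\<^sup>2 + 2 * (frac_of_size m E1' a - y a)\<^sup>2) / (2 * \<delta>)"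
        using \<delta> by (intro divide_right_mono) auto
      also have "\<dots> = 1 / \<delta> * (frac_of_size n E1 a - x a)\<^sup>2 + 1 / \<delta> * (frac_of_size m E1' a - y a)\<^sup>2"
        using \<delta> by (simp add: add_divide_distrib)
      finally show "sqrt ((e a + h a)\<^sup>2 + \<delta>\<^sup>2) \<le> (sqrt ((e a)\<^sup>2 + \<delta>\<^sup>2) + w a * h a) +
          (1 / \<delta> * (frac_of_size n E1 a - x a)\<^sup>2 + 1 / \<delta> * (frac_of_size m E1' a - y a)\<^sup>2)"
        using sqrt_smooth_step[OF \<delta>, of "e a" "h a"] a by (simp add: w_def)
    qed
    also have "\<dots> = (?\<Phi> + f E1) + g E1'"
    proof -
      have "(\<Sum>a=1..B. w a * h a) =
          (size_avg n E1 w - size_avg n E w) - (size_avg m E1' w - size_avg m E' w)"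
        unfolding W
        by (simp add: h_def x_def y_def right_diff_distrib sum_subtractf mult.commute)
      then show ?thesis
        by (simp add: sum.distrib f_def g_def \<Delta>_def x_def y_def e_def smooth_dist_def sum_distrib_left
            sum_divide_distrib)
    qed
    finally show ?thesis .
  qed
  have \<Delta>_le: "\<Delta> k F F' \<le> 4 * (real B) ^ 3 / (real k)\<^sup>2"
    if "2 \<le> k" "F' \<in> set_pmf (graph_step R k F)" for k F F'
  proof -
    have "\<Delta> k F F' \<le> (\<Sum>a=1..B. (2 * real B / k)\<^sup>2)"
      unfolding \<Delta>_def
    proof (rule sum_mono)
      fix a assume "a \<in> {1..B}"
      then have "2 * real a / k \<le> 2 * real B / k" by (intro divide_right_mono) auto
      then have "\<bar>frac_of_size k F' a - frac_of_size k F a\<bar> \<le> \<bar>2 * real B / k\<bar>"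
        using frac_of_size_jump[OF that, of a] by simp
      then show "(frac_of_size k F' a - frac_of_size k F a)\<^sup>2 \<le> (2 * real B / k)\<^sup>2"
        by (simp only: abs_le_square_iff)
    qed
    also have "\<dots> = 4 * (real B) ^ 3 / (real k)\<^sup>2"
      by (simp add: power_divide power2_eq_square power3_eq_cube)
    finally show ?thesis .
  qed
  have E\<Delta>: "expect (graph_step R k F) (\<Delta> k F) \<le> 4 * (real B) ^ 3 / (real k)\<^sup>2" if "2 \<le> k" for k F
    using expect_mono[of "graph_step R k F" "\<Delta> k F" "\<lambda>_. 4 * (real B) ^ 3 / (real k)\<^sup>2"] \<Delta>_le[OF that] that
    by simp
  define A where "A = expect (sel_pmf R n E) (gain n E w)"
  define A' where "A' = expect (sel_pmf R m E') (gain m E' w)"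
  have Ef: "expect (lazy_step R n ?p E) f \<le> A / m + 4 * (real B) ^ 3 / (\<delta> * n * m)"
  proof -
    have "f E = 0" by (simp add: f_def \<Delta>_def)
    then have "expect (lazy_step R n ?p E) f = ?p * expect (graph_step R n E) f"
      using expect_lazy_step[OF n(1) p, of R E f] by simp
    also have "expect (graph_step R n E) f = A / n + 1 / \<delta> * expect (graph_step R n E) (\<Delta> n E)"
      unfolding f_def using n by (simp add: expect_add expect_diff expect_step_size_avg A_def)
    also have "?p * (A / n + 1 / \<delta> * expect (graph_step R n E) (\<Delta> n E)) \<le>
        ?p * (A / n + 1 / \<delta> * (4 * (real B) ^ 3 / (real n)\<^sup>2))"
      using p \<delta> E\<Delta>[OF n(1)] by (intro mult_left_mono add_left_mono) auto
    also have "\<dots> = A / m + 4 * (real B) ^ 3 / (\<delta> * n * m)"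
      using n \<delta> by (simp add: field_simps power2_eq_square)
    finally show ?thesis .
  qed
  have Eg: "expect (graph_step R m E') g \<le> - A' / m + 4 * (real B) ^ 3 / (\<delta> * n * m)"
  proof -
    have "expect (graph_step R m E') g =
        expect (graph_step R m E') (\<lambda>E1. size_avg m E' w - size_avg m E1 w + 1 / \<delta> * \<Delta> m E' E1)"
      by (simp add: g_def[abs_def])
    also have "\<dots> = - A' / m + 1 / \<delta> * expect (graph_step R m E') (\<Delta> m E')"
      using m by (simp add: expect_add expect_diff expect_step_size_avg A'_def)
    also have "\<dots> \<le> - A' / m + 1 / \<delta> * (4 * (real B) ^ 3 / (real m)\<^sup>2)"
      using \<delta> E\<Delta>[OF m] by (intro mult_left_mono add_left_mono) auto
    also have "4 * (real B) ^ 3 / (real m)\<^sup>2 \<le> 4 * (real B) ^ 3 / (real n * real m)"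
      using n by (intro divide_left_mono) (auto simp: power2_eq_square intro!: mult_mono)
    then have "- A' / m + 1 / \<delta> * (4 * (real B) ^ 3 / (real m)\<^sup>2) \<le>
        - A' / m + 1 / \<delta> * (4 * (real B) ^ 3 / (real n * real m))"
      using \<delta> by (intro add_left_mono mult_left_mono) auto
    finally show ?thesis by (simp add: mult.assoc)
  qed
  have "expect (lazy_step R n ?p E) (\<lambda>E1. expect (graph_step R m E') (\<lambda>E1'. smooth_dist B \<delta> n m E1 E1')) \<le>
      expect (lazy_step R n ?p E) (\<lambda>E1. expect (graph_step R m E') (\<lambda>E1'. (?\<Phi> + f E1) + g E1'))"
    using n m pointwise by (intro expect_mono) auto
  also have "\<dots> = ?\<Phi> + expect (lazy_step R n ?p E) f + expect (graph_step R m E') g"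
    using n m by (simp add: expect_add)
  also have "\<dots> \<le> ?\<Phi> + (A / m + 4 * (real B) ^ 3 / (\<delta> * n * m)) +
      (- A' / m + 4 * (real B) ^ 3 / (\<delta> * n * m))"
    using Ef Eg by linarith
  also have "\<dots> = ?\<Phi> + (A - A' + 8 * (real B) ^ 3 / (\<delta> * n)) / m"
    using n \<delta> by (simp add: field_simps)
  also have "A - A' \<le> 24 * K * (?\<Phi> + (susc2 n E + susc2 m E') / B) +
      4 * ((real B)\<^sup>2 * \<delta> + (susc2 n E + susc2 m E') / B) + 48 * real B * K / real n"
  proof -
    have K0: "0 \<le> K" using susc_nonneg[of n E] S by linarith
    have xd: "size_distr m K x" unfolding x_def by (rule size_distr_frac[OF n S(1)])
    have yd: "size_distr m K y" unfolding y_def by (rule size_distr_frac[OF m order.refl S(2)])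
    have wB: "w a = 0" if "B < a" for a using that by (simp add: w_def)
    have "24 * real B * susc n E / real n \<le> 24 * real B * K / real n"
      using S by (intro divide_right_mono mult_left_mono) auto
    moreover have "\<bar>A - quad m (sel_gain R w) x x x x\<bar> \<le> 24 * real B * susc n E / real n"
      unfolding A_def by (rule expect_sel_gain_approx[OF n w1 wB x_def])
    ultimately have a1: "A \<le> quad m (sel_gain R w) x x x x + 24 * real B * K / real n"
      by linarith
    have "24 * real B * susc m E' / real m \<le> 24 * real B * K / real n"
      using S n K0 by (intro frac_le mult_left_mono) auto
    moreover have "\<bar>A' - quad m (sel_gain R w) y y y y\<bar> \<le> 24 * real B * susc m E' / real m"
      unfolding A'_def by (rule expect_sel_gain_approx[OF m order.refl w1 wB y_def])
    ultimately have a2: "quad m (sel_gain R w) y y y y - 24 * real B * K / real n \<le> A'"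
      by linarith
    have a3: "quad m (sel_gain R w) x x x x - quad m (sel_gain R w) y y y y \<le>
        24 * K * (\<Sum>a=1..m. \<bar>e a\<bar>) + 4 * (\<Sum>a=1..m. real a * (\<bar>e a\<bar> - e a * w a))"
      unfolding e_def by (rule drift_difference[OF xd yd w1])
    have "(\<Sum>a=1..m. \<bar>e a\<bar>) \<le> ?\<Phi> + (susc2 n E + susc2 m E') / B"
      unfolding e_def x_def y_def using n(2) order.refl B \<delta> by (rule l1_dist_le)
    then have a4: "24 * K * (\<Sum>a=1..m. \<bar>e a\<bar>) \<le> 24 * K * (?\<Phi> + (susc2 n E + susc2 m E') / B)"
      using K0 by (intro mult_left_mono) auto
    have "(\<Sum>a=1..m. real a * (\<bar>e a\<bar> - e a * w a)) \<le>
        (\<Sum>a=1..m. of_bool (a \<le> B) * (B * \<delta>) + ((real a)\<^sup>2 / B * x a + (real a)\<^sup>2 / B * y a))"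
    proof (rule sum_mono)
      fix a assume a: "a \<in> {1..m}"
      have xy: "0 \<le> x a" "0 \<le> y a" by (auto simp: x_def y_def frac_of_size_nonneg)
      show "real a * (\<bar>e a\<bar> - e a * w a) \<le>
          of_bool (a \<le> B) * (B * \<delta>) + ((real a)\<^sup>2 / B * x a + (real a)\<^sup>2 / B * y a)"
      proof (cases "a \<le> B")
        case True
        define u where "u = sqrt ((e a)\<^sup>2 + \<delta>\<^sup>2)"
        have u: "\<bar>e a\<bar> \<le> u" "0 < u" using root[of a] by (auto simp: u_def)
        have "\<bar>e a\<bar> - e a * w a = \<bar>e a\<bar> / u * (u - \<bar>e a\<bar>)"
        proof -
          have "e a * w a = \<bar>e a\<bar> * \<bar>e a\<bar> / u" using True a by (simp add: w_def u_def)
          then show ?thesis using u by (auto simp: field_simps)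
        qed
        also have "\<dots> \<le> 1 * \<delta>"
        proof (intro mult_mono)
          have "u \<le> \<bar>e a\<bar> + \<delta>"
            unfolding u_def using \<delta> by (intro real_le_lsqrt) (auto simp: power2_sum)
          then show "u - \<bar>e a\<bar> \<le> \<delta>" by simp
        qed (use u in auto)
        finally have "real a * (\<bar>e a\<bar> - e a * w a) \<le> real B * \<delta>"
          using True \<delta> by (intro order.trans[OF mult_left_mono mult_right_mono]) auto
        moreover have "0 \<le> (real a)\<^sup>2 / B * x a + (real a)\<^sup>2 / B * y a" using xy by simp
        ultimately show ?thesis using True by simp
      next
        case False
        have "real a * \<bar>e a\<bar> \<le> (real a)\<^sup>2 / B * (x a + y a)"
        proof (intro mult_mono)
          have "real a * real B \<le> real a * real a" using False by (intro mult_left_mono) auto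
          then show "real a \<le> (real a)\<^sup>2 / B" using B by (simp add: field_simps power2_eq_square)
        qed (use xy in \<open>auto simp: e_def\<close>)
        then show ?thesis using False by (simp add: w_def distrib_left)
      qed
    qed
    also have "\<dots> = (\<Sum>a=1..m. of_bool (a \<le> B) * (B * \<delta>)) + (susc2 n E / B + susc2 m E' / B)"
      unfolding x_def y_def sum.distrib
      using sum_frac_tail[OF n(2), of "real B"] sum_frac_tail[OF order.refl, of "real B" m] B by simp
    also have "(\<Sum>a=1..m. of_bool (a \<le> B) * (B * \<delta>)) \<le> (real B)\<^sup>2 * \<delta>"
    proof -
      have "(\<Sum>a=1..m. of_bool (a \<le> B) * (B * \<delta>)) = (\<Sum>a=1..m. of_bool (a \<le> B)) * (B * \<delta>)"
        by (simp add: sum_distrib_right)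
      also have "(\<Sum>a=1..m. of_bool (a \<le> B) :: real) \<le> B"
      proof -
        have "card ({1..m} \<inter> {a. a \<le> B}) \<le> card {1..B}" by (intro card_mono) auto
        then show ?thesis by simp
      qed
      then have "(\<Sum>a=1..m. of_bool (a \<le> B)) * (B * \<delta>) \<le> B * (B * \<delta>)"
        using \<delta> by (intro mult_right_mono) auto
      finally show ?thesis by (simp add: power2_eq_square)
    qed
    finally have a5: "(\<Sum>a=1..m. real a * (\<bar>e a\<bar> - e a * w a)) \<le>
        (real B)\<^sup>2 * \<delta> + (susc2 n E + susc2 m E') / B"
      by (simp add: add_divide_distrib)
    have "A - A' \<le> u' + 4 * v' + d"
      if "A \<le> q + c" "q' - c \<le> A'" "q - q' \<le> u + 4 * v" "u \<le> u'" "v \<le> v'" "d = 2 * c"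
      for q q' c u u' v v' d :: real
      using that by linarith
    from this[OF a1 a2 a3 a4 a5] show ?thesis by simp
  qed
  then have "?\<Phi> + (A - A' + 8 * (real B) ^ 3 / (\<delta> * n)) / m \<le>
      ?\<Phi> + ((24 * K * (?\<Phi> + (susc2 n E + susc2 m E') / B) +
      4 * ((real B)\<^sup>2 * \<delta> + (susc2 n E + susc2 m E') / B) + 48 * real B * K / real n) + 8 * (real B) ^ 3 / (\<delta> * n)) / m"
    by (intro add_left_mono divide_right_mono add_right_mono) auto
  also have "\<dots> = (1 + 24 * K / m) * ?\<Phi> +
    ((24 * K + 4) * (susc2 n E + susc2 m E') / B + 4 * (real B)\<^sup>2 * \<delta> + 48 * real B * K / real n +
      8 * (real B) ^ 3 / (\<delta> * n)) / m"
    by (simp add: add_divide_distrib distrib_left distrib_right)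
  finally show ?thesis .
qed

lemma smooth_dist_nonneg: "0 \<le> smooth_dist B \<delta> n m E E'"
  unfolding smooth_dist_def by (intro sum_nonneg) simp

lemma susc_lazy_step_mono:
  assumes "2 \<le> n" "E' \<in> set_pmf (lazy_step R n p E)"
  shows "susc n E \<le> susc n E'"
proof -
  have "E' \<in> set_pmf (graph_step R n E) \<or> E' = E"
    using assms(2) by (auto simp: lazy_step_def split: if_splits)
  then show ?thesis using size_avg_step_mono[OF assms(1) mono_real] by auto
qed

text \<open>Iterating \<open>coupling_step\<close>. The events that the two susceptibilities are at most \<open>K\<close> can only be left, so the
indicator is carried along. At time 0 both processes consist of isolated vertices and the distance is \<open>B \<delta>\<close>.\<close>

lemma coupled_distance:
  fixes B :: nat and K \<delta> t :: real
  assumes n: "2 \<le> n" "n \<le> m" and K: "0 \<le> K" and B: "1 \<le> B" and \<delta>: "0 < \<delta>"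
    and j: "real j \<le> t * real m"
  defines "J \<equiv> \<lambda>E E'. susc n E \<le> K \<and> susc m E' \<le> K"
  shows "expect (lazy R n (real n / real m) j) (\<lambda>E. expect (gdist R m j)
      (\<lambda>E'. smooth_dist B \<delta> n m E E' * of_bool (J E E'))) \<le>
    exp (24 * K * t) * (B * \<delta> + t * ((24 * K + 4) * (2 * exp (24 * K * t)) / B + 4 * (real B)\<^sup>2 * \<delta> +
      48 * real B * K / real n + 8 * (real B) ^ 3 / (\<delta> * real n)))"
proof -
  let ?p = "real n / real m"
  have m: "2 \<le> m" using n by simp
  have p: "0 \<le> ?p" "?p \<le> 1" using n by auto
  define P where "P = exp (24 * K * t)"
  define c where "c = (24 * K + 4) / B"
  define d where "d = 4 * (real B)\<^sup>2 * \<delta> + 48 * real B * K / real n + 8 * (real B) ^ 3 / (\<delta> * real n)"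
  define F where "F E E' = smooth_dist B \<delta> n m E E' * of_bool (J E E')" for E E'
  define \<phi> where "\<phi> i = expect (lazy R n ?p i) (\<lambda>E. expect (gdist R m i) (F E))" for i
  define X where "X E = susc2 n E * of_bool (susc n E \<le> K)" for E
  define Y where "Y E = susc2 m E * of_bool (susc m E \<le> K)" for E
  have c0: "0 \<le> c" using K by (simp add: c_def)
  have d0: "0 \<le> d" using K \<delta> by (simp add: d_def)
  have F0: "0 \<le> F E E'" for E E' by (simp add: F_def smooth_dist_nonneg)
  have t0: "0 \<le> t"
  proof (rule ccontr)
    assume "\<not> 0 \<le> t"
    then have "t * real m < 0" using m by (intro mult_neg_pos) auto
    then show False using j by linarith
  qed
  have inner: "expect (lazy_step R n ?p E) (\<lambda>E1. expect (graph_step R m E') (F E1)) \<le>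
      ((1 + 24 * K / m) * F E E' + d / m) + (c / m * X E + c / m * Y E')" for E E'
  proof (cases "J E E'")
    case True
    have "expect (lazy_step R n ?p E) (\<lambda>E1. expect (graph_step R m E') (F E1)) \<le>
        expect (lazy_step R n ?p E) (\<lambda>E1. expect (graph_step R m E') (smooth_dist B \<delta> n m E1))"
      using n m by (intro expect_mono) (auto simp: F_def smooth_dist_nonneg)
    also have "\<dots> \<le> (1 + 24 * K / m) * smooth_dist B \<delta> n m E E' +
      ((24 * K + 4) * (susc2 n E + susc2 m E') / B + 4 * (real B)\<^sup>2 * \<delta> + 48 * real B * K / real n +
      8 * (real B) ^ 3 / (\<delta> * n)) / m"
      by (rule coupling_step[OF n _ _ B \<delta>]) (use True in \<open>auto simp: J_def\<close>)
    also have "\<dots> = ((1 + 24 * K / m) * F E E' + d / m) + (c / m * X E + c / m * Y E')"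
      using True by (simp add: F_def X_def Y_def J_def c_def d_def add_divide_distrib distrib_left distrib_right)
    finally show ?thesis .
  next
    case False
    have "expect (lazy_step R n ?p E) (\<lambda>E1. expect (graph_step R m E') (F E1)) =
        expect (lazy_step R n ?p E) (\<lambda>_. expect (graph_step R m E') (\<lambda>_. 0))"
    proof (intro expect_cong)
      fix E1 E1' assume "E1 \<in> set_pmf (lazy_step R n ?p E)" "E1' \<in> set_pmf (graph_step R m E')"
      then have "susc n E \<le> susc n E1" "susc m E' \<le> susc m E1'"
        using susc_lazy_step_mono[OF n(1)] size_avg_step_mono[OF m mono_real] by blast+
      then show "F E1 E1' = 0" using False by (auto simp: F_def J_def)
    qed
    moreover have "0 \<le> ((1 + 24 * K / m) * F E E' + d / m) + (c / m * X E + c / m * Y E')"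
      using c0 d0 K F0 by (simp add: X_def Y_def susc2_nonneg)
    ultimately show ?thesis by simp
  qed
  have "\<phi> j \<le> exp (24 * K / m * j) * (\<phi> 0 + real j * ((c * (2 * P) + d) / m))"
  proof (rule discrete_gronwall)
    fix i assume i: "i < j"
    have "24 * K / m * i \<le> 24 * K * t"
    proof -
      have "real i \<le> t * real m" using i j by linarith
      then have "real i / m \<le> t" using m by (simp add: field_simps)
      then have "24 * K * (real i / m) \<le> 24 * K * t" using K by (intro mult_left_mono) auto
      then show ?thesis by simp
    qed
    then have eP: "exp (24 * K / m * i) \<le> P" by (simp add: P_def)
    have "\<phi> (Suc i) = expect (lazy R n ?p i) (\<lambda>E. expect (lazy_step R n ?p E)
        (\<lambda>E1. expect (gdist R m i) (\<lambda>E'. expect (graph_step R m E') (F E1))))"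
      unfolding \<phi>_def using n m p by (simp add: lazy_Suc expect_bind)
    also have "\<dots> = expect (lazy R n ?p i) (\<lambda>E. expect (gdist R m i)
        (\<lambda>E'. expect (lazy_step R n ?p E) (\<lambda>E1. expect (graph_step R m E') (F E1))))"
      using n m by (intro expect_cong expect_swap) auto
    also have "\<dots> \<le> expect (lazy R n ?p i) (\<lambda>E. expect (gdist R m i)
        (\<lambda>E'. ((1 + 24 * K / m) * F E E' + d / m) + (c / m * X E + c / m * Y E')))"
      using n m p inner by (intro expect_mono) auto
    also have "\<dots> = (1 + 24 * K / m) * \<phi> i + d / m +
        (c / m * expect (lazy R n ?p i) X + c / m * expect (gdist R m i) Y)"
      using n m p by (simp add: expect_add \<phi>_def)
    also have "c / m * expect (lazy R n ?p i) X \<le> c / m * P"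
      using susc2_bound_lazy[OF n K, of R i] eP c0 unfolding X_def by (intro mult_left_mono) auto
    also have "c / m * expect (gdist R m i) Y \<le> c / m * P"
      using susc2_bound[OF m K, of R i] eP c0 unfolding Y_def by (intro mult_left_mono) auto
    finally show "\<phi> (Suc i) \<le> (1 + 24 * K / m) * \<phi> i + (c * (2 * P) + d) / m"
      by (simp add: add_divide_distrib mult_ac)
  next
    show "0 \<le> \<phi> 0" unfolding \<phi>_def using F0 by (intro expect_nonneg) auto
    show "0 \<le> (c * (2 * P) + d) / m" using c0 d0 by (simp add: P_def)
  qed (use K in simp)
  also have "\<dots> \<le> P * (B * \<delta> + t * (c * (2 * P) + d))"
  proof (rule mult_mono)
    have jm: "real j / m \<le> t" using j m by (simp add: field_simps)
    then have "24 * K * (real j / m) \<le> 24 * K * t" using K by (intro mult_left_mono) auto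
    then show "exp (24 * K / m * j) \<le> P" by (simp add: P_def)
    have "F {} {} \<le> B * \<delta>"
      using n m \<delta> by (simp add: F_def smooth_dist_def size_avg_empty)
    then have "\<phi> 0 \<le> B * \<delta>" using n p by (simp add: \<phi>_def lazy_0)
    moreover have "real j / m * (c * (2 * P) + d) \<le> t * (c * (2 * P) + d)"
      using jm c0 d0 by (intro mult_right_mono) (auto simp: P_def)
    then have "real j * ((c * (2 * P) + d) / m) \<le> t * (c * (2 * P) + d)" by simp
    ultimately show "\<phi> 0 + real j * ((c * (2 * P) + d) / m) \<le> B * \<delta> + t * (c * (2 * P) + d)"
      by (rule add_mono)
    show "0 \<le> \<phi> 0 + real j * ((c * (2 * P) + d) / m)"
      using c0 d0 F0 by (auto simp: \<phi>_def P_def intro!: add_nonneg_nonneg expect_nonneg mult_nonneg_nonneg divide_nonneg_nonneg)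
  qed (simp add: P_def)
  finally show ?thesis unfolding \<phi>_def F_def c_def d_def P_def
    by (simp add: add.assoc)
qed

lemma trunc_susc_diff_le:
  assumes "2 \<le> n" "n \<le> m"
  shows "trunc_susc k n E - trunc_susc k m E' \<le>
    k * (\<Sum>a=1..m. \<bar>frac_of_size n E a - frac_of_size m E' a\<bar>)"
proof -
  have "trunc_susc k n E - trunc_susc k m E' =
      (\<Sum>a=1..m. frac_of_size n E a * real (min a k)) - (\<Sum>a=1..m. frac_of_size m E' a * real (min a k))"
    using size_avg_as_sum[OF assms(2), of E "\<lambda>c. real (min c k)"]
      size_avg_as_sum[OF order.refl, of m E' "\<lambda>c. real (min c k)"] by linarith
  also have "\<dots> = (\<Sum>a=1..m. (frac_of_size n E a - frac_of_size m E' a) * real (min a k))"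
    by (simp only: sum_subtractf[symmetric] left_diff_distrib)
  also have "\<dots> \<le> (\<Sum>a=1..m. \<bar>frac_of_size n E a - frac_of_size m E' a\<bar> * real k)"
    by (intro sum_mono mult_mono) auto
  finally show ?thesis by (simp add: sum_distrib_left mult.commute)
qed

lemma compare_bound:
  fixes B k :: nat and K \<delta> t L P :: real
  assumes n: "2 \<le> n" "n \<le> m" and K: "0 \<le> K" and B: "1 \<le> B" and \<delta>: "0 < \<delta>"
    and j: "real j \<le> t * real m"
  defines "P \<equiv> exp (24 * K * t)"
  shows "pr (lazy R n (real n / real m) j) (\<lambda>E. L + 1 \<le> trunc_susc k n E) *
      pr (gdist R m j) (\<lambda>E'. trunc_susc k m E' < L) \<le>
    k * (P * (B * \<delta> + t * ((24 * K + 4) * (2 * P) / B + 4 * (real B)\<^sup>2 * \<delta> +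
      48 * real B * K / real n + 8 * (real B) ^ 3 / (\<delta> * real n)))) + k * (2 * P) / B +
    (pr (lazy R n (real n / real m) j) (\<lambda>E. K < susc n E) + pr (gdist R m j) (\<lambda>E'. K < susc m E'))"
proof -
  let ?p = "real n / real m"
  let ?l = "lazy R n ?p j" and ?g = "gdist R m j"
  have m: "2 \<le> m" using n by simp
  have p: "0 \<le> ?p" "?p \<le> 1" using n by auto
  define F where "F E E' = smooth_dist B \<delta> n m E E' * of_bool (susc n E \<le> K \<and> susc m E' \<le> K)" for E E'
  define X where "X E = susc2 n E * of_bool (susc n E \<le> K)" for E
  define Y where "Y E = susc2 m E * of_bool (susc m E \<le> K)" for E
  have F0: "0 \<le> F E E'" for E E' by (simp add: F_def smooth_dist_nonneg)
  have XY0: "0 \<le> X E" "0 \<le> Y E" for E by (auto simp: X_def Y_def susc2_nonneg)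
  have point: "of_bool (L + 1 \<le> trunc_susc k n E) * of_bool (trunc_susc k m E' < L) \<le>
      (k * F E E' + (k / B * X E + k / B * Y E')) + (of_bool (K < susc n E) + of_bool (K < susc m E'))" for E E'
  proof (cases "susc n E \<le> K \<and> susc m E' \<le> K")
    case True
    have "trunc_susc k n E - trunc_susc k m E' \<le> k * (smooth_dist B \<delta> n m E E' + (susc2 n E + susc2 m E') / B)"
      by (rule order.trans[OF trunc_susc_diff_le[OF n]])
        (intro mult_left_mono l1_dist_le n order.refl B \<delta> of_nat_0_le_iff)
    also have "\<dots> = k * F E E' + (k / B * X E + k / B * Y E')"
      using True by (simp add: F_def X_def Y_def distrib_left add_divide_distrib)
    finally show ?thesis using True F0[of E E'] XY0[of E] XY0[of E'] by (auto simp: of_bool_def)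
  next
    case False
    have "0 \<le> k * F E E' + (k / B * X E + k / B * Y E')" using F0 XY0 by simp
    then show ?thesis using False by (auto simp: of_bool_def)
  qed
  have "pr ?l (\<lambda>E. L + 1 \<le> trunc_susc k n E) * pr ?g (\<lambda>E'. trunc_susc k m E' < L) =
      expect ?l (\<lambda>E. expect ?g (\<lambda>E'. of_bool (L + 1 \<le> trunc_susc k n E) * of_bool (trunc_susc k m E' < L)))"
    by simp
  also have "\<dots> \<le> expect ?l (\<lambda>E. expect ?g (\<lambda>E'. (k * F E E' + (k / B * X E + k / B * Y E')) +
      (of_bool (K < susc n E) + of_bool (K < susc m E'))))"
    using n m p point by (intro expect_mono) auto
  also have "\<dots> = (k * expect ?l (\<lambda>E. expect ?g (F E)) + (k / B * expect ?l X + k / B * expect ?g Y)) +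
      (pr ?l (\<lambda>E. K < susc n E) + pr ?g (\<lambda>E'. K < susc m E'))"
    using n m p by (simp add: expect_add)
  also have "k * expect ?l (\<lambda>E. expect ?g (F E)) \<le>
      k * (P * (B * \<delta> + t * ((24 * K + 4) * (2 * P) / B + 4 * (real B)\<^sup>2 * \<delta> +
      48 * real B * K / real n + 8 * (real B) ^ 3 / (\<delta> * real n))))"
    unfolding F_def P_def by (intro mult_left_mono coupled_distance[OF n K B \<delta> j]) simp
  also have "k / B * expect ?l X + k / B * expect ?g Y \<le> k / B * P + k / B * P"
  proof -
    have "24 * K / m * j \<le> 24 * K * t"
    proof -
      have "real j / m \<le> t" using j m by (simp add: field_simps)
      then have "24 * K * (real j / m) \<le> 24 * K * t" using K by (intro mult_left_mono) auto
      then show ?thesis by simp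
    qed
    then have eP: "exp (24 * K / m * j) \<le> P" by (simp add: P_def)
    have "expect ?l X \<le> P" using susc2_bound_lazy[OF n K, of R j] eP unfolding X_def by linarith
    moreover have "expect ?g Y \<le> P" using susc2_bound[OF m K, of R j] eP unfolding Y_def by linarith
    ultimately show ?thesis by (intro add_mono mult_left_mono) auto
  qed
  also have "k / B * P + k / B * P = k * (2 * P) / B" by simp
  finally show ?thesis by simp
qed

text \<open>With high probability, the truncated susceptibilities of two independent processes at the same time differ by
less than 1 while both susceptibilities are bounded. As the processes are independent, the probability that one is above \<open>L + 1\<close> and the other below
\<open>L\<close> is a product. The errors are made small by choosing \<open>B\<close>, then \<open>\<delta>\<close>, then \<open>n\<close>.\<close>

lemma compare_processes:
  fixes k :: nat and K t L \<epsilon> :: real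
  assumes K: "0 \<le> K" and t: "0 \<le> t" and \<epsilon>: "0 < \<epsilon>"
  shows "\<exists>n0\<ge>2. \<forall>n\<ge>n0. \<forall>m\<ge>n. \<forall>j. real j \<le> t * real m \<longrightarrow>
    pr (lazy R n (real n / real m) j) (\<lambda>E. L + 1 \<le> trunc_susc k n E) *
      pr (gdist R m j) (\<lambda>E'. trunc_susc k m E' < L) \<le>
    \<epsilon> + (pr (lazy R n (real n / real m) j) (\<lambda>E. K < susc n E) + pr (gdist R m j) (\<lambda>E'. K < susc m E'))"
proof -
  define P where "P = exp (24 * K * t)"
  have P: "0 < P" by (simp add: P_def)
  define c1 where "c1 = k * (P * t * (24 * K + 4) * (2 * P) + 2 * P)"
  have c1: "0 \<le> c1" using P t K by (simp add: c1_def)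
  define B where "B = nat \<lceil>3 * c1 / \<epsilon>\<rceil> + 1"
  have B: "1 \<le> B" by (simp add: B_def)
  have B3: "c1 / B \<le> \<epsilon> / 3"
  proof -
    have "3 * c1 / \<epsilon> \<le> B" unfolding B_def using real_nat_ceiling_ge[of "3 * c1 / \<epsilon>"] by simp
    then show ?thesis using \<epsilon> B by (simp add: field_simps)
  qed
  define c2 where "c2 = k * P * (B + 4 * t * (real B)\<^sup>2)"
  have c2: "0 \<le> c2" using P t by (simp add: c2_def)
  define \<delta> where "\<delta> = \<epsilon> / (3 * (c2 + 1))"
  have \<delta>: "0 < \<delta>" using \<epsilon> c2 by (simp add: \<delta>_def)
  have \<delta>3: "\<delta> * c2 \<le> \<epsilon> / 3" using \<epsilon> c2 by (simp add: \<delta>_def field_simps)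
  define c3 where "c3 = k * P * t * (48 * real B * K + 8 * (real B) ^ 3 / \<delta>)"
  define n0 where "n0 = nat \<lceil>3 * c3 / \<epsilon>\<rceil> + 2"
  show ?thesis
  proof (intro exI[of _ n0] conjI allI impI)
    show "2 \<le> n0" by (simp add: n0_def)
    fix n m j assume n: "n0 \<le> n" "n \<le> m" and j: "real j \<le> t * real m"
    have n2: "2 \<le> n" using n by (simp add: n0_def)
    have n3: "c3 / n \<le> \<epsilon> / 3"
    proof -
      have "3 * c3 / \<epsilon> \<le> n0" unfolding n0_def using real_nat_ceiling_ge[of "3 * c3 / \<epsilon>"] by simp
      then have "3 * c3 / \<epsilon> \<le> n" using n by linarith
      then show ?thesis using \<epsilon> n2 by (simp add: field_simps)
    qed
    have "k * (P * (B * \<delta> + t * ((24 * K + 4) * (2 * P) / B + 4 * (real B)\<^sup>2 * \<delta> +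
        48 * real B * K / real n + 8 * (real B) ^ 3 / (\<delta> * real n)))) + k * (2 * P) / B =
        c1 / B + \<delta> * c2 + c3 / n"
      unfolding c1_def c2_def c3_def using B \<delta> n2 by (simp add: field_simps)
    then have "k * (P * (B * \<delta> + t * ((24 * K + 4) * (2 * P) / B + 4 * (real B)\<^sup>2 * \<delta> +
        48 * real B * K / real n + 8 * (real B) ^ 3 / (\<delta> * real n)))) + k * (2 * P) / B \<le> \<epsilon>"
      using B3 \<delta>3 n3 by linarith
    then show "pr (lazy R n (real n / real m) j) (\<lambda>E. L + 1 \<le> trunc_susc k n E) *
        pr (gdist R m j) (\<lambda>E'. trunc_susc k m E' < L) \<le>
      \<epsilon> + (pr (lazy R n (real n / real m) j) (\<lambda>E. K < susc n E) + pr (gdist R m j) (\<lambda>E'. K < susc m E'))"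
      using compare_bound[OF n2 n(2) K B \<delta> j, of R L k, folded P_def] by linarith
  qed
qed

section \<open>The number of steps of the lazy process\<close>

lemma expect_binomial_Suc:
  assumes "0 \<le> p" "p \<le> 1"
  shows "expect (binomial_pmf (Suc j) p) F =
    p * expect (binomial_pmf j p) (\<lambda>k. F (Suc k)) + (1 - p) * expect (binomial_pmf j p) F"
proof -
  have "expect (binomial_pmf (Suc j) p) F = expect (bernoulli_pmf p)
      (\<lambda>b. expect (binomial_pmf j p) (\<lambda>k. F ((if b then 1 else 0) + k)))"
    using assms
    by (simp add: binomial_pmf_Suc expect_bind finite_set_pmf_binomial_pmf finite_subset[OF subset_UNIV])
  then show ?thesis using assms by (simp add: mult.commute)
qed

lemma binomial_moments:
  assumes p: "0 \<le> p" "p \<le> 1"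
  shows "expect (binomial_pmf j p) real = j * p"
    and "expect (binomial_pmf j p) (\<lambda>i. (real i - j * p)\<^sup>2) = j * p * (1 - p)"
proof -
  have fin: "finite (set_pmf (binomial_pmf j p))" for j using p by (intro finite_set_pmf_binomial_pmf) auto
  show mean: "expect (binomial_pmf j p) real = j * p" for j
  proof (induction j)
    case (Suc j)
    have "expect (binomial_pmf j p) (\<lambda>k. 1 + real k) = 1 + j * p"
      using Suc fin by (simp add: expect_add)
    then show ?case unfolding expect_binomial_Suc[OF p] using Suc by (simp add: algebra_simps)
  qed (use p in \<open>simp add: binomial_pmf_0\<close>)
  show "expect (binomial_pmf j p) (\<lambda>i. (real i - j * p)\<^sup>2) = j * p * (1 - p)"
  proof (induction j)
    case (Suc j)
    have shift: "expect (binomial_pmf j p) (\<lambda>i. (real i - j * p + c)\<^sup>2) = j * p * (1 - p) + c\<^sup>2" for c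
    proof -
      have "expect (binomial_pmf j p) (\<lambda>i. (real i - j * p + c)\<^sup>2) =
          expect (binomial_pmf j p) (\<lambda>i. (real i - j * p)\<^sup>2 + (2 * c * real i + (c\<^sup>2 - 2 * c * (j * p))))"
        by (intro expect_cong) (simp add: power2_eq_square algebra_simps)
      also have "\<dots> = expect (binomial_pmf j p) (\<lambda>i. (real i - j * p)\<^sup>2) +
          (2 * c * expect (binomial_pmf j p) real + (c\<^sup>2 - 2 * c * (j * p)))"
        using fin by (simp add: expect_add)
      finally show ?thesis using Suc mean by simp
    qed
    have "(\<lambda>k. (real (Suc k) - Suc j * p)\<^sup>2) = (\<lambda>k. (real k - j * p + (1 - p))\<^sup>2)"
      "(\<lambda>k. (real k - Suc j * p)\<^sup>2) = (\<lambda>k. (real k - j * p + (- p))\<^sup>2)"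
      by (auto simp: algebra_simps)
    then show ?case unfolding expect_binomial_Suc[OF p]
      by (simp only: shift) (simp add: power2_eq_square algebra_simps)
  qed (use p in \<open>simp add: binomial_pmf_0\<close>)
qed

lemma binomial_chebyshev:
  assumes p: "0 \<le> p" "p \<le> 1" and d: "0 < d" and P: "\<And>i. P i \<Longrightarrow> d \<le> \<bar>real i - j * p\<bar>"
  shows "pr (binomial_pmf j p) P \<le> j * p / d\<^sup>2"
proof -
  have "pr (binomial_pmf j p) P \<le> expect (binomial_pmf j p) (\<lambda>i. (real i - j * p)\<^sup>2) / d\<^sup>2"
  proof (rule pr_markov)
    fix i assume "P i"
    then have "\<bar>d\<bar> \<le> \<bar>real i - j * p\<bar>" using P d by simp
    then show "d\<^sup>2 \<le> (real i - j * p)\<^sup>2" by (simp only: abs_le_square_iff)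
  qed (use p d finite_set_pmf_binomial_pmf in auto)
  also have "\<dots> \<le> j * p * 1 / d\<^sup>2"
    unfolding binomial_moments(2)[OF p] using p by (intro divide_right_mono mult_left_mono) auto
  finally show ?thesis by simp
qed

lemma pr_lazy: "2 \<le> n \<Longrightarrow> 0 \<le> p \<Longrightarrow> p \<le> 1 \<Longrightarrow>
    pr (lazy R n p j) P = expect (binomial_pmf j p) (\<lambda>i. pr (gdist R n i) P)"
  by (simp add: lazy_def expect_bind finite_set_pmf_binomial_pmf)

text \<open>The number of steps made by the lazy process concentrates around its mean, and a persistent property is at least
as likely after more steps.\<close>

lemma pr_lazy_ge:
  assumes n: "2 \<le> n" and p: "0 \<le> p" "p \<le> 1" and d: "0 < d" "i0 + d \<le> j * p"
    and P: "\<And>E E'. P E \<Longrightarrow> E' \<in> set_pmf (graph_step R n E) \<Longrightarrow> P E'"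
  shows "(1 - j * p / d\<^sup>2) * pr (gdist R n i0) P \<le> pr (lazy R n p j) P"
proof -
  let ?b = "binomial_pmf j p"
  have fin: "finite (set_pmf ?b)" using p by (intro finite_set_pmf_binomial_pmf) auto
  have "pr ?b (\<lambda>i. i < i0) \<le> j * p / d\<^sup>2"
    using p d(1) by (rule binomial_chebyshev) (use d in auto)
  then have "1 - j * p / d\<^sup>2 \<le> pr ?b (\<lambda>i. \<not> i < i0)" using fin by (simp add: pr_not)
  then have "(1 - j * p / d\<^sup>2) * pr (gdist R n i0) P \<le> pr ?b (\<lambda>i. \<not> i < i0) * pr (gdist R n i0) P"
    using pr_nonneg by (intro mult_right_mono)
  also have "\<dots> = expect ?b (\<lambda>i. of_bool (\<not> i < i0) * pr (gdist R n i0) P)" by simp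
  also have "\<dots> \<le> expect ?b (\<lambda>i. pr (gdist R n i) P)"
  proof (rule expect_mono[OF fin])
    fix i
    show "of_bool (\<not> i < i0) * pr (gdist R n i0) P \<le> pr (gdist R n i) P"
      using dist_from_persist[where ?E0.0 = "{}" and i = i0 and j = i, OF n _ P] pr_nonneg
      by (cases "i < i0") auto
  qed
  finally show ?thesis using n p by (simp add: pr_lazy)
qed

lemma pr_lazy_le:
  assumes n: "2 \<le> n" and p: "0 \<le> p" "p \<le> 1" and d: "0 < d" "j * p + d \<le> i1"
    and P: "\<And>E E'. P E \<Longrightarrow> E' \<in> set_pmf (graph_step R n E) \<Longrightarrow> P E'"
  shows "pr (lazy R n p j) P \<le> pr (gdist R n i1) P + j * p / d\<^sup>2"
proof -
  let ?b = "binomial_pmf j p"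
  have fin: "finite (set_pmf ?b)" using p by (intro finite_set_pmf_binomial_pmf) auto
  have "pr (lazy R n p j) P = expect ?b (\<lambda>i. pr (gdist R n i) P)" using n p by (simp add: pr_lazy)
  also have "\<dots> \<le> expect ?b (\<lambda>i. pr (gdist R n i1) P + of_bool (i1 < i))"
  proof (rule expect_mono[OF fin])
    fix i
    show "pr (gdist R n i) P \<le> pr (gdist R n i1) P + of_bool (i1 < i)"
    proof (cases "i1 < i")
      case True
      then have "(of_bool (i1 < i) :: real) = 1" by simp
      then show ?thesis using pr_le_1[OF finite_dist_from[OF n], of R "{}" i P]
          pr_nonneg[of "gdist R n i1" P] by linarith
    next
      case False
      then show ?thesis using dist_from_persist[where ?E0.0 = "{}" and i = i and j = i1, OF n _ P] by auto
    qed
  qed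
  also have "\<dots> = pr (gdist R n i1) P + pr ?b (\<lambda>i. i1 < i)" using fin by (simp add: expect_add)
  also have "pr ?b (\<lambda>i. i1 < i) \<le> j * p / d\<^sup>2"
    using p d(1) by (rule binomial_chebyshev) (use d in auto)
  finally show ?thesis by simp
qed

section \<open>The blow-up of the truncated susceptibility\<close>

definition susc_tight :: "size_rule \<Rightarrow> real \<Rightarrow> bool" where
  "susc_tight R t \<longleftrightarrow> (\<forall>\<epsilon>>0. \<exists>K. \<forall>\<^sub>F n in sequentially.
     pr (gdist R n (time_index t n)) (\<lambda>E. K < susc n E) \<le> \<epsilon>)"

lemma bounded_in_prob_iff:
  "bounded_in_prob choices (\<lambda>n \<omega>. susceptibility n (graph_at R n t \<omega>)) \<longleftrightarrow> susc_tight R t"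
proof -
  have "\<P>(\<omega> in choices n. K < \<bar>susceptibility n (graph_at R n t \<omega>)\<bar>) =
      pr (gdist R n (time_index t n)) (\<lambda>E. K < susc n E)" for n K
    using prob_graph[where n = n and R = R and i = "time_index t n" and P = "\<lambda>E. K < \<bar>susceptibility n E\<bar>"]
    by (simp add: graph_at_def time_index_def susceptibility_eq susc_nonneg)
  then show ?thesis by (simp add: bounded_in_prob_def susc_tight_def)
qed

lemma susc_persist:
  assumes "2 \<le> n" "s \<le> t"
  shows "pr (gdist R n (time_index s n)) (\<lambda>E. K < susc n E) \<le>
    pr (gdist R n (time_index t n)) (\<lambda>E. K < susc n E)"
  by (rule dist_from_persist[OF assms(1) time_index_mono[OF assms(2)]])
    (use size_avg_step_mono[OF assms(1) mono_real] in \<open>blast intro: less_le_trans\<close>)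

lemma susc_tight_mono:
  assumes "susc_tight R t" "s \<le> t"
  shows "susc_tight R s"
  unfolding susc_tight_def
proof (intro allI impI)
  fix \<epsilon> :: real assume "0 < \<epsilon>"
  then obtain K where K: "\<forall>\<^sub>F n in sequentially. pr (gdist R n (time_index t n)) (\<lambda>E. K < susc n E) \<le> \<epsilon>"
    using assms(1) unfolding susc_tight_def by blast
  have "\<forall>\<^sub>F n in sequentially. pr (gdist R n (time_index s n)) (\<lambda>E. K < susc n E) \<le> \<epsilon>"
    using K eventually_ge_at_top[of 2]
    by eventually_elim (use susc_persist[OF _ assms(2)] order.trans in blast)
  then show "\<exists>K. \<forall>\<^sub>F n in sequentially. pr (gdist R n (time_index s n)) (\<lambda>E. K < susc n E) \<le> \<epsilon>" ..
qed

lemma susc_tight_le_2: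
  assumes "susc_tight R t"
  shows "t \<le> 2"
proof (rule ccontr)
  assume t: "\<not> t \<le> 2"
  have "(0::real) < 1 / 4" by simp
  then obtain K where K: "\<forall>\<^sub>F n in sequentially. pr (gdist R n (time_index t n)) (\<lambda>E. K < susc n E) \<le> 1 / 4"
    using assms unfolding susc_tight_def by blast
  define L where "L = max K 0"
  have "(\<lambda>n. 1 / real n) \<longlonglongrightarrow> 0" by (rule lim_const_over_n)
  then have "\<forall>\<^sub>F n in sequentially. 1 / real n < t - 2" by (rule order_tendstoD) (use t in simp)
  moreover have "(\<lambda>n. 4 * L / real n) \<longlonglongrightarrow> 0" by (rule lim_const_over_n)
  then have "\<forall>\<^sub>F n in sequentially. 4 * L / real n < 1 / 4" by (rule order_tendstoD) simp
  ultimately have "\<forall>\<^sub>F n in sequentially. False"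
    using K eventually_ge_at_top[of 2]
  proof eventually_elim
    case (elim n)
    have n: "2 \<le> n" "0 < real n" using elim by auto
    let ?p = "pr (gdist R n (time_index t n)) (\<lambda>E. susc n E \<le> L)"
    have "pr (gdist R n (time_index t n)) (\<lambda>E. \<not> susc n E \<le> L) \<le>
        pr (gdist R n (time_index t n)) (\<lambda>E. K < susc n E)"
      using n(1) by (intro pr_mono) (auto simp: L_def)
    then have p: "3 / 4 \<le> ?p" using elim n(1) by (simp add: pr_not)
    have "2 \<le> time_index t n / n"
    proof -
      have "1 \<le> (t - 2) * n" using elim n by (simp add: field_simps)
      then have "2 * real n \<le> time_index t n"
        using time_index_bounds(1)[of t n] t by (simp add: left_diff_distrib)
      then show ?thesis using n by (simp add: field_simps)
    qed
    then have "2 * (3 / 4) \<le> time_index t n / n * (1 - 4 * L / n)"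
      using elim by (intro mult_mono) auto
    then have "3 / 4 * (2 * (3 / 4)) \<le> ?p * (time_index t n / n * (1 - 4 * L / n))"
      by (rule mult_mono[OF p]) (simp_all add: pr_nonneg)
    moreover have "4 * L \<le> n" using elim n by (simp add: field_simps)
    then have "?p * (time_index t n / n * (1 - 4 * L / n)) \<le> 1"
      using n by (intro susc_bounded_time) (auto simp: L_def)
    ultimately have "3 / 4 * (2 * (3 / 4)) \<le> (1 :: real)" by (rule order.trans)
    then show False by simp
  qed
  then show False by simp
qed

lemma exp_time_le:
  assumes "0 \<le> K" "0 \<le> t" "2 \<le> n"
  shows "exp (24 * K / n * time_index t n) \<le> exp (24 * K * t)"
proof -
  have "time_index t n / n \<le> t" using time_index_bounds(2)[OF assms(2), of n] assms by (simp add: field_simps)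
  then have "24 * K * (time_index t n / n) \<le> 24 * K * t" using assms by (intro mult_left_mono) auto
  then show ?thesis by simp
qed

text \<open>Markov's inequality for the second moment on the event that the susceptibility is bounded.\<close>

lemma susc2_tight:
  assumes "susc_tight R t" "0 \<le> t" "0 < \<epsilon>"
  shows "\<exists>A>0. \<forall>\<^sub>F n in sequentially. pr (gdist R n (time_index t n)) (\<lambda>E. A < susc2 n E) \<le> \<epsilon>"
proof -
  obtain K0 where K0: "\<forall>\<^sub>F n in sequentially. pr (gdist R n (time_index t n)) (\<lambda>E. K0 < susc n E) \<le> \<epsilon> / 2"
    using assms(1)[unfolded susc_tight_def] assms(3) half_gt_zero by blast
  define K where "K = max K0 0"
  define A where "A = exp (24 * K * t) * 2 / \<epsilon>"
  have A: "0 < A" using assms by (simp add: A_def)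
  have "\<forall>\<^sub>F n in sequentially. pr (gdist R n (time_index t n)) (\<lambda>E. A < susc2 n E) \<le> \<epsilon>"
    using K0 eventually_ge_at_top[of 2]
  proof eventually_elim
    case (elim n)
    let ?g = "gdist R n (time_index t n)" and ?X = "\<lambda>E. susc2 n E * of_bool (susc n E \<le> K)"
    have fin: "finite (set_pmf ?g)" using elim by simp
    have "pr ?g (\<lambda>E. A < susc2 n E) \<le> pr ?g (\<lambda>E. A \<le> ?X E) + pr ?g (\<lambda>E. K0 < susc n E)"
      using fin by (rule pr_Un) (auto simp: K_def)
    also have "pr ?g (\<lambda>E. A \<le> ?X E) \<le> expect ?g ?X / A"
      using fin A by (intro pr_markov) (auto simp: susc2_nonneg)
    also have "\<dots> \<le> exp (24 * K * t) / A"
      by (intro divide_right_mono order.trans[OF susc2_bound exp_time_le] elim(2) assms(2) less_imp_le[OF A])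
        (simp_all add: K_def)
    also have "\<dots> = \<epsilon> / 2" using assms by (simp add: A_def)
    finally show ?case using elim(1) by linarith
  qed
  then show ?thesis using A by blast
qed

text \<open>A bound \<open>M\<close> that holds with probability tending to 1 survives a further time \<open>1/(128M)\<close> as tightness. Mere
tightness would not do, because the extra time must not depend on the error probability.\<close>

lemma susc_tight_extend:
  assumes tight: "susc_tight R t" and t: "0 \<le> t" and M: "0 < M"
    and lim: "(\<lambda>n. pr (gdist R n (time_index t n)) (\<lambda>E. M < susc n E)) \<longlonglongrightarrow> 0"
  shows "susc_tight R (t + 1 / (128 * M))"
  unfolding susc_tight_def
proof (intro allI impI exI)
  fix \<epsilon> :: real assume \<epsilon>: "0 < \<epsilon>"
  then have \<epsilon>4: "0 < \<epsilon> / 4" by simp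
  let ?s = "t + 1 / (128 * M)"
  obtain A where A: "0 < A"
    "\<forall>\<^sub>F n in sequentially. pr (gdist R n (time_index t n)) (\<lambda>E. A < susc2 n E) \<le> \<epsilon> / 4"
    using susc2_tight[OF tight t \<epsilon>4] by blast
  define A' where "A' = 12 * A / \<epsilon>"
  have A': "0 < A'" using A \<epsilon> by (simp add: A'_def)
  define C where "C = (32 * A'\<^sup>2 + 2048 * M ^ 4) * 4 / M\<^sup>2 * (1 / (64 * M))"
  have "(\<lambda>n. C / real n) \<longlonglongrightarrow> 0" by (rule lim_const_over_n)
  then have "\<forall>\<^sub>F n in sequentially. C / real n < \<epsilon> / 4" using \<epsilon>4 by (rule order_tendstoD)
  moreover have "\<forall>\<^sub>F n in sequentially. pr (gdist R n (time_index t n)) (\<lambda>E. M < susc n E) < \<epsilon> / 4"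
    using lim \<epsilon>4 by (rule order_tendstoD)
  moreover have "\<forall>\<^sub>F n in sequentially. time_index t n \<le> time_index ?s n \<and>
      1 / (128 * M) / 2 \<le> (real (time_index ?s n) - real (time_index t n)) / n \<and>
      (real (time_index ?s n) - real (time_index t n)) / n \<le> 2 * (1 / (128 * M))"
    by (rule time_index_diff[OF t]) (use M in simp)
  ultimately show "\<forall>\<^sub>F n in sequentially. pr (gdist R n (time_index ?s n)) (\<lambda>E. 2 * M < susc n E) \<le> \<epsilon>"
    using A(2) eventually_ge_at_top[of 2]
  proof eventually_elim
    case (elim n)
    define j where "j = time_index ?s n - time_index t n"
    have s: "time_index ?s n = time_index t n + j" using elim(3) by (simp add: j_def)
    have "real j / n \<le> 1 / (64 * M)" using elim(3) by (simp add: s)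
    then have "real j \<le> n / (64 * M)" using elim(5) by (simp add: field_simps)
    from susc_forward[OF elim(5) M A(1) A' this, of R "time_index t n"]
    have "pr (gdist R n (time_index ?s n)) (\<lambda>E. 2 * M < susc n E) \<le>
        pr (gdist R n (time_index t n)) (\<lambda>E. M < susc n E) +
        pr (gdist R n (time_index t n)) (\<lambda>E. A < susc2 n E) + 3 * A / A' + C / n"
      unfolding s C_def .
    moreover have "3 * A / A' = \<epsilon> / 4" using A \<epsilon> by (simp add: A'_def)
    ultimately show ?case using elim(1,2,4) by linarith
  qed
qed

lemma eventually_binomial_error:
  fixes d t \<epsilon> :: real
  assumes "0 < d" "0 < \<epsilon>"
  shows "\<forall>\<^sub>F n in sequentially. 1 < d / 2 * real n \<and> t * real n / (d / 2 * real n)\<^sup>2 < \<epsilon>"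
proof -
  have "(\<lambda>n. 1 / real n) \<longlonglongrightarrow> 0" by (rule lim_const_over_n)
  then have "\<forall>\<^sub>F n in sequentially. 1 / real n < d / 2" by (rule order_tendstoD) (use assms in simp)
  moreover have "(\<lambda>n. t * 4 / d\<^sup>2 / real n) \<longlonglongrightarrow> 0" by (rule lim_const_over_n)
  then have "\<forall>\<^sub>F n in sequentially. t * 4 / d\<^sup>2 / real n < \<epsilon>" using assms(2) by (rule order_tendstoD)
  ultimately show ?thesis using eventually_gt_at_top[of 0]
  proof eventually_elim
    case (elim n)
    have "t * real n / (d / 2 * real n)\<^sup>2 = t * 4 / d\<^sup>2 / real n"
      using elim assms by (simp add: power2_eq_square field_simps)
    then show ?case using elim by (simp add: field_simps)
  qed
qed

text \<open>Suppose that for infinitely many \<open>m\<close> the truncated susceptibility at time \<open>tb\<close> is below \<open>L\<close> with probability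
at least \<open>\<gamma>\<close>. By monotonicity the same holds before \<open>tb\<close>. A process on any number \<open>n\<close> of vertices that is above
\<open>L + 1\<close> with probability \<open>q\<close> disagrees with an independent one of such a size \<open>m\<close> with probability at least
\<open>q\<gamma>/2\<close>, so \<open>q\<close> must be small. Thus a failure along a subsequence, with a possibly tiny probability, becomes a
statement about all large \<open>n\<close> with high probability. The times \<open>t < t' < t''\<close> leave room for the fluctuations
of the number of lazy steps.\<close>

lemma trunc_susc_upper_whp:
  assumes t: "0 \<le> t" "t < t'" "t' < t''" "t'' \<le> tb" and tight: "susc_tight R t''"
    and L: "\<not> (\<lambda>n. pr (gdist R n (time_index tb n)) (\<lambda>E. trunc_susc k n E < L)) \<longlonglongrightarrow> 0"
  shows "(\<lambda>n. pr (gdist R n (time_index t n)) (\<lambda>E. L + 1 \<le> trunc_susc k n E)) \<longlonglongrightarrow> 0"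
proof (rule pr_tendsto_0I)
  fix \<epsilon> :: real assume \<epsilon>: "0 < \<epsilon>"
  let ?low = "\<lambda>m. pr (gdist R m (time_index tb m)) (\<lambda>E. trunc_susc k m E < L)"
  have "\<exists>\<gamma>>0. \<not> (\<forall>\<^sub>F m in sequentially. ?low m < \<gamma>)"
  proof (rule ccontr)
    assume H: "\<not> (\<exists>\<gamma>>0. \<not> (\<forall>\<^sub>F m in sequentially. ?low m < \<gamma>))"
    have "?low \<longlonglongrightarrow> 0" by (rule pr_tendsto_0I) (use H in simp)
    with L show False by (rule notE)
  qed
  then obtain \<gamma> where \<gamma>0: "0 < \<gamma>" and "\<not> (\<forall>\<^sub>F m in sequentially. ?low m < \<gamma>)"
    by (elim exE conjE)
  then have "\<exists>\<^sub>F m in sequentially. \<gamma> \<le> ?low m" by (simp only: not_eventually not_less)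
  note \<gamma> = \<gamma>0 this
  define \<epsilon>2 where "\<epsilon>2 = \<gamma> * \<epsilon> / 16"
  have \<epsilon>2: "0 < \<epsilon>2" using \<gamma> \<epsilon> by (simp add: \<epsilon>2_def)
  obtain K0 where K0: "\<forall>\<^sub>F n in sequentially. pr (gdist R n (time_index t'' n)) (\<lambda>E. K0 < susc n E) \<le> \<epsilon>2"
    using tight[unfolded susc_tight_def] \<epsilon>2 by blast
  define K where "K = max K0 0"
  have K: "0 \<le> K" by (simp add: K_def)
  have KK: "\<forall>\<^sub>F n in sequentially. pr (gdist R n (time_index t'' n)) (\<lambda>E. K < susc n E) \<le> \<epsilon>2"
    using K0 eventually_ge_at_top[of 2]
  proof eventually_elim
    case (elim n)
    have "pr (gdist R n (time_index t'' n)) (\<lambda>E. K < susc n E) \<le>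
        pr (gdist R n (time_index t'' n)) (\<lambda>E. K0 < susc n E)"
      by (rule pr_mono) (use elim in \<open>auto simp: K_def\<close>)
    then show ?case using elim by linarith
  qed
  have t'0: "0 \<le> t'" using t by simp
  from compare_processes[OF K t'0 \<epsilon>2, of R L k]
  obtain n0 where n0: "2 \<le> n0" "\<forall>n\<ge>n0. \<forall>m\<ge>n. \<forall>j. real j \<le> t' * real m \<longrightarrow>
      pr (lazy R n (real n / real m) j) (\<lambda>E. L + 1 \<le> trunc_susc k n E) *
      pr (gdist R m j) (\<lambda>E'. trunc_susc k m E' < L) \<le>
      \<epsilon>2 + (pr (lazy R n (real n / real m) j) (\<lambda>E. K < susc n E) + pr (gdist R m j) (\<lambda>E'. K < susc m E'))"
    by (elim exE conjE)
  (* half of the smaller gap, times n, is the deviation allowed to the number of lazy steps *)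
  define d where "d = min (t' - t) (t'' - t')"
  have d: "0 < d" "d \<le> t' - t" "d \<le> t'' - t'" using t by (auto simp: d_def)
  define \<epsilon>3 where "\<epsilon>3 = min \<epsilon>2 (1 / 2)"
  have \<epsilon>3: "0 < \<epsilon>3" using \<epsilon>2 by (simp add: \<epsilon>3_def)
  show "\<forall>\<^sub>F n in sequentially. pr (gdist R n (time_index t n)) (\<lambda>E. L + 1 \<le> trunc_susc k n E) < \<epsilon>"
    using KK eventually_binomial_error[OF d(1) \<epsilon>3, of t'] eventually_ge_at_top[of n0]
  proof eventually_elim
    case (elim n)
    have n: "2 \<le> n" "n0 \<le> n" using elim n0 by auto
    have "\<exists>\<^sub>F m in sequentially. \<gamma> \<le> ?low m \<and>
        (pr (gdist R m (time_index t'' m)) (\<lambda>E. K < susc m E) \<le> \<epsilon>2 \<and> n \<le> m)"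
      using \<gamma>(2) eventually_conj[OF KK eventually_ge_at_top[of n]] by (rule frequently_eventually_frequently)
    then obtain m where m: "\<gamma> \<le> ?low m"
      "pr (gdist R m (time_index t'' m)) (\<lambda>E. K < susc m E) \<le> \<epsilon>2" "n \<le> m"
      by (auto dest: frequently_ex)
    have m2: "2 \<le> m" using n m by simp
    define j where "j = time_index t' m"
    let ?p = "real n / real m"
    have p: "0 \<le> ?p" "?p \<le> 1" using n m by auto
    have j: "real j \<le> t' * real m" "t' * real m - 1 < real j"
      using time_index_bounds[OF t'0, of m] by (auto simp: j_def)
    have jp: "real j * ?p \<le> t' * n" "t' * n - 1 \<le> real j * ?p"
    proof -
      have "real j * ?p \<le> (t' * real m) * ?p" using j p by (intro mult_right_mono) auto
      also have "\<dots> = t' * n" using m2 by simp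
      finally show "real j * ?p \<le> t' * n" .
      have "t' * n - 1 \<le> t' * n - ?p" using p by simp
      also have "\<dots> = (t' * real m - 1) * ?p" using m2 by (simp add: field_simps)
      also have "\<dots> \<le> real j * ?p" using j p by (intro mult_right_mono) auto
      finally show "t' * n - 1 \<le> real j * ?p" .
    qed
    define D where "D = d / 2 * real n"
    have D: "1 < D" "t' * real n / D\<^sup>2 < \<epsilon>3" using elim(2) by (auto simp: D_def)
    have err: "real j * ?p / D\<^sup>2 \<le> \<epsilon>3"
      using divide_right_mono[OF jp(1), of "D\<^sup>2"] D by simp
    have dn: "2 * D \<le> (t' - t) * n" "2 * D \<le> (t'' - t') * n"
      using mult_right_mono[OF d(2), of "real n"] mult_right_mono[OF d(3), of "real n"] by (auto simp: D_def)
    let ?q = "pr (gdist R n (time_index t n)) (\<lambda>E. L + 1 \<le> trunc_susc k n E)"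
    let ?l = "pr (lazy R n ?p j) (\<lambda>E. L + 1 \<le> trunc_susc k n E)"
    have "(1 - real j * ?p / D\<^sup>2) * ?q \<le> ?l"
    proof (rule pr_lazy_ge[OF n(1) p])
      show "real (time_index t n) + D \<le> real j * ?p"
        using time_index_bounds(2)[OF t(1), of n] dn(1) jp(2) D(1) by (simp add: left_diff_distrib)
    next
      fix E E' assume "L + 1 \<le> trunc_susc k n E" and E': "E' \<in> set_pmf (graph_step R n E)"
      then show "L + 1 \<le> trunc_susc k n E'"
        using size_avg_step_mono[OF n(1) mono_trunc E', of k] by linarith
    qed (use D in simp)
    moreover have "1 / 2 * ?q \<le> (1 - real j * ?p / D\<^sup>2) * ?q"
      using err pr_nonneg by (intro mult_right_mono) (auto simp: \<epsilon>3_def)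
    ultimately have q: "1 / 2 * ?q \<le> ?l" by linarith
    have S: "pr (lazy R n ?p j) (\<lambda>E. K < susc n E) \<le>
        pr (gdist R n (time_index t'' n)) (\<lambda>E. K < susc n E) + real j * ?p / D\<^sup>2"
    proof (rule pr_lazy_le[OF n(1) p])
      show "real j * ?p + D \<le> real (time_index t'' n)"
        using time_index_bounds(1)[of t'' n] t dn(2) jp(1) D(1) by (simp add: left_diff_distrib)
    next
      fix E E' assume "K < susc n E" and E': "E' \<in> set_pmf (graph_step R n E)"
      then show "K < susc n E'"
        using size_avg_step_mono[OF n(1) mono_real E'] by linarith
    qed (use D in simp)
    have S': "pr (gdist R m j) (\<lambda>E'. K < susc m E') \<le> \<epsilon>2"
      using susc_persist[OF m2, of t' t'' R K] t m(2) unfolding j_def by linarith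
    have low: "\<gamma> \<le> pr (gdist R m j) (\<lambda>E'. trunc_susc k m E' < L)"
    proof -
      have "pr (gdist R m j) (\<lambda>E'. \<not> trunc_susc k m E' < L) \<le>
          pr (gdist R m (time_index tb m)) (\<lambda>E'. \<not> trunc_susc k m E' < L)"
        unfolding j_def
      proof (rule dist_from_persist[OF m2 time_index_mono])
        fix E E' assume P: "\<not> trunc_susc k m E < L" and E': "E' \<in> set_pmf (graph_step R m E)"
        show "\<not> trunc_susc k m E' < L"
          using P size_avg_step_mono[OF m2 mono_trunc E', of k] by linarith
      qed (use t in simp)
      then show ?thesis using m(1) m2 by (simp add: pr_not)
    qed
    have "1 / 2 * ?q * \<gamma> \<le> ?l * pr (gdist R m j) (\<lambda>E'. trunc_susc k m E' < L)"
      using q low \<gamma>(1) by (intro mult_mono) (auto intro: pr_nonneg)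
    also have "\<dots> \<le> \<epsilon>2 + (pr (lazy R n ?p j) (\<lambda>E. K < susc n E) + pr (gdist R m j) (\<lambda>E'. K < susc m E'))"
      by (rule n0(2)[rule_format, OF n(2) m(3) j(1)])
    also have "\<dots> \<le> 4 * \<epsilon>2"
      using S S' err elim(1) \<epsilon>3_def by linarith
    also have "\<dots> = \<gamma> * \<epsilon> / 4" by (simp add: \<epsilon>2_def)
    finally have "\<gamma> * (?q / 2) \<le> \<gamma> * (\<epsilon> / 4)" by (simp add: mult_ac)
    then have "?q / 2 \<le> \<epsilon> / 4" using \<gamma>(1) by simp
    then show ?case using \<epsilon> by linarith
  qed
qed

text \<open>Truncation at \<open>k\<close> changes the susceptibility by at most the second moment divided by \<open>k\<close>. The level \<open>k\<close> may be
chosen after the error probability, because the bound \<open>L + 1\<close> is the same for all levels; so the final bound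
\<open>L + 2\<close> depends neither on the error probability nor on the time.\<close>

lemma susc_upper_whp:
  assumes t: "0 \<le> t" "t < t''" "t'' \<le> tb" and tight: "susc_tight R t''"
    and L: "\<And>k. \<not> (\<lambda>n. pr (gdist R n (time_index tb n)) (\<lambda>E. trunc_susc k n E < L)) \<longlonglongrightarrow> 0"
  shows "(\<lambda>n. pr (gdist R n (time_index t n)) (\<lambda>E. L + 2 < susc n E)) \<longlonglongrightarrow> 0"
proof (rule pr_tendsto_0I)
  fix \<epsilon> :: real assume \<epsilon>: "0 < \<epsilon>"
  then have \<epsilon>3: "0 < \<epsilon> / 3" by simp
  have "susc_tight R t" using tight by (rule susc_tight_mono) (use t in simp)
  from susc2_tight[OF this t(1) \<epsilon>3] obtain A where A: "0 < A"
    "\<forall>\<^sub>F n in sequentially. pr (gdist R n (time_index t n)) (\<lambda>E. A < susc2 n E) \<le> \<epsilon> / 3" by blast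
  (* truncation at k loses at most 1 when the second moment is at most A *)
  define k where "k = nat \<lceil>A\<rceil>"
  have k: "A \<le> k" unfolding k_def by (rule real_nat_ceiling_ge)
  obtain t' where t': "t < t'" "t' < t''" using t dense by blast
  have "(\<lambda>n. pr (gdist R n (time_index t n)) (\<lambda>E. L + 1 \<le> trunc_susc k n E)) \<longlonglongrightarrow> 0"
    by (rule trunc_susc_upper_whp[OF t(1) t' t(3) tight L])
  then have "\<forall>\<^sub>F n in sequentially. pr (gdist R n (time_index t n)) (\<lambda>E. L + 1 \<le> trunc_susc k n E) < \<epsilon> / 3"
    using \<epsilon>3 by (rule order_tendstoD)
  then show "\<forall>\<^sub>F n in sequentially. pr (gdist R n (time_index t n)) (\<lambda>E. L + 2 < susc n E) < \<epsilon>"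
    using A(2) eventually_ge_at_top[of 2]
  proof eventually_elim
    case (elim n)
    let ?g = "gdist R n (time_index t n)"
    have diff: "susc n E - trunc_susc k n E \<le> susc2 n E / A" for E
    proof -
      have "susc n E - trunc_susc k n E = size_avg n E (\<lambda>c. real c - real (min c k))"
        by (simp only: size_avg_diff)
      also have "\<dots> \<le> size_avg n E (\<lambda>c. 1 / A * (real c)\<^sup>2)"
      proof (rule size_avg_mono)
        fix c :: nat
        show "real c - real (min c k) \<le> 1 / A * (real c)\<^sup>2"
        proof (cases "c \<le> k")
          case False
          have "A * real c \<le> real c * real c" using False k by (intro mult_right_mono) auto
          then have "real c \<le> 1 / A * (real c)\<^sup>2" using A(1) by (simp add: field_simps power2_eq_square)
          then show ?thesis by linarith
        qed (use A(1) in simp)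
      qed
      also have "\<dots> = susc2 n E / A" unfolding size_avg_cmult by simp
      finally show ?thesis .
    qed
    have "pr ?g (\<lambda>E. L + 2 < susc n E) \<le>
        pr ?g (\<lambda>E. L + 1 \<le> trunc_susc k n E) + pr ?g (\<lambda>E. A < susc2 n E)"
    proof (rule pr_Un)
      fix E assume "L + 2 < susc n E"
      then show "L + 1 \<le> trunc_susc k n E \<or> A < susc2 n E"
      proof (cases "L + 1 \<le> trunc_susc k n E")
        case False
        then have "1 < susc2 n E / A" using diff[of E] \<open>L + 2 < susc n E\<close> by linarith
        then show ?thesis using A(1) by (simp add: field_simps)
      qed simp
    qed (use elim in simp)
    then show ?case using elim(1,2) \<epsilon> by linarith
  qed
qed

lemma susc_tight_0: "susc_tight R 0"
  unfolding susc_tight_def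
proof (intro allI impI exI)
  fix \<epsilon> :: real assume \<epsilon>: "0 < \<epsilon>"
  show "\<forall>\<^sub>F n in sequentially. pr (gdist R n (time_index 0 n)) (\<lambda>E. 1 < susc n E) \<le> \<epsilon>"
    using eventually_gt_at_top[of 0]
    by eventually_elim (use \<epsilon> in \<open>simp add: time_index_def size_avg_empty\<close>)
qed

lemma t_b_eq: "t_b R = Sup {t. 0 \<le> t \<and> susc_tight R t}"
  unfolding t_b_def bounded_in_prob_iff ..

lemma susc_tight_le_t_b: "0 \<le> t \<Longrightarrow> susc_tight R t \<Longrightarrow> t \<le> t_b R"
  unfolding t_b_eq by (rule cSup_upper) (auto intro!: bdd_aboveI susc_tight_le_2)

lemma susc_tight_below_t_b:
  assumes "t < t_b R"
  obtains t'' where "t < t''" "t'' \<le> t_b R" "susc_tight R t''"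
proof -
  obtain t'' where "t'' \<in> {t. 0 \<le> t \<and> susc_tight R t}" "t < t''"
    using less_cSupD[of "{t. 0 \<le> t \<and> susc_tight R t}" t] assms susc_tight_0 unfolding t_b_eq by blast
  then show ?thesis using that susc_tight_le_t_b by blast
qed

lemma t_b_pos: "0 < t_b R"
proof -
  have "pr (gdist R n (time_index 0 n)) (\<lambda>E. 1 < susc n E) = 0" if "1 \<le> n" for n
    using that by (simp add: time_index_def size_avg_empty)
  then have "\<forall>\<^sub>F n in sequentially. pr (gdist R n (time_index 0 n)) (\<lambda>E. 1 < susc n E) = 0"
    by (rule eventually_sequentiallyI)
  then have "(\<lambda>n. pr (gdist R n (time_index 0 n)) (\<lambda>E. 1 < susc n E)) \<longlonglongrightarrow> 0"
    by (rule tendsto_eventually)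
  from susc_tight_extend[OF susc_tight_0 order.refl _ this]
  have "susc_tight R (1 / 128)" by simp
  then have "1 / 128 \<le> t_b R" by (intro susc_tight_le_t_b) auto
  then show ?thesis by linarith
qed

text \<open>This is where the definition of \<open>t_b\<close> enters. If no level \<open>k\<close> worked, the susceptibility would be at most
\<open>M = L + 2\<close> with high probability at all times before \<open>t_b\<close>, with a bound that does not deteriorate as
\<open>t_b\<close> is approached. Starting from a time within \<open>1/(256M)\<close> of \<open>t_b\<close>, it would stay bounded in
probability beyond \<open>t_b\<close>.\<close>

lemma trunc_susc_blowup:
  "\<exists>k. (\<lambda>n. pr (gdist R n (time_index (t_b R) n)) (\<lambda>E. trunc_susc k n E < K)) \<longlonglongrightarrow> 0"
proof (rule ccontr)
  assume H: "\<not> ?thesis"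
  define L where "L = max K 0"
  have L: "\<not> (\<lambda>n. pr (gdist R n (time_index (t_b R) n)) (\<lambda>E. trunc_susc k n E < L)) \<longlonglongrightarrow> 0" for k
  proof
    assume lim: "(\<lambda>n. pr (gdist R n (time_index (t_b R) n)) (\<lambda>E. trunc_susc k n E < L)) \<longlonglongrightarrow> 0"
    have "pr (gdist R n (time_index (t_b R) n)) (\<lambda>E. trunc_susc k n E < K) \<le>
        pr (gdist R n (time_index (t_b R) n)) (\<lambda>E. trunc_susc k n E < L)" if "2 \<le> n" for n
      using that by (intro pr_mono) (auto simp: L_def)
    then have "\<forall>\<^sub>F n in sequentially. pr (gdist R n (time_index (t_b R) n)) (\<lambda>E. trunc_susc k n E < K) \<le>
        pr (gdist R n (time_index (t_b R) n)) (\<lambda>E. trunc_susc k n E < L)" by (rule eventually_sequentiallyI)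
    then have "(\<lambda>n. pr (gdist R n (time_index (t_b R) n)) (\<lambda>E. trunc_susc k n E < K)) \<longlonglongrightarrow> 0"
      by (rule tendsto_sandwich[OF always_eventually[OF allI[OF pr_nonneg]] _ tendsto_const lim])
    then show False using H by blast
  qed
  define M where "M = L + 2"
  have M: "0 < M" by (simp add: M_def L_def)
  define t where "t = max 0 (t_b R - 1 / (256 * M))"
  have t: "0 \<le> t" "t < t_b R" using t_b_pos[of R] M by (auto simp: t_def)
  obtain t'' where t'': "t < t''" "t'' \<le> t_b R" "susc_tight R t''" using susc_tight_below_t_b[OF t(2)] .
  have "(\<lambda>n. pr (gdist R n (time_index t n)) (\<lambda>E. M < susc n E)) \<longlonglongrightarrow> 0"
    unfolding M_def by (rule susc_upper_whp[OF t(1) t'' L])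
  then have "susc_tight R (t + 1 / (128 * M))"
    using susc_tight_extend[OF susc_tight_mono[OF t''(3) less_imp_le[OF t''(1)]] t(1) M] by blast
  then have "t + 1 / (128 * M) \<le> t_b R" using t M by (intro susc_tight_le_t_b) auto
  moreover have "t_b R - 1 / (256 * M) \<le> t" by (simp add: t_def)
  moreover have "1 / (256 * M) < 1 / (128 * M)" using M by (simp add: field_simps)
  ultimately show False by linarith
qed

section \<open>The percolation threshold\<close>

lemma L1_sublinear_below_t_b:
  assumes t: "0 \<le> t" "t < t_b R"
  shows "tends_to_0_in_prob choices (\<lambda>n \<omega>. real (L1 n (graph_at R n t \<omega>)) / real n)"
  unfolding tends_to_0_in_prob_def
proof (intro allI impI)
  fix \<epsilon> :: real assume \<epsilon>: "0 < \<epsilon>"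
  obtain t'' where "t < t''" "susc_tight R t''" using susc_tight_below_t_b[OF t(2)] by blast
  then have tight: "susc_tight R t" using susc_tight_mono by fastforce
  have P: "\<P>(\<omega> in choices n. \<epsilon> < \<bar>real (L1 n (graph_at R n t \<omega>)) / real n\<bar>) =
      pr (gdist R n (time_index t n)) (\<lambda>E. \<epsilon> < real (L1 n E) / real n)" for n
    using prob_graph[where n = n and R = R and i = "time_index t n" and P = "\<lambda>E. \<epsilon> < \<bar>real (L1 n E) / real n\<bar>"]
    by (simp add: graph_at_def time_index_def)
  show "(\<lambda>n. \<P>(\<omega> in choices n. \<epsilon> < \<bar>real (L1 n (graph_at R n t \<omega>)) / real n\<bar>)) \<longlonglongrightarrow> 0"
    unfolding P
  proof (rule pr_tendsto_0I)
    fix x :: real assume x: "0 < x"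
    then obtain K where K: "\<forall>\<^sub>F n in sequentially. pr (gdist R n (time_index t n)) (\<lambda>E. K < susc n E) \<le> x / 2"
      using tight[unfolded susc_tight_def] half_gt_zero by blast
    have "(\<lambda>n. K / \<epsilon>\<^sup>2 / real n) \<longlonglongrightarrow> 0" by (rule lim_const_over_n)
    then have "\<forall>\<^sub>F n in sequentially. K / \<epsilon>\<^sup>2 / real n < 1" by (rule order_tendstoD) simp
    then show "\<forall>\<^sub>F n in sequentially. pr (gdist R n (time_index t n)) (\<lambda>E. \<epsilon> < real (L1 n E) / real n) < x"
      using K eventually_ge_at_top[of 2]
    proof eventually_elim
      case (elim n)
      have "K < susc n E" if "\<epsilon> < real (L1 n E) / real n" for E
      proof -
        have "\<epsilon> * n < L1 n E" using that elim(3) by (simp add: field_simps)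
        then have "(\<epsilon> * n)\<^sup>2 < (real (L1 n E))\<^sup>2" using \<epsilon> by (intro power_strict_mono) auto
        also have "\<dots> \<le> n * susc n E" using L1_square_le[of n E] elim(3) by (simp add: susceptibility_eq)
        finally have "\<epsilon>\<^sup>2 * n < susc n E"
          using elim(3) by (simp add: power_mult_distrib power2_eq_square)
        moreover have "K < \<epsilon>\<^sup>2 * n" using elim(1,3) \<epsilon> by (simp add: field_simps)
        ultimately show ?thesis by linarith
      qed
      then have "pr (gdist R n (time_index t n)) (\<lambda>E. \<epsilon> < real (L1 n E) / real n) \<le>
          pr (gdist R n (time_index t n)) (\<lambda>E. K < susc n E)"
        using elim(3) by (intro pr_mono) auto
      then show ?case using elim(2) x by linarith
    qed
  qed
qed

lemma giant_above_t_b: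
  assumes "take_it_or_leave_it R" "0 < \<epsilon>"
  shows "\<exists>\<alpha>>0. (\<lambda>n. \<P>(\<omega> in choices n. real (L1 n (graph_at R n (t_b R + \<epsilon>) \<omega>)) \<ge> \<alpha> * real n)) \<longlonglongrightarrow> 1"
proof -
  obtain \<alpha> where \<alpha>: "0 < \<alpha>" "(\<lambda>n. pr (gdist R n (time_index (t_b R + \<epsilon>) n))
      (\<lambda>E. \<alpha> * real n \<le> real (L1 n E))) \<longlonglongrightarrow> 1"
    using giant_after_blowup[OF assms(1) t_b_pos assms(2) trunc_susc_blowup] by blast
  have "\<P>(\<omega> in choices n. real (L1 n (graph_at R n (t_b R + \<epsilon>) \<omega>)) \<ge> \<alpha> * real n) =
      pr (gdist R n (time_index (t_b R + \<epsilon>) n)) (\<lambda>E. \<alpha> * real n \<le> real (L1 n E))" for n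
    using prob_graph[where n = n and R = R and i = "time_index (t_b R + \<epsilon>) n" and P = "\<lambda>E. \<alpha> * real n \<le> real (L1 n E)"]
    by (simp add: graph_at_def time_index_def)
  then show ?thesis using \<alpha> by (intro exI[of _ \<alpha>]) simp
qed

lemma t_c_eq_t_b:
  assumes R: "take_it_or_leave_it R"
  shows "t_b R = t_c R"
proof -
  let ?C = "{t. t \<ge> 0 \<and> tends_to_0_in_prob choices (\<lambda>n \<omega>. real (L1 n (graph_at R n t \<omega>)) / real n)}"
  have upper: "t \<le> t_b R" if "t \<in> ?C" for t
  proof (rule ccontr)
    assume "\<not> t \<le> t_b R"
    then have pos: "0 < t - t_b R" by simp
    have eq: "t_b R + (t - t_b R) = t" by simp
    from giant_above_t_b[OF R pos, unfolded eq] obtain \<alpha> where \<alpha>: "0 < \<alpha>"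
      "(\<lambda>n. \<P>(\<omega> in choices n. real (L1 n (graph_at R n t \<omega>)) \<ge> \<alpha> * real n)) \<longlonglongrightarrow> 1"
      by (elim exE conjE)
    let ?a = "\<lambda>n. \<P>(\<omega> in choices n. real (L1 n (graph_at R n t \<omega>)) \<ge> \<alpha> * real n)"
    let ?b = "\<lambda>n. \<P>(\<omega> in choices n. \<alpha> / 2 < \<bar>real (L1 n (graph_at R n t \<omega>)) / real n\<bar>)"
    have a: "?a n = pr (gdist R n (time_index t n)) (\<lambda>E. \<alpha> * real n \<le> real (L1 n E))" for n
      using prob_graph[where n = n and R = R and i = "time_index t n" and P = "\<lambda>E. \<alpha> * real n \<le> real (L1 n E)"]
      by (simp add: graph_at_def time_index_def)
    have b: "?b n = pr (gdist R n (time_index t n)) (\<lambda>E. \<alpha> / 2 < \<bar>real (L1 n E) / real n\<bar>)" for n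
      using prob_graph[where n = n and R = R and i = "time_index t n" and P = "\<lambda>E. \<alpha> / 2 < \<bar>real (L1 n E) / real n\<bar>"]
      by (simp add: graph_at_def time_index_def)
    have "?a n \<le> ?b n" if n: "2 \<le> n" for n
      unfolding a b
    proof (rule pr_mono)
      fix E assume "\<alpha> * real n \<le> real (L1 n E)"
      then have "\<alpha> \<le> real (L1 n E) / real n" using n by (simp add: field_simps)
      then show "\<alpha> / 2 < \<bar>real (L1 n E) / real n\<bar>" using \<alpha>(1) by linarith
    qed (use n in simp)
    then have "\<forall>\<^sub>F n in sequentially. ?a n \<le> ?b n" by (rule eventually_sequentiallyI)
    moreover have "?b \<longlonglongrightarrow> 0"
    proof -
      have "tends_to_0_in_prob choices (\<lambda>n \<omega>. real (L1 n (graph_at R n t \<omega>)) / real n)"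
        using that by simp
      from this[unfolded tends_to_0_in_prob_def, rule_format, of "\<alpha> / 2"] show ?thesis
        using \<alpha>(1) by simp
    qed
    ultimately have "(1::real) \<le> 0"
      using tendsto_le[OF sequentially_bot _ \<alpha>(2)] by blast
    then show False by simp
  qed
  have mem: "t \<in> ?C" if "0 \<le> t" "t < t_b R" for t
    by (intro CollectI conjI L1_sublinear_below_t_b that)
  have zero: "0 \<in> ?C" by (rule mem[OF order.refl t_b_pos])
  have "Sup ?C = t_b R"
  proof (rule cSup_eq_non_empty)
    show "?C \<noteq> {}" using zero by (metis empty_iff)
    show "\<And>x. x \<in> ?C \<Longrightarrow> x \<le> t_b R" by (rule upper)
    fix y assume y: "\<And>x. x \<in> ?C \<Longrightarrow> x \<le> y"
    show "t_b R \<le> y"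
    proof (rule ccontr)
      assume "\<not> t_b R \<le> y"
      then have "y < t_b R" by simp
      from dense[OF this] obtain x where x: "y < x" "x < t_b R" by (elim exE conjE)
      then have "0 \<le> x" using y[OF zero] by linarith
      then have "x \<in> ?C" using x(2) by (rule mem)
      from y[OF this] x(1) show False by linarith
    qed
  qed
  then show ?thesis unfolding t_c_def by (rule sym)
qed

theorem theorem16:
  fixes R :: size_rule
  assumes "take_it_or_leave_it R"
  shows "t_b R = t_c R
    \<and> (\<forall>t \<epsilon> :: real. t > t_b R \<longrightarrow> \<epsilon> > 0 \<longrightarrow>
         (\<exists>\<delta>>0. \<exists>n0>0. \<forall>n\<ge>n0.
            \<P>(\<omega> in choices n. real (L1 n (graph_at R n t \<omega>)) \<ge> \<delta> * real n) \<ge> 1 - \<epsilon>))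
    \<and> (\<forall>\<epsilon>>0. \<exists>\<alpha>>0.
         (\<lambda>n. \<P>(\<omega> in choices n. real (L1 n (graph_at R n (t_b R + \<epsilon>) \<omega>)) \<ge> \<alpha> * real n))
           \<longlonglongrightarrow> 1)"
proof (intro conjI allI impI)
  show "t_b R = t_c R" using assms by (rule t_c_eq_t_b)
next
  fix t \<epsilon> :: real assume t: "t > t_b R" and \<epsilon>: "\<epsilon> > 0"
  then have pos: "0 < t - t_b R" by simp
  have eq: "t_b R + (t - t_b R) = t" by simp
  from giant_above_t_b[OF assms pos, unfolded eq] obtain \<delta> where \<delta>: "0 < \<delta>"
    "(\<lambda>n. \<P>(\<omega> in choices n. real (L1 n (graph_at R n t \<omega>)) \<ge> \<delta> * real n)) \<longlonglongrightarrow> 1"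
    by (elim exE conjE)
  have "\<forall>\<^sub>F n in sequentially. 1 - \<epsilon> < \<P>(\<omega> in choices n. real (L1 n (graph_at R n t \<omega>)) \<ge> \<delta> * real n)"
    using \<delta>(2) by (rule order_tendstoD) (use \<epsilon> in simp)
  then obtain n1 where n1: "\<forall>n\<ge>n1.
      1 - \<epsilon> < \<P>(\<omega> in choices n. real (L1 n (graph_at R n t \<omega>)) \<ge> \<delta> * real n)"
    unfolding eventually_sequentially by (elim exE)
  show "\<exists>\<delta>>0. \<exists>n0>0. \<forall>n\<ge>n0.
      \<P>(\<omega> in choices n. real (L1 n (graph_at R n t \<omega>)) \<ge> \<delta> * real n) \<ge> 1 - \<epsilon>"
  proof (intro exI[of _ \<delta>] conjI exI[of _ "Suc n1"] allI impI)
    fix n assume "Suc n1 \<le> n"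
    then show "\<P>(\<omega> in choices n. real (L1 n (graph_at R n t \<omega>)) \<ge> \<delta> * real n) \<ge> 1 - \<epsilon>"
      using n1[rule_format, of n] by linarith
  qed (use \<delta>(1) in simp_all)
next
  fix \<epsilon> :: real assume "\<epsilon> > 0"
  with assms show "\<exists>\<alpha>>0. (\<lambda>n. \<P>(\<omega> in choices n.
      real (L1 n (graph_at R n (t_b R + \<epsilon>) \<omega>)) \<ge> \<alpha> * real n)) \<longlonglongrightarrow> 1"
    by (rule giant_above_t_b)
qed

end
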